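(* Let $k\ge2$, $\alpha,\beta>0$, and let $p$ be a polynomial on $\mathbb{R}^2\cong\mathbb{C}$ invariant under $I_{2k}$. For $b\ge0$ and $\xi\in[-1,1]$ let $q=\arccos\xi$, $\lambda=\alpha+\beta$, and $$g(b,\xi)=\tfrac12\Big[\Phi_2^{(k)}\big(\lambda,\dots,\lambda;k\lambda;\big(b\cos\tfrac{q-2j\pi}{k}\big)_{j=0}^{k-1}\big)+\Phi_2^{(k)}\big(\lambda,\dots,\lambda;k\lambda;\big(b\cos\tfrac{\pi-q-2j\pi}{k}\big)_{j=0}^{k-1}\big)\Big].$$ For $z=|z|e^{i\phi_1}$ and $u,v\in[-1,1]$, the function $w=|w|e^{i\phi_2}\mapsto J_{u,v}(z,w):=g\big(|zw|,\xi_{u,v}(k\phi_1,k\phi_2)\big)$ is given by an everywhere convergent power series in the coordinates of $w$. Put $p_{u,v}(z):=[p(w),J_{u,v}(z,w)]_0=\big(p(\partial_w)J_{u,v}(z,w)\big)\big|_{w=0}$. Then $$V_\kappa(p)(z)=\int_{-1}^1\int_{-1}^1p_{u,v}(z)\,d\nu^\alpha(u)\,d\nu^\beta(v),$$ and moreover $p_{u,v}(z)=\frac1{2\pi}\int_{\mathbb{R}^2}\mathcal F\big(e^{-|\cdot|^2/2}J_{u,v}(z,\cdot)\big)(y)\,\mathcal F\big(e^{-|\cdot|^2/2}p\big)(y)\,e^{|y|^2/2}dy$.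
   Context: Identify $\mathbb{R}^2$ with $\mathbb{C}$, $\langle z,w\rangle=\mathrm{Re}(z\bar w)$. The dihedral group $I_{2k}$ (order $4k$) contains the reflections $z\mapsto\bar ze^{ij\pi/k}$, $j=0,\dots,2k-1$, forming two conjugacy classes ($j$ even, containing $z\mapsto\bar z$; $j$ odd); $\kappa=(\alpha,\beta)$ is $\alpha$ on the class with $j$ even and $\beta$ on the class with $j$ odd. $V_\kappa$ is the Dunkl intertwining operator (unique degree-preserving linear isomorphism of polynomials with $V_\kappa1=1$, $T_jV_\kappa=V_\kappa\partial_j$ for the Dunkl operators $T_j$). $p(\partial_w)$ is obtained from $p$ by replacing the coordinates of $w$ by the corresponding partial derivatives. $d\nu^\alpha(u)=\frac{\Gamma(\alpha+1/2)}{\sqrt\pi\Gamma(\alpha)}(1-u^2)^{\alpha-1}du$ on $[-1,1]$. $\xi_{u,v}(\theta_1,\theta_2)=v\cos\theta_1\cos\theta_2+u\sin\theta_1\sin\theta_2$. Humbert function $\Phi_2^{(m)}(\beta_1,\dots,\beta_m;\gamma;x_1,\dots,x_m)=\sum_{j_i\ge0}\frac{(\beta_1)_{j_1}\cdots(\beta_m)_{j_m}}{(\gamma)_{j_1+\cdots+j_m}}\prod_i\frac{x_i^{j_i}}{j_i!}$. Fourier transform $\mathcal Ff(y)=\frac1{2\pi}\int_{\mathbb{R}^2}e^{-i\langle x,y\rangle}f(x)dx$. *)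

theory Defs
  imports "HOL-Analysis.Analysis"
begin

definition poly_rep :: "(nat \<times> nat \<Rightarrow> real) \<Rightarrow> (complex \<Rightarrow> real) \<Rightarrow> bool" where
  "poly_rep c f \<longleftrightarrow> finite {ij. c ij \<noteq> 0} \<and>
     (\<forall>x. f x = (\<Sum>(i,j)\<in>{ij. c ij \<noteq> 0}. c (i,j) * Re x ^ i * Im x ^ j))"

definition polyfun :: "(complex \<Rightarrow> real) \<Rightarrow> bool" where
  "polyfun f \<longleftrightarrow> (\<exists>c. poly_rep c f)"

definition homog_polyfun :: "nat \<Rightarrow> (complex \<Rightarrow> real) \<Rightarrow> bool" where
  "homog_polyfun n f \<longleftrightarrow> (\<exists>c. poly_rep c f \<and> (\<forall>i j. c (i,j) \<noteq> 0 \<longrightarrow> i + j = n))"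

definition poly_coeffs :: "(complex \<Rightarrow> real) \<Rightarrow> (nat \<times> nat \<Rightarrow> real)" where
  "poly_coeffs f = (SOME c. poly_rep c f)"

definition pderiv_dir :: "complex \<Rightarrow> (complex \<Rightarrow> real) \<Rightarrow> complex \<Rightarrow> real" where
  "pderiv_dir e f x = deriv (\<lambda>t. f (x + of_real t * e)) 0"

definition poly_diff_op :: "(complex \<Rightarrow> real) \<Rightarrow> (complex \<Rightarrow> real) \<Rightarrow> complex \<Rightarrow> real" where
  "poly_diff_op p g w =
     (let c = poly_coeffs p in
      \<Sum>(i,j)\<in>{ij. c ij \<noteq> 0}. c (i,j) * ((pderiv_dir 1 ^^ i) ((pderiv_dir \<i> ^^ j) g)) w)"

definition dih_refl :: "nat \<Rightarrow> nat \<Rightarrow> complex \<Rightarrow> complex" where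
  "dih_refl k j z = cnj z * cis (real j * pi / real k)"

text \<open>A root (unit normal of the mirror) of reflection j.\<close>
definition dih_root :: "nat \<Rightarrow> nat \<Rightarrow> complex" where
  "dih_root k j = cis (real j * pi / (2 * real k) + pi / 2)"

definition dih_kappa :: "real \<Rightarrow> real \<Rightarrow> nat \<Rightarrow> real" where
  "dih_kappa a b j = (if even j then a else b)"

definition dunkl :: "nat \<Rightarrow> real \<Rightarrow> real \<Rightarrow> complex \<Rightarrow> (complex \<Rightarrow> real) \<Rightarrow> complex \<Rightarrow> real" where
  "dunkl k a b e f x = pderiv_dir e f x +
     (\<Sum>j<2*k. dih_kappa a b j * (dih_root k j \<bullet> e) *
        (f x - f (dih_refl k j x)) / (dih_root k j \<bullet> x))"

text \<open>V is a Dunkl intertwining operator: a degree-preserving linear isomorphism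
  of the polynomials with V 1 = 1 and T_e V = V d_e (the identity is required off the
  mirrors, where the difference quotients are defined).\<close>
definition is_intertwiner :: "nat \<Rightarrow> real \<Rightarrow> real \<Rightarrow> ((complex \<Rightarrow> real) \<Rightarrow> (complex \<Rightarrow> real)) \<Rightarrow> bool" where
  "is_intertwiner k a b V \<longleftrightarrow>
     bij_betw V {f. polyfun f} {f. polyfun f} \<and>
     (\<forall>f g s t. polyfun f \<longrightarrow> polyfun g \<longrightarrow>
        V (\<lambda>x. s * f x + t * g x) = (\<lambda>x. s * V f x + t * V g x)) \<and>
     (\<forall>n f. homog_polyfun n f \<longrightarrow> homog_polyfun n (V f)) \<and>
     V (\<lambda>_. 1) = (\<lambda>_. 1) \<and>
     (\<forall>e\<in>Basis. \<forall>f. polyfun f \<longrightarrow> (\<forall>x. (\<forall>j<2*k. dih_root k j \<bullet> x \<noteq> 0) \<longrightarrow>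
        dunkl k a b e (V f) x = V (pderiv_dir e f) x))"

definition humbert_Phi2 :: "nat \<Rightarrow> (nat \<Rightarrow> real) \<Rightarrow> real \<Rightarrow> (nat \<Rightarrow> real) \<Rightarrow> real" where
  "humbert_Phi2 m bet gam x =
     infsum (\<lambda>js. (\<Prod>i<m. pochhammer (bet i) (js i) * x i ^ js i / fact (js i))
                  / pochhammer gam (\<Sum>i<m. js i))
            (PiE {..<m} (\<lambda>_. UNIV))"

definition g_fun :: "nat \<Rightarrow> real \<Rightarrow> real \<Rightarrow> real \<Rightarrow> real \<Rightarrow> real" where
  "g_fun k a b r \<xi> =
     (let q = arccos \<xi>; l = a + b in
      (humbert_Phi2 k (\<lambda>_. l) (real k * l)
          (\<lambda>j. r * cos ((q - 2 * real j * pi) / real k))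
     + humbert_Phi2 k (\<lambda>_. l) (real k * l)
          (\<lambda>j. r * cos ((pi - q - 2 * real j * pi) / real k))) / 2)"

definition xi_uv :: "real \<Rightarrow> real \<Rightarrow> real \<Rightarrow> real \<Rightarrow> real" where
  "xi_uv u v t1 t2 = v * cos t1 * cos t2 + u * sin t1 * sin t2"

definition J_uv :: "nat \<Rightarrow> real \<Rightarrow> real \<Rightarrow> real \<Rightarrow> real \<Rightarrow> complex \<Rightarrow> complex \<Rightarrow> real" where
  "J_uv k a b u v z w = g_fun k a b (cmod (z * w)) (xi_uv u v (real k * Arg z) (real k * Arg w))"

definition p_uv :: "nat \<Rightarrow> real \<Rightarrow> real \<Rightarrow> (complex \<Rightarrow> real) \<Rightarrow> real \<Rightarrow> real \<Rightarrow> complex \<Rightarrow> real" where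
  "p_uv k a b p u v z = poly_diff_op p (J_uv k a b u v z) 0"

definition nu_const :: "real \<Rightarrow> real" where
  "nu_const a = Gamma (a + 1/2) / (sqrt pi * Gamma a)"

definition fourier2 :: "(complex \<Rightarrow> real) \<Rightarrow> complex \<Rightarrow> complex" where
  "fourier2 f y = (1 / (2 * pi)) * integral\<^sup>L lborel (\<lambda>x. exp (- \<i> * of_real (x \<bullet> y)) * of_real (f x))"

end

theory Submission
  imports Defs "HOL-Probability.Characteristic_Functions"
begin

text \<open>
  Write \<open>\<lambda> = a + b\<close>. As the numbers \<open>cos ((q - 2 j \<pi>) / k)\<close> are the roots of \<open>T\<^sub>k - cos q\<close>, with \<open>T\<^sub>k\<close> the
  Chebyshev polynomial, the generating product \<open>\<Prod>\<^sub>j (1 - s r cos ((q - 2 j \<pi>) / k))\<close> of the Humbert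
  function is \<open>A(s) - 2 (r s / 2) ^ k cos q\<close> with an even polynomial \<open>A\<close> independent of \<open>q\<close>. Expanding its
  power \<open>- \<lambda>\<close> shows that \<open>J_uv\<close> is an entire series in \<open>w\<close>, with coefficients polynomial in \<open>u\<close> and \<open>v\<close>.

  The operator \<open>V\<close> is pinned down by Euler's identity: for \<open>F\<^sub>n(z) = V((x \<bullet> w) ^ n)(z)\<close> one has
  \<open>n F\<^sub>n(z) + \<Sum>\<^sub>j \<kappa>\<^sub>j (F\<^sub>n(z) - F\<^sub>n(\<sigma>\<^sub>j z)) = n (z \<bullet> w) F\<^sub>n\<^sub>-\<^sub>1(z)\<close>, and a maximum argument on the orbit of \<open>z\<close>
  shows that this recursion has only one solution. An explicit solution is obtained from the
  intertwining operator of the group \<open>Z\<^sub>2 \<times> Z\<^sub>2\<close> acting on \<open>z ^ k\<close>. Averaging it over the dihedral group gives the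
  integral of \<open>J_uv\<close> against the two measures, degree by degree.

  For the Fourier formula, the transform of \<open>x ^ n exp (- x\<^sup>2 / 2)\<close> is a Hermite polynomial times the Gaussian, and
  orthogonality of the Hermite polynomials turns the integral into the pairing \<open>p(\<partial>) J_uv\<close> at 0.
\<close>

unbundle no vec_syntax
unbundle fps_syntax

section \<open>Real powers of formal power series\<close>

text \<open>With K = k \<lambda>, rescaling \<open>F\<^sub>n\<close> by
  \<open>pochhammer (K + 1) n / fact n\<close> changes the factor n on the right of Euler's identity
  into n + K. Multiplying the generating series by 1 - (z . w) s then absorbs that right side, and
  the recursion becomes an identity of formal power series. Reflections with even j act on
  \<open>z ^ k\<close> as conjugation, those with odd j as negated conjugation; this is how Z2 x Z2
  with multiplicities a and b enters.

  Two obstacles shape the proof. The intertwining relation is available off the mirrors only, so V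
  is computed where \<open>z ^ (2 * k)\<close> is not real, and the result is extended by
  continuity. And J is written with \<open>Arg\<close> and \<open>arccos\<close>, which hides its
  analyticity in w; all angles are eliminated in favour of |zw| and the k-th powers of z and w, and
  odd powers of |w| drop out because A is even.

  No limit has to be exchanged with the integrals over u and v: the coefficients of J in w are
  finite sums, linear in a table T. With the monomials in u and v as T they give J, with the moments
  as T they give the group average of V.\<close>

definition fps_rpow :: "real fps \<Rightarrow> real \<Rightarrow> real fps" where
  "fps_rpow f c = fps_binomial c oo (f - 1)"

lemma fps_rpow_nth_0 [simp]: "fps_rpow f c $ 0 = 1"
  by (simp add: fps_rpow_def)

text \<open>\<open>f $ 0 = 1\<close> makes \<open>f - 1\<close> an admissible inner series, so
  composition is multiplicative and the exponent law of \<open>fps_binomial\<close> carries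
  over.\<close>

lemma fps_rpow_add:
  assumes "f $ 0 = 1"
  shows "fps_rpow f (c + d) = fps_rpow f c * fps_rpow f d"
  using assms by (simp add: fps_rpow_def fps_binomial_add_mult fps_compose_mult_distrib)

lemma fps_rpow_0 [simp]: "fps_rpow f 0 = 1"
  by (simp add: fps_rpow_def)

lemma fps_rpow_1:
  assumes "f $ 0 = 1"
  shows "fps_rpow f 1 = f"
  using assms by (simp add: fps_rpow_def fps_binomial_1 fps_compose_add_distrib fps_X_fps_compose_startby0)

lemma fps_rpow_minus_1:
  assumes "f $ 0 = 1"
  shows "fps_rpow f (- 1) = inverse f"
proof -
  have "fps_rpow f (- 1) * f = 1"
    using fps_rpow_add[OF assms, of "-1" 1] fps_rpow_1[OF assms] by simp
  thus ?thesis by (metis fps_inverse_unique mult.commute)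
qed

lemma fps_rpow_minus_of_nat:
  assumes "f $ 0 = 1"
  shows "fps_rpow f (- real m) = inverse f ^ m"
proof (induction m)
  case (Suc m)
  have "fps_rpow f (- real (Suc m)) = fps_rpow f (- 1 + - real m)" by simp
  also have "\<dots> = inverse f ^ Suc m"
    by (simp only: fps_rpow_add[OF assms] fps_rpow_minus_1[OF assms] Suc power_Suc)
  finally show ?case .
qed simp

text \<open>The chain rule transports \<open>(1 + X) B' = c B\<close>, the equation of the binomial
  series B, to the inner series \<open>f - 1\<close>. Keeping f on the left avoids a division and
  fits the uniqueness lemma below.\<close>

lemma fps_rpow_deriv:
  assumes "f $ 0 = 1"
  shows "f * fps_deriv (fps_rpow f c) = fps_const c * fps_deriv f * fps_rpow f c"
proof -
  have z: "(f - 1) $ 0 = 0" using assms by simp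
  have nz: "(1 + fps_X :: real fps) $ 0 \<noteq> 0" by simp
  have "(1 + fps_X) * fps_deriv (fps_binomial c) = fps_const c * fps_binomial c"
    unfolding fps_binomial_deriv using nz
    by (simp add: fps_divide_unit mult.left_commute[of "1 + fps_X"] inverse_mult_eq_1')
  hence "((1 + fps_X) * fps_deriv (fps_binomial c)) oo (f - 1) = (fps_const c * fps_binomial c) oo (f - 1)"
    by simp
  hence "f * (fps_deriv (fps_binomial c) oo (f - 1)) = fps_const c * fps_rpow f c"
    using z by (simp add: fps_compose_mult_distrib fps_compose_add_distrib fps_X_fps_compose_startby0
        fps_rpow_def)
  moreover have "fps_deriv (fps_rpow f c) = (fps_deriv (fps_binomial c) oo (f - 1)) * fps_deriv f"
    unfolding fps_rpow_def by (subst fps_compose_deriv[OF z]) simp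
  ultimately show ?thesis by (simp add: mult_ac)
qed

text \<open>As f has constant term 1, coefficient m of \<open>f * D'\<close> is the one of
  \<open>D'\<close> plus multiples of lower ones, so a difference D with \<open>D $ 0 = 0\<close>
  vanishes by strong induction.\<close>

lemma fps_linear_ODE_unique:
  fixes f g h F :: "real fps"
  assumes "f $ 0 = 1" and "f * fps_deriv F = h * F" and "f * fps_deriv G = h * G" and "F $ 0 = G $ 0"
  shows "F = G"
proof -
  define D where "D = F - G"
  have D: "f * fps_deriv D = h * D" "D $ 0 = 0"
    using assms by (simp_all add: D_def algebra_simps)
  have "D $ n = 0" for n
  proof (induction n rule: less_induct)
    case (less n)
    show ?case
    proof (cases n)
      case 0 thus ?thesis using D by simp
    next
      case (Suc m)
      have 1: "fps_deriv D $ i = 0" if "i < m" for i using less[of "Suc i"] that Suc by simp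
      have "(h * D) $ m = 0"
        unfolding fps_mult_nth using less Suc by (intro sum.neutral) auto
      moreover have "(f * fps_deriv D) $ m = fps_deriv D $ m"
      proof -
        have "(f * fps_deriv D) $ m = (\<Sum>i=0..m. f $ i * fps_deriv D $ (m - i))" by (simp add: fps_mult_nth)
        also have "\<dots> = (\<Sum>i\<in>{0}. f $ i * fps_deriv D $ (m - i))"
          by (rule sum.mono_neutral_right) (auto simp: 1 simp del: fps_deriv_nth)
        finally show ?thesis using assms(1) by simp
      qed
      ultimately have "fps_deriv D $ m = 0" using D by simp
      thus ?thesis using Suc by simp
    qed
  qed
  hence "D = 0" by (simp add: fps_eq_iff)
  thus ?thesis by (simp add: D_def)
qed

text \<open>The two sides substitute different inner series into \<open>fps_binomial\<close>; what
  they share is the first-order equation with logarithmic derivative c (f g)' / (f g) and the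
  constant term 1.\<close>

lemma fps_rpow_mult:
  assumes "f $ 0 = 1" and "g $ 0 = 1"
  shows "fps_rpow (f * g) c = fps_rpow f c * fps_rpow g c"
proof (rule fps_linear_ODE_unique[where f = "f * g" and h = "fps_const c * fps_deriv (f * g)"])
  show "f * g * fps_deriv (fps_rpow (f * g) c) = fps_const c * fps_deriv (f * g) * fps_rpow (f * g) c"
    using assms by (intro fps_rpow_deriv) simp
  have "f * g * fps_deriv (fps_rpow f c * fps_rpow g c) =
     (f * fps_deriv (fps_rpow f c)) * (g * fps_rpow g c) + (f * fps_rpow f c) * (g * fps_deriv (fps_rpow g c))"
    by (simp add: algebra_simps)
  also have "\<dots> = fps_const c * fps_deriv (f * g) * (fps_rpow f c * fps_rpow g c)"
    unfolding fps_rpow_deriv[OF assms(1)] fps_rpow_deriv[OF assms(2)] by (simp add: algebra_simps)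
  finally show "f * g * fps_deriv (fps_rpow f c * fps_rpow g c)
      = fps_const c * fps_deriv (f * g) * (fps_rpow f c * fps_rpow g c)" .
qed (use assms in auto)

lemma fps_prod_nth_0: "(\<Prod>i\<in>I. f i) $ 0 = (\<Prod>i\<in>I. f i $ 0 :: real)"
  by (induction I rule: infinite_finite_induct) auto

lemma fps_rpow_one_base [simp]: "fps_rpow 1 c = 1"
  by (simp add: fps_rpow_def)

lemma fps_rpow_prod:
  assumes "\<And>i. i \<in> I \<Longrightarrow> f i $ 0 = 1"
  shows "fps_rpow (\<Prod>i\<in>I. f i) c = (\<Prod>i\<in>I. fps_rpow (f i) c)"
  using assms
  by (induction I rule: infinite_finite_induct) (auto simp: fps_rpow_mult fps_prod_nth_0)

lemma fps_rpow_compose: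
  assumes "f $ 0 = 1" and "t $ 0 = 0"
  shows "fps_rpow f c oo t = fps_rpow (f oo t) c"
  using assms by (simp add: fps_rpow_def fps_compose_assoc[symmetric] fps_compose_sub_distrib)

text \<open>These coefficients are the one-variable numerators of the Humbert series, which makes
  the power of a linear factor their generating function.\<close>

lemma fps_rpow_linear_nth:
  "fps_rpow (1 - fps_const x * fps_X) (- c) $ n = pochhammer c n * x ^ n / fact n"
proof -
  have "fps_rpow (1 - fps_const x * fps_X) (- c) = fps_binomial (- c) oo (fps_const (- x) * fps_X)"
    by (simp add: fps_rpow_def del: fps_const_neg add: fps_const_neg[symmetric])
  also have "\<dots> $ n = (- x) ^ n * (- c gchoose n)"
    by (simp add: fps_compose_linear)
  also have "\<dots> = pochhammer c n * x ^ n / fact n"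
  proof -
    have "(- x) ^ n * (- 1) ^ n = x ^ n" by (simp flip: power_mult_distrib)
    thus ?thesis by (simp add: gbinomial_pochhammer)
  qed
  finally show ?thesis .
qed

lemma fps_X_mult_deriv_X_power:
  "fps_X * fps_deriv (fps_X ^ k) = fps_const (real k) * (fps_X ^ k :: real fps)"
proof (induction k)
  case (Suc k)
  have "fps_X * fps_deriv (fps_X ^ Suc k) = fps_X * (fps_X ^ k + fps_X * fps_deriv (fps_X ^ k) :: real fps)"
    by (simp only: power_Suc fps_deriv_mult fps_deriv_fps_X mult_1_left add.commute)
  also have "\<dots> = fps_const (1 + real k) * fps_X ^ Suc k"
    unfolding Suc fps_const_add[symmetric] fps_const_1_eq_1 power_Suc by (simp only: algebra_simps mult_1_left)
  finally show ?case by simp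
qed simp

text \<open>Put E = X d/dX. Then A (E t) = t (k A - E A), and E + k l applied to
  \<open>A ^ (- l)\<close> gives l (k A - E A) times the next lower power. So k A - E A splits off,
  the exponent drops by 1, and l + E acts on d. The identity is used left to right for the recursion
  and right to left for the group average.\<close>

lemma fps_euler_rpow_compose:
  fixes A d :: "real fps"
  assumes A: "A $ 0 = 1" and k: "k > 0"
  defines "t \<equiv> fps_X ^ k * inverse A"
  shows "fps_X * fps_deriv (fps_rpow A (- l) * (d oo t)) + fps_const (real k * l) * (fps_rpow A (- l) * (d oo t))
     = (fps_const (real k) * A - fps_X * fps_deriv A) *
       (fps_rpow A (- l - 1) * ((fps_const l * d + fps_X * fps_deriv d) oo t))"
proof -
  have t0: "t $ 0 = 0" using k by (simp add: t_def)
  define R where "R = fps_rpow A (- l - 1)"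
  have nzA: "A \<noteq> 0" using A by auto
  have AiA: "A * inverse A = 1" using A by (simp add: inverse_mult_eq_1')
  have RA: "fps_rpow A (- l) = A * R"
    using fps_rpow_add[OF A, of 1 "-l-1"] fps_rpow_1[OF A] by (simp add: R_def)
  have dR: "fps_deriv (fps_rpow A (- l)) = - fps_const l * fps_deriv A * R"
  proof -
    have "A * fps_deriv (fps_rpow A (- l)) = A * (- fps_const l * fps_deriv A * R)"
      using fps_rpow_deriv[OF A, of "-l"] unfolding RA by (simp add: mult_ac)
    thus ?thesis using nzA by (metis mult_left_cancel)
  qed
  have At: "A * t = fps_X ^ k" using AiA by (simp add: t_def mult_ac)
  have dt: "A * (fps_X * fps_deriv t) = t * (fps_const (real k) * A - fps_X * fps_deriv A)"
  proof -
    have "fps_X * fps_deriv (A * t) = fps_const (real k) * (A * t)"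
      unfolding At by (rule fps_X_mult_deriv_X_power)
    thus ?thesis by (simp add: algebra_simps)
  qed
  have dd: "fps_deriv (d oo t) = (fps_deriv d oo t) * fps_deriv t"
    by (rule fps_compose_deriv[OF t0])
  have dist: "(fps_const l * d + fps_X * fps_deriv d) oo t = fps_const l * (d oo t) + t * (fps_deriv d oo t)"
    using t0 by (simp add: fps_compose_add_distrib fps_compose_mult_distrib fps_X_fps_compose_startby0)
  have "fps_X * fps_deriv (fps_rpow A (- l) * (d oo t)) =
     fps_X * (- fps_const l * fps_deriv A * R) * (d oo t) + R * (fps_deriv d oo t) * (A * (fps_X * fps_deriv t))"
    by (simp only: fps_deriv_mult dR dd) (simp add: RA algebra_simps)
  also have "\<dots> + fps_const (real k * l) * (fps_rpow A (- l) * (d oo t)) =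
     (fps_const (real k) * A - fps_X * fps_deriv A) * (R * (fps_const l * (d oo t) + t * (fps_deriv d oo t)))"
    unfolding dt RA by (simp add: algebra_simps del: fps_const_neg flip: fps_const_mult)
  finally show ?thesis unfolding dist R_def .
qed

text \<open>\<open>t ^ m\<close> is X^(k m) times A^(-m): it starts in degree k m, which cuts the
  sum at \<open>n div k\<close>, and it shifts the exponent of A to -l - m.\<close>

lemma fps_rpow_compose_nth:
  fixes A d :: "real fps"
  assumes A: "A $ 0 = 1" and k: "k > 0"
  shows "(fps_rpow A (- l) * (d oo (fps_X ^ k * inverse A))) $ n =
    (\<Sum>m\<le>n div k. d $ m * fps_rpow A (- l - real m) $ (n - k * m))"
proof -
  define t where "t = fps_X ^ k * inverse A"
  have tp: "t ^ m = fps_X ^ (k * m) * fps_rpow A (- real m)" for m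
    by (simp add: t_def power_mult_distrib power_mult fps_rpow_minus_of_nat[OF A])
  have co: "(d oo t) $ i = (\<Sum>m\<le>n. d $ m * (t ^ m) $ i)" if "i \<le> n" for i
  proof -
    have "t ^ m $ i = 0" if "m > i" for m
    proof -
      have "i < k * m" using that k by (cases k) auto
      thus ?thesis by (simp add: tp fps_X_power_mult_nth)
    qed
    thus ?thesis unfolding fps_compose_nth atLeast0AtMost
      using that by (intro sum.mono_neutral_left) auto
  qed
  have "(fps_rpow A (- l) * (d oo t)) $ n = (\<Sum>i=0..n. fps_rpow A (- l) $ i * (\<Sum>m\<le>n. d $ m * (t ^ m) $ (n - i)))"
    unfolding fps_mult_nth by (intro sum.cong) (auto simp: co)
  also have "\<dots> = (\<Sum>m\<le>n. d $ m * (\<Sum>i=0..n. fps_rpow A (- l) $ i * (t ^ m) $ (n - i)))"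
    by (simp only: sum_distrib_left sum.swap[of _ "{0..n}"]) (simp add: mult_ac)
  also have "\<dots> = (\<Sum>m\<le>n. d $ m * (fps_rpow A (- l) * t ^ m) $ n)"
    by (simp add: fps_mult_nth)
  also have "\<dots> = (\<Sum>m\<le>n. if k * m \<le> n then d $ m * fps_rpow A (- l - real m) $ (n - k * m) else 0)"
  proof (intro sum.cong refl)
    fix m
    have "fps_rpow A (- l) * t ^ m = fps_X ^ (k * m) * fps_rpow A (- l - real m)"
      using fps_rpow_add[OF A, of "-l" "-real m"] by (simp add: tp mult_ac)
    thus "d $ m * (fps_rpow A (- l) * t ^ m) $ n = (if k * m \<le> n then d $ m * fps_rpow A (- l - real m) $ (n - k * m) else 0)"
      by (simp add: fps_X_power_mult_nth)
  qed
  also have "\<dots> = (\<Sum>m\<le>n div k. d $ m * fps_rpow A (- l - real m) $ (n - k * m))"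
  proof -
    have "{..n} \<inter> {m. k * m \<le> n} = {..n div k}"
    proof -
      have "k * m \<le> n \<longleftrightarrow> m \<le> n div k" for m
        using k by (simp add: less_eq_div_iff_mult_less_eq mult.commute)
      moreover have "m \<le> n div k \<Longrightarrow> m \<le> n" for m
        using div_le_dividend order_trans by blast
      ultimately show ?thesis by auto
    qed
    moreover have "(\<Sum>m\<le>n. if k * m \<le> n then f m else 0) = sum f ({..n} \<inter> {m. k * m \<le> n})" for f :: "nat \<Rightarrow> real"
      by (subst sum.inter_restrict) auto
    ultimately show ?thesis by simp
  qed
  finally show ?thesis unfolding t_def .
qed

section \<open>The Chebyshev product and the Humbert function\<close>

text \<open>Two polynomials of degree k that agree at the k roots of unity and in the leading
  coefficient coincide; evaluation at \<open>inverse x\<close> and multiplication by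
  \<open>x ^ k\<close> give the claim.\<close>

lemma prod_one_minus_roots_unity:
  assumes "k > 0"
  shows "(\<Prod>j<k. 1 - x * cis (2 * pi * real j / real k)) = 1 - x ^ k"
proof (cases "x = 0")
  case False
  let ?p = "\<Prod>j<k. [:- cis (2 * pi * real j / real k), 1:]"
  let ?q = "monom 1 k - 1 :: complex poly"
  have bij: "bij_betw (\<lambda>j. cis (2 * pi * real j / real k)) {..<k} {z. z ^ k = 1}"
    by (rule Complex.bij_betw_roots_unity[OF assms])
  have degp: "degree ?p = k"
    by (subst degree_prod_eq_sum_degree) auto
  have "lead_coeff ?p = 1" by (simp add: lead_coeff_prod)
  hence coe: "coeff ?p k = 1" using degp by simp
  have pq: "?p = ?q"
  proof (rule poly_eqI_degree_lead_coeff[where A = "{z. z ^ k = 1}" and n = k])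
    show "card {z::complex. z ^ k = 1} \<ge> k"
      using card_roots_unity_eq[OF assms] by simp
    show "degree ?p \<le> k" using degp by simp
    show "degree ?q \<le> k" by (intro degree_diff_le) (auto simp: degree_monom_eq)
    show "poly ?p z = poly ?q z" if "z \<in> {z. z ^ k = 1}" for z
    proof -
      from that have "z \<in> (\<lambda>j. cis (2 * pi * real j / real k)) ` {..<k}"
        by (simp only: bij_betw_imp_surj_on[OF bij])
      then obtain j where "j < k" "z = cis (2 * pi * real j / real k)" by blast
      hence "poly ?p z = 0" by (auto simp: poly_prod)
      thus ?thesis using that by (simp add: poly_monom)
    qed
    show "coeff ?p k = coeff ?q k" using coe assms by (simp add: coeff_eq_0)
  qed
  have "(\<Prod>j<k. 1 - x * cis (2 * pi * real j / real k)) = (\<Prod>j<k. x * (inverse x - cis (2 * pi * real j / real k)))"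
    using False by (intro prod.cong) (auto simp: algebra_simps)
  also have "\<dots> = x ^ k * poly ?p (inverse x)"
    by (simp add: poly_prod prod.distrib)
  also have "\<dots> = 1 - x ^ k"
    unfolding pq using False by (simp add: poly_monom algebra_simps power_inverse)
  finally show ?thesis .
qed (use assms in auto)

lemma cmod_one_minus_cis_squared:
  "(cmod (1 - of_real t * cis x))\<^sup>2 = 1 - 2 * t * cos x + t\<^sup>2"
proof -
  have "(cmod (1 - of_real t * cis x))\<^sup>2 = (1 - t * cos x)\<^sup>2 + (t * sin x)\<^sup>2"
    by (simp add: cmod_power2)
  also have "\<dots> = 1 - 2 * t * cos x + t\<^sup>2 * ((sin x)\<^sup>2 + (cos x)\<^sup>2)"
    by (simp only: power2_eq_square distrib_left distrib_right) (simp add: algebra_simps)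
  finally show ?thesis by simp
qed

text \<open>Each quadratic factor is a squared modulus |1 - t e^(-i \<theta>)|^2, so the
  roots-of-unity product collapses the whole to the squared modulus of 1 - t^k e^(-i q).\<close>

lemma prod_quadratic_cos:
  assumes "k > 0"
  shows "(\<Prod>j<k. 1 - 2 * t * cos ((q - 2 * real j * pi) / real k) + t\<^sup>2) = 1 - 2 * t ^ k * cos q + (t ^ k)\<^sup>2"
proof -
  have "(\<Prod>j<k. 1 - 2 * t * cos ((q - 2 * real j * pi) / real k) + t\<^sup>2) =
        (\<Prod>j<k. (cmod (1 - (of_real t * cis (- q / real k)) * cis (2 * pi * real j / real k)))\<^sup>2)"
  proof (intro prod.cong refl)
    fix j
    have e: "- q / real k + 2 * pi * real j / real k = - ((q - 2 * real j * pi) / real k)"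
      by (simp add: diff_divide_distrib mult_ac)
    have "(of_real t * cis (- q / real k)) * cis (2 * pi * real j / real k) =
          of_real t * cis (- ((q - 2 * real j * pi) / real k))"
      by (simp only: mult.assoc[of "of_real t"] cis_mult e)
    thus "1 - 2 * t * cos ((q - 2 * real j * pi) / real k) + t\<^sup>2 =
        (cmod (1 - (of_real t * cis (- q / real k)) * cis (2 * pi * real j / real k)))\<^sup>2"
      by (simp only: cmod_one_minus_cis_squared cos_minus)
  qed
  also have "\<dots> = (cmod (\<Prod>j<k. 1 - (of_real t * cis (- q / real k)) * cis (2 * pi * real j / real k)))\<^sup>2"
    by (simp only: prod_norm[symmetric] prod_power_distrib)
  also have "\<dots> = (cmod (1 - (of_real t * cis (- q / real k)) ^ k))\<^sup>2"
    by (simp only: prod_one_minus_roots_unity[OF assms])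
  also have "(of_real t * cis (- q / real k)) ^ k = of_real (t ^ k) * cis (- q)"
    using assms by (simp add: power_mult_distrib Complex.DeMoivre)
  finally show ?thesis by (simp only: cmod_one_minus_cis_squared cos_minus)
qed

text \<open>Up to normalisation this is the reciprocal polynomial of \<open>T\<^sub>k - cos q\<close>, with \<open>T\<^sub>k\<close> the
  Chebyshev polynomial; hence \<open>q\<close> only enters through the coefficient of \<open>X\<^sup>k\<close>.\<close>

definition cheb_prod :: "nat \<Rightarrow> real \<Rightarrow> real \<Rightarrow> real fps" where
  "cheb_prod k r q = (\<Prod>j<k. 1 - fps_const (r * cos ((q - 2 * real j * pi) / real k)) * fps_X)"

lemma cheb_prod_nth_0 [simp]: "cheb_prod k r q $ 0 = 1"
  by (simp add: cheb_prod_def fps_prod_nth_0)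

lemma cheb_prod_scale: "cheb_prod k r q = cheb_prod k 1 q oo (fps_const r * fps_X)"
proof -
  have "(1 - fps_const c * fps_X) oo (fps_const r * fps_X) = 1 - fps_const (r * c) * fps_X" for c
  proof -
    have "(1 - fps_const c * fps_X) oo (fps_const r * fps_X) = 1 - fps_const c * (fps_const r * fps_X)"
      by (simp add: fps_compose_sub_distrib fps_compose_mult_distrib fps_X_fps_compose_startby0)
    also have "fps_const c * (fps_const r * fps_X) = fps_const (r * c) * fps_X"
      by (simp only: mult.assoc[symmetric] fps_const_mult mult.commute[of c r])
    finally show ?thesis .
  qed
  thus ?thesis unfolding cheb_prod_def
    by (subst fps_compose_prod_distrib) auto
qed

text \<open>The substitution s = 2 t / (1 + t^2) turns 1 - s cos \<theta> into a factor of
  \<open>prod_quadratic_cos\<close> divided by 1 + t^2. Hence the angle enters the value at s only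
  through -2 (t / (1 + t^2))^k cos q = -2 (s / 2)^k cos q. The reference angle \<pi>/2 has cosine
  0.\<close>

lemma cheb_prod_eq_1:
  assumes "k > 0"
  shows "cheb_prod k 1 q = cheb_prod k 1 (pi / 2) - fps_const (2 * (1 / 2) ^ k * cos q) * fps_X ^ k"
proof -
  define p where "p q = (\<Prod>j<k. [:1, - cos ((q - 2 * real j * pi) / real k):])" for q
  define D where "D = p q - p (pi / 2) + monom (2 * (1 / 2) ^ k * cos q) k"
  have pv: "poly (p q) (2 * t / (1 + t\<^sup>2)) = (1 - 2 * t ^ k * cos q + (t ^ k)\<^sup>2) / (1 + t\<^sup>2) ^ k" for t q
  proof -
    have nz: "1 + t\<^sup>2 \<noteq> 0" by (metis add_pos_nonneg less_numeral_extra(1) less_numeral_extra(3) zero_le_power2)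
    have "poly (p q) (2 * t / (1 + t\<^sup>2)) = (\<Prod>j<k. (1 - 2 * t * cos ((q - 2 * real j * pi) / real k) + t\<^sup>2) / (1 + t\<^sup>2))"
      unfolding p_def poly_prod using nz by (intro prod.cong) (auto simp: field_simps)
    also have "\<dots> = (1 - 2 * t ^ k * cos q + (t ^ k)\<^sup>2) / (1 + t\<^sup>2) ^ k"
      by (simp only: prod_dividef prod_quadratic_cos[OF assms]) simp
    finally show ?thesis .
  qed
  have "poly D (2 * t / (1 + t\<^sup>2)) = 0" for t
  proof -
    have "poly D (2 * t / (1 + t\<^sup>2)) = (- 2 * t ^ k * cos q) / (1 + t\<^sup>2) ^ k + 2 * (1 / 2) ^ k * cos q * (2 * t / (1 + t\<^sup>2)) ^ k"
      by (simp add: D_def poly_monom pv diff_divide_distrib add_divide_distrib)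
    also have "2 * (1 / 2) ^ k * cos q * (2 * t / (1 + t\<^sup>2)) ^ k = 2 * cos q * ((1 / 2) * (2 * t / (1 + t\<^sup>2))) ^ k"
      unfolding power_mult_distrib by (simp only: mult_ac)
    also have "(1 / 2) * (2 * t / (1 + t\<^sup>2)) = t / (1 + t\<^sup>2)" by simp
    also have "(t / (1 + t\<^sup>2)) ^ k = t ^ k / (1 + t\<^sup>2) ^ k" by (rule power_divide)
    finally show ?thesis by (simp add: mult_ac)
  qed
  hence sub: "(\<lambda>t. 2 * t / (1 + t\<^sup>2)) ` {0<..<1} \<subseteq> {x. poly D x = 0}" by auto
  \<comment> \<open>Injectivity on the unit interval yields infinitely many roots of D, so D =
    0.\<close>
  have inj: "inj_on (\<lambda>t::real. 2 * t / (1 + t\<^sup>2)) {0<..<1}"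
  proof (rule inj_onI)
    fix s t :: real assume st: "s \<in> {0<..<1}" "t \<in> {0<..<1}" "2 * s / (1 + s\<^sup>2) = 2 * t / (1 + t\<^sup>2)"
    have "1 + s\<^sup>2 > 0" "1 + t\<^sup>2 > 0" by (simp_all add: add_pos_nonneg)
    hence "s * (1 + t\<^sup>2) = t * (1 + s\<^sup>2)" using st(3) by (simp add: field_simps)
    hence "(s - t) * (1 - s * t) = 0" by (simp add: algebra_simps power2_eq_square)
    moreover have "s * t < 1" using st mult_strict_mono'[of s 1 t 1] by simp
    ultimately show "s = t" by simp
  qed
  have "infinite {0<..<1::real}" by simp
  hence "infinite ((\<lambda>t::real. 2 * t / (1 + t\<^sup>2)) ` {0<..<1})" using finite_imageD[OF _ inj] by blast
  hence "D = 0" using poly_roots_finite[of D] finite_subset[OF sub] by blast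
  hence "p q = p (pi / 2) - monom (2 * (1 / 2) ^ k * cos q) k" by (simp add: D_def algebra_simps)
  hence e: "fps_of_poly (p q) = fps_of_poly (p (pi / 2)) - fps_of_poly (monom (2 * (1 / 2) ^ k * cos q) k)"
    by (simp add: fps_of_poly_diff)
  have lin: "fps_of_poly [:1, - c:] = 1 - fps_const c * fps_X" for c :: real
    by (simp add: fps_of_poly_pCons mult.commute)
  have "fps_of_poly (p q) = cheb_prod k 1 q" for q
    by (simp only: p_def cheb_prod_def fps_of_poly_prod lin mult_1_left)
  thus ?thesis using e by (simp add: fps_of_poly_monom)
qed

lemma cheb_prod_eq:
  assumes "k > 0"
  shows "cheb_prod k r q = cheb_prod k r (pi / 2) - fps_const (2 * (r / 2) ^ k * cos q) * fps_X ^ k"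
proof -
  have "cheb_prod k r q = (cheb_prod k 1 (pi / 2) - fps_const (2 * (1 / 2) ^ k * cos q) * fps_X ^ k) oo (fps_const r * fps_X)"
    by (subst cheb_prod_scale, subst cheb_prod_eq_1[OF assms]) simp
  also have "\<dots> = cheb_prod k r (pi / 2) - fps_const (2 * (1 / 2) ^ k * cos q) * (fps_const r * fps_X) ^ k"
    by (simp add: fps_compose_sub_distrib fps_compose_mult_distrib fps_compose_power[symmetric] fps_X_fps_compose_startby0
      cheb_prod_scale[of k r "pi/2"])
  also have "fps_const (2 * (1 / 2) ^ k * cos q) * (fps_const r * fps_X) ^ k = fps_const (2 * (r / 2) ^ k * cos q) * fps_X ^ k"
    by (simp only: power_mult_distrib fps_const_power mult.assoc[symmetric] fps_const_mult)
       (simp add: power_divide mult_ac)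
  finally show ?thesis .
qed

lemma fps_rpow_cheb_prod_nth: "fps_rpow (cheb_prod k r q) c $ n = r ^ n * fps_rpow (cheb_prod k 1 q) c $ n"
  by (subst cheb_prod_scale, subst fps_rpow_compose[symmetric]) (auto simp: fps_compose_linear)

text \<open>Replacing X by -X amounts to shifting q by k \<pi>. From \<pi>/2 this leads to another
  zero of the cosine, so the product and all its powers are even series.\<close>

lemma fps_rpow_cheb_prod_odd:
  assumes "k > 0" and "odd n"
  shows "fps_rpow (cheb_prod k 1 (pi / 2)) c $ n = 0"
proof -
  have "cheb_prod k (- 1) (pi / 2) = cheb_prod k 1 (pi / 2 + real k * pi)"
    unfolding cheb_prod_def
  proof (intro prod.cong refl)
    fix j
    have "(pi / 2 + real k * pi - 2 * real j * pi) / real k = (pi / 2 - 2 * real j * pi) / real k + pi"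
      using assms by (simp add: field_simps)
    thus "1 - fps_const (- 1 * cos ((pi / 2 - 2 * real j * pi) / real k)) * fps_X =
      1 - fps_const (1 * cos ((pi / 2 + real k * pi - 2 * real j * pi) / real k)) * fps_X"
      by (simp add: cos_add)
  qed
  also have "\<dots> = cheb_prod k 1 (pi / 2)"
    by (subst cheb_prod_eq[OF assms(1)]) (simp add: cos_add)
  finally have "fps_rpow (cheb_prod k 1 (pi / 2)) c $ n = (- 1) ^ n * fps_rpow (cheb_prod k 1 (pi / 2)) c $ n"
    using fps_rpow_cheb_prod_nth[of k "- 1" "pi / 2" c n] by simp
  thus ?thesis using assms(2) by simp
qed

text \<open>Writing the product as A (1 - y t) with t = X^k / A isolates the angle: only
  \<open>y ^ m\<close>, a multiple of (cos q)^m, depends on q. The radius scales out as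
  \<open>r ^ n\<close>.\<close>

lemma fps_rpow_cheb_prod:
  assumes "k > 0"
  shows "fps_rpow (cheb_prod k r q) (- l) $ n =
    (\<Sum>m\<le>n div k. pochhammer l m / fact m * (2 * (1 / 2) ^ k * cos q) ^ m * r ^ n *
       fps_rpow (cheb_prod k 1 (pi / 2)) (- l - real m) $ (n - k * m))"
proof -
  define A where "A = cheb_prod k r (pi / 2)"
  define y where "y = 2 * (r / 2) ^ k * cos q"
  define t where "t = fps_X ^ k * inverse A"
  have A0: "A $ 0 = 1" by (simp add: A_def)
  have t0: "t $ 0 = 0" using assms by (simp add: t_def)
  have "cheb_prod k r q = A * (1 - fps_const y * t)"
  proof -
    have At: "A * t = fps_X ^ k" using A0 by (simp add: t_def mult.left_commute inverse_mult_eq_1')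
    have "cheb_prod k r q = A - fps_const y * fps_X ^ k"
      unfolding A_def y_def by (rule cheb_prod_eq[OF assms])
    also have "\<dots> = A * (1 - fps_const y * t)"
      unfolding At[symmetric] by (simp only: right_diff_distrib mult_1_right mult_ac)
    finally show ?thesis .
  qed
  hence "fps_rpow (cheb_prod k r q) (- l) = fps_rpow A (- l) * fps_rpow (1 - fps_const y * t) (- l)"
    using A0 t0 by (simp add: fps_rpow_mult)
  also have "fps_rpow (1 - fps_const y * t) (- l) = fps_rpow (1 - fps_const y * fps_X) (- l) oo t"
    using t0 by (simp add: fps_rpow_compose fps_compose_sub_distrib fps_compose_mult_distrib fps_X_fps_compose_startby0)
  finally have "fps_rpow (cheb_prod k r q) (- l) $ n =
     (\<Sum>m\<le>n div k. pochhammer l m * y ^ m / fact m * fps_rpow A (- l - real m) $ (n - k * m))"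
    unfolding t_def by (simp only: fps_rpow_compose_nth[OF A0 assms] fps_rpow_linear_nth)
  also have "\<dots> = (\<Sum>m\<le>n div k. pochhammer l m / fact m * (2 * (1 / 2) ^ k * cos q) ^ m * r ^ n *
       fps_rpow (cheb_prod k 1 (pi / 2)) (- l - real m) $ (n - k * m))"
  proof (intro sum.cong refl)
    fix m assume "m \<in> {..n div k}"
    hence "k * m \<le> n" using assms by (simp add: less_eq_div_iff_mult_less_eq mult.commute)
    hence "r ^ n = (r ^ k) ^ m * r ^ (n - k * m)" by (simp flip: power_mult power_add)
    moreover have "y = (2 * (1 / 2) ^ k * cos q) * r ^ k" by (simp add: y_def power_divide)
    ultimately show "pochhammer l m * y ^ m / fact m * fps_rpow A (- l - real m) $ (n - k * m) =
      pochhammer l m / fact m * (2 * (1 / 2) ^ k * cos q) ^ m * r ^ n *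
       fps_rpow (cheb_prod k 1 (pi / 2)) (- l - real m) $ (n - k * m)"
      by (simp only: A_def fps_rpow_cheb_prod_nth[of k r] power_mult_distrib) (simp add: mult_ac)
  qed
  finally show ?thesis .
qed

section \<open>Expansion of the Humbert function by total degree\<close>

lemma pochhammer_le_fact_power:
  fixes c :: real
  assumes "c \<ge> 0"
  shows "pochhammer c n \<le> (c + 1) ^ n * fact n"
proof (induction n)
  case (Suc n)
  have "c + real n \<le> (c + 1) * (real n + 1)" using assms by (simp add: algebra_simps)
  hence "pochhammer c n * (c + real n) \<le> ((c + 1) ^ n * fact n) * ((c + 1) * (real n + 1))"
    using Suc assms pochhammer_nonneg[of c n]
    by (intro mult_mono) (auto simp: pochhammer_pos less_eq_real_def)
  thus ?case by (simp add: pochhammer_Suc algebra_simps)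
qed simp

lemma pochhammer_ge_fact_power:
  fixes c d :: real
  assumes "0 \<le> d" "d \<le> c" "d \<le> 1"
  shows "d ^ n * fact n \<le> pochhammer c n"
proof (induction n)
  case (Suc n)
  have "d * (real n + 1) = d * real n + d" by (simp add: algebra_simps)
  also have "\<dots> \<le> c + real n" using assms mult_right_mono[of d 1 "real n"] by simp
  finally have "(d ^ n * fact n) * (d * (real n + 1)) \<le> pochhammer c n * (c + real n)"
    using Suc assms by (intro mult_mono) (auto intro: order_trans[OF _ Suc])
  thus ?case by (simp add: pochhammer_Suc algebra_simps)
qed simp

text \<open>The index functions are extensional, as in \<open>humbert_Phi2\<close>, so this
  coefficient is one block of the Humbert sum.\<close>

lemma fps_prod_Abs_nth:
  fixes f :: "nat \<Rightarrow> nat \<Rightarrow> real"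
  shows "(\<Prod>i<m. Abs_fps (f i)) $ n =
    (\<Sum>js\<in>{js \<in> PiE {..<m} (\<lambda>_. UNIV). (\<Sum>i<m. js i) = n}. \<Prod>i<m. f i (js i))"
proof (induction m arbitrary: n)
  case 0
  show ?case by (cases "n = 0") auto
next
  case (Suc m)
  let ?S = "\<lambda>m n. {js \<in> PiE {..<m} (\<lambda>_. UNIV :: nat set). (\<Sum>i<m. js i) = n}"
  have fin: "finite (?S m n)" for m n :: nat
  proof (rule finite_subset)
    show "?S m n \<subseteq> PiE {..<m} (\<lambda>_. {..n})"
    proof
      fix js assume js: "js \<in> ?S m n"
      have "js i \<le> n" if "i < m" for i
        using member_le_sum[of i "{..<m}" js] js that by auto
      thus "js \<in> PiE {..<m} (\<lambda>_. {..n})" using js by (auto simp: PiE_iff)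
    qed
  qed (auto intro: finite_PiE)
  have "(\<Prod>i<Suc m. Abs_fps (f i)) $ n = (\<Sum>a=0..n. (\<Sum>js\<in>?S m a. \<Prod>i<m. f i (js i)) * f m (n - a))"
    by (simp add: fps_mult_nth Suc.IH)
  also have "\<dots> = (\<Sum>(a, js)\<in>(SIGMA a:{0..n}. ?S m a). (\<Prod>i<m. f i (js i)) * f m (n - a))"
    using fin by (subst sum.Sigma[symmetric]) (auto simp: sum_distrib_right)
  also have "\<dots> = (\<Sum>js\<in>?S (Suc m) n. \<Prod>i<Suc m. f i (js i))"
  proof (rule sum.reindex_bij_witness[where i = "\<lambda>js. (n - js m, restrict js {..<m})"
        and j = "\<lambda>(a, js). js(m := n - a)"])
    show "(case case x of (a, js) \<Rightarrow> js(m := n - a) of js \<Rightarrow> (n - js m, restrict js {..<m})) = x"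
      if "x \<in> (SIGMA a:{0..n}. ?S m a)" for x
      using that by (auto simp: fun_eq_iff restrict_def PiE_iff extensional_def)
    show "(case x of (a, js) \<Rightarrow> js(m := n - a)) \<in> ?S (Suc m) n" if "x \<in> (SIGMA a:{0..n}. ?S m a)" for x
      using that by (auto simp: PiE_iff extensional_def)
    show "(case (n - js m, restrict js {..<m}) of (a, js) \<Rightarrow> js(m := n - a)) = js" if "js \<in> ?S (Suc m) n" for js
      using that by (auto simp: fun_eq_iff restrict_def PiE_iff extensional_def)
    show "(n - js m, restrict js {..<m}) \<in> (SIGMA a:{0..n}. ?S m a)" if "js \<in> ?S (Suc m) n" for js
      using that by (auto simp: PiE_iff extensional_def)
    show "(\<Prod>i<Suc m. f i ((case x of (a, js) \<Rightarrow> js(m := n - a)) i)) = (case x of (a, js) \<Rightarrow> (\<Prod>i<m. f i (js i)) * f m (n - a))"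
      if "x \<in> (SIGMA a:{0..n}. ?S m a)" for x
      by (auto split: prod.splits intro!: prod.cong)
  qed
  finally show ?case .
qed

lemma prod_fact_le_fact_sum:
  fixes js :: "nat \<Rightarrow> nat"
  shows "(\<Prod>i<m. fact (js i) :: real) \<le> fact (\<Sum>i<m. js i)"
proof (induction m)
  case (Suc m)
  have ab: "fact x * fact y \<le> (fact (x + y) :: real)" for x y
  proof -
    have "fact x * fact y \<le> (fact (x + y) :: nat)"
      by (rule dvd_imp_le[OF fact_fact_dvd_fact]) simp
    thus ?thesis by (metis of_nat_fact of_nat_le_iff of_nat_mult)
  qed
  have "(\<Prod>i<Suc m. fact (js i) :: real) \<le> fact (\<Sum>i<m. js i) * fact (js m)"
    using Suc by (simp add: mult_right_mono)
  also have "\<dots> \<le> fact (\<Sum>i<Suc m. js i)" using ab[of "\<Sum>i<m. js i" "js m"] by simp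
  finally show ?case .
qed simp

lemma exp_terms_summable_on: "(\<lambda>n. c ^ n / fact n :: real) summable_on UNIV"
proof -
  have "summable (\<lambda>n. norm (c ^ n / fact n))"
    using summable_norm_exp[of c] by (simp add: divide_inverse mult.commute)
  thus ?thesis by (rule norm_summable_imp_summable_on)
qed

text \<open>Multi-indices of total degree n share the denominator \<open>pochhammer gam n\<close>,
  and their numerators add up to coefficient n of the product of the powers of linear factors.
  Regrouping by n is justified by absolute summability.\<close>

lemma humbert_Phi2_has_sum:
  assumes l: "l > 0" and g: "gam > 0"
  shows "((\<lambda>n. (\<Prod>i<m. fps_rpow (1 - fps_const (x i) * fps_X) (- l)) $ n / pochhammer gam n)
     has_sum humbert_Phi2 m (\<lambda>_. l) gam x) UNIV"
proof -
  define f where "f i n = pochhammer l n * x i ^ n / fact n" for i n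
  define F where "F js = (\<Prod>i<m. f i (js i)) / pochhammer gam (\<Sum>i<m. js i)" for js
  define P where "P = PiE {..<m} (\<lambda>_. UNIV :: nat set)"
  \<comment> \<open>With d at most gam and at most 1, the denominator is at least d^N N!, and N!
    dominates the product of the \<open>fact (js i)\<close>. The majorant splits into exponential
    series with arguments \<open>M i\<close>.\<close>
  define d where "d = min gam 1"
  have d: "0 < d" "d \<le> gam" "d \<le> 1" using g by (auto simp: d_def)
  define M where "M i = (l + 1) * \<bar>x i\<bar> / d" for i
  have "Infinite_Set_Sum.abs_summable_on (\<lambda>js. \<Prod>i<m. M i ^ js i / fact (js i)) P"
    unfolding P_def
    by (rule abs_summable_on_prod_PiE) (auto simp flip: abs_summable_equivalent
        simp: power_abs exp_terms_summable_on)
  hence sM: "(\<lambda>js. \<Prod>i<m. M i ^ js i / fact (js i)) summable_on P"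
    using abs_summable_equivalent abs_summable_summable by blast
  have bnd: "\<bar>F js\<bar> \<le> (\<Prod>i<m. M i ^ js i / fact (js i))" for js
  proof -
    have pg: "0 < pochhammer gam n" for n using g by (simp add: pochhammer_pos)
    define N where "N = (\<Sum>i<m. js i)"
    have "\<bar>\<Prod>i<m. f i (js i)\<bar> \<le> (\<Prod>i<m. ((l + 1) * \<bar>x i\<bar>) ^ js i)"
      unfolding abs_prod
    proof (intro prod_mono conjI)
      fix i
      have "\<bar>f i (js i)\<bar> = pochhammer l (js i) / fact (js i) * \<bar>x i\<bar> ^ js i"
        using l by (simp add: f_def abs_mult power_abs pochhammer_nonneg)
      also have "\<dots> \<le> (l + 1) ^ js i * \<bar>x i\<bar> ^ js i"
        using pochhammer_le_fact_power[of l "js i"] l by (intro mult_right_mono) (auto simp: divide_le_eq)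
      finally show "\<bar>f i (js i)\<bar> \<le> ((l + 1) * \<bar>x i\<bar>) ^ js i" by (simp add: power_mult_distrib)
    qed auto
    moreover have "1 / pochhammer gam N \<le> 1 / (d ^ N * (\<Prod>i<m. fact (js i)))"
    proof -
      have "d ^ N * (\<Prod>i<m. fact (js i)) \<le> d ^ N * fact N"
        unfolding N_def using d by (intro mult_left_mono prod_fact_le_fact_sum) auto
      also have "\<dots> \<le> pochhammer gam N" using d by (intro pochhammer_ge_fact_power) auto
      finally show ?thesis using d pg[of N] by (intro divide_left_mono) (auto intro!: mult_pos_pos prod_pos)
    qed
    ultimately have "\<bar>\<Prod>i<m. f i (js i)\<bar> * (1 / pochhammer gam N) \<le> (\<Prod>i<m. ((l + 1) * \<bar>x i\<bar>) ^ js i) * (1 / (d ^ N * (\<Prod>i<m. fact (js i))))"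
      using pg[of N] l by (intro mult_mono) (auto intro!: prod_nonneg)
    also have "\<dots> = (\<Prod>i<m. M i ^ js i / fact (js i))"
      by (simp add: M_def N_def power_sum power_divide prod_dividef prod.distrib)
    finally show ?thesis unfolding F_def N_def[symmetric] using pg[of N] by (simp add: abs_divide)
  qed
  have sF: "F summable_on P"
    by (rule abs_summable_summable, rule summable_on_comparison_test[OF sM]) (auto simp: bnd)
  have "humbert_Phi2 m (\<lambda>_. l) gam x = infsum F P"
    by (simp add: humbert_Phi2_def F_def[abs_def] f_def P_def)
  hence hs: "(F has_sum humbert_Phi2 m (\<lambda>_. l) gam x) P"
    using sF by (simp add: has_sum_infsum)
  define S where "S n = {js \<in> P. (\<Sum>i<m. js i) = n}" for n
  have "((\<lambda>(n, js). F js) has_sum humbert_Phi2 m (\<lambda>_. l) gam x) (Sigma UNIV S)"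
    by (subst has_sum_reindex_bij_witness[where i = "\<lambda>js. (\<Sum>i<m. js i, js)" and j = "\<lambda>(n, js). js"
          and T = P and h = F and s' = "humbert_Phi2 m (\<lambda>_. l) gam x"]) (use hs in \<open>auto simp: S_def\<close>)
  moreover have "((\<lambda>js. F js) has_sum (\<Prod>i<m. fps_rpow (1 - fps_const (x i) * fps_X) (- l)) $ n / pochhammer gam n) (S n)" for n
  proof (rule has_sum_finiteI)
    show "finite (S n)"
    proof (rule finite_subset)
      show "S n \<subseteq> PiE {..<m} (\<lambda>_. {..n})"
      proof
        fix js assume js: "js \<in> S n"
        have "js i \<le> n" if "i < m" for i
          using member_le_sum[of i "{..<m}" js] js that by (auto simp: S_def P_def)
        thus "js \<in> PiE {..<m} (\<lambda>_. {..n})" using js by (auto simp: PiE_iff S_def P_def)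
      qed
    qed (auto intro: finite_PiE)
    have "fps_rpow (1 - fps_const (x i) * fps_X) (- l) = Abs_fps (f i)" for i
      by (simp add: fps_eq_iff fps_rpow_linear_nth f_def)
    hence "(\<Prod>i<m. fps_rpow (1 - fps_const (x i) * fps_X) (- l)) $ n = (\<Sum>js\<in>S n. \<Prod>i<m. f i (js i))"
      by (simp add: fps_prod_Abs_nth S_def P_def)
    also have "\<dots> / pochhammer gam n = sum F (S n)"
      unfolding sum_divide_distrib by (intro sum.cong) (auto simp: F_def S_def)
    finally show "(\<Prod>i<m. fps_rpow (1 - fps_const (x i) * fps_X) (- l)) $ n / pochhammer gam n = sum F (S n)" .
  qed
  ultimately show ?thesis
    using has_sum_SigmaD[where f = "\<lambda>(n, js). F js" and A = UNIV and B = S] by fastforce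
qed

section \<open>Binary forms and the Bessel kernel\<close>

text \<open>Coefficientwise majorisation by (x + y)^n. Vandermonde's identity keeps it under
  products, so the bound holds uniformly for the powers and products that make up the
  kernel.\<close>

definition dominated_form :: "nat \<Rightarrow> (nat \<Rightarrow> real) \<Rightarrow> (complex \<Rightarrow> real) \<Rightarrow> bool" where
  "dominated_form n c f \<longleftrightarrow> (\<forall>i. \<bar>c i\<bar> \<le> real (n choose i)) \<and>
     (\<forall>w. f w = (\<Sum>i\<le>n. c i * Re w ^ i * Im w ^ (n - i)))"

lemma dominated_form_mult:
  assumes "dominated_form n c f" and "dominated_form n' c' g"
  shows "dominated_form (n + n') (\<lambda>s. \<Sum>i\<le>s. c i * c' (s - i)) (\<lambda>w. f w * g w)"
  unfolding dominated_form_def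
proof (intro conjI allI)
  have c: "\<bar>c i\<bar> \<le> real (n choose i)" and c': "\<bar>c' i\<bar> \<le> real (n' choose i)" for i
    using assms by (auto simp: dominated_form_def)
  have c0: "i \<le> n" if "c i \<noteq> 0" for i using c[of i] that by (cases "i \<le> n") (auto simp: binomial_eq_0)
  have c'0: "i \<le> n'" if "c' i \<noteq> 0" for i using c'[of i] that by (cases "i \<le> n'") (auto simp: binomial_eq_0)
  show "\<bar>\<Sum>i\<le>s. c i * c' (s - i)\<bar> \<le> real (n + n' choose s)" for s
  proof -
    have "\<bar>\<Sum>i\<le>s. c i * c' (s - i)\<bar> \<le> (\<Sum>i\<le>s. \<bar>c i\<bar> * \<bar>c' (s - i)\<bar>)"
      using sum_abs[of "\<lambda>i. c i * c' (s - i)" "{..s}"] by (simp add: abs_mult)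
    also have "\<dots> \<le> (\<Sum>i\<le>s. real (n choose i) * real (n' choose (s - i)))"
      by (intro sum_mono mult_mono c c') auto
    also have "\<dots> = real (n + n' choose s)" by (simp flip: vandermonde)
    finally show ?thesis .
  qed
  fix w
  let ?x = "Re w" and ?y = "Im w"
  define G where "G i j = c i * c' j * ?x ^ (i + j) * ?y ^ (n + n' - (i + j))" for i j
  have "f w * g w = (\<Sum>(i, j)\<in>{..n} \<times> {..n'}. (c i * ?x ^ i * ?y ^ (n - i)) * (c' j * ?x ^ j * ?y ^ (n' - j)))"
    using assms by (simp add: dominated_form_def sum_product sum.cartesian_product)
  also have "\<dots> = (\<Sum>(i, j)\<in>{..n} \<times> {..n'}. G i j)"
  proof (intro sum.cong refl)
    fix p assume "p \<in> {..n} \<times> {..n'}"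
    then obtain i j where p: "p = (i, j)" "i \<le> n" "j \<le> n'" by auto
    hence e: "n + n' - (i + j) = (n - i) + (n' - j)" by auto
    show "(case p of (i, j) \<Rightarrow> (c i * ?x ^ i * ?y ^ (n - i)) * (c' j * ?x ^ j * ?y ^ (n' - j))) = (case p of (i, j) \<Rightarrow> G i j)"
      unfolding p(1) G_def prod.case e power_add by (simp only: mult_ac)
  qed
  \<comment> \<open>The rectangle may be enlarged to the triangle because the coefficients vanish
    together with the binomials that bound them.\<close>
  also have "\<dots> = (\<Sum>(i, j)\<in>{(i, j). i + j \<le> n + n'}. G i j)"
  proof (rule sum.mono_neutral_left)
    have "{(i, j). i + j \<le> n + n'} \<subseteq> {..n + n'} \<times> {..n + n'}" by auto
    thus "finite {(i, j). i + j \<le> n + n'}" using finite_subset by blast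
  qed (auto simp: G_def intro: c0 c'0)
  also have "\<dots> = (\<Sum>s\<le>n + n'. \<Sum>i\<le>s. G i (s - i))" by (rule sum.triangle_reindex_eq)
  also have "\<dots> = (\<Sum>s\<le>n + n'. (\<Sum>i\<le>s. c i * c' (s - i)) * ?x ^ s * ?y ^ (n + n' - s))"
    by (intro sum.cong refl) (simp add: G_def sum_distrib_right)
  finally show "f w * g w = (\<Sum>s\<le>n + n'. (\<Sum>i\<le>s. c i * c' (s - i)) * ?x ^ s * ?y ^ (n + n' - s))" .
qed

lemma ex_dominated_form_1: "\<exists>c. dominated_form 0 c (\<lambda>w. 1)"
  by (rule exI[of _ "\<lambda>i. if i = 0 then 1 else 0"]) (auto simp: dominated_form_def)

lemma ex_dominated_form_mult:
  assumes "\<exists>c. dominated_form n c f" and "\<exists>c. dominated_form n' c g"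
  shows "\<exists>c. dominated_form (n + n') c (\<lambda>w. f w * g w)"
  using assms dominated_form_mult by blast

lemma ex_dominated_form_power:
  assumes "\<exists>c. dominated_form n c f"
  shows "\<exists>c. dominated_form (m * n) c (\<lambda>w. f w ^ m)"
proof (induction m)
  case (Suc m)
  show ?case using ex_dominated_form_mult[OF assms Suc] by simp
qed (simp add: ex_dominated_form_1)

lemma power_complex_binomial:
  "w ^ k = (\<Sum>i\<le>k. of_real (real (k choose i) * Re w ^ i * Im w ^ (k - i)) * \<i> ^ (k - i))"
proof -
  have "w ^ k = (of_real (Re w) + \<i> * of_real (Im w)) ^ k" by (simp flip: complex_eq)
  also have "\<dots> = (\<Sum>i\<le>k. of_nat (k choose i) * of_real (Re w) ^ i * (\<i> ^ (k - i) * of_real (Im w) ^ (k - i)))"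
    by (simp only: binomial_ring power_mult_distrib)
  also have "\<dots> = (\<Sum>i\<le>k. of_real (real (k choose i) * Re w ^ i * Im w ^ (k - i)) * \<i> ^ (k - i))"
    by (intro sum.cong refl) (simp only: of_real_mult of_real_power of_real_of_nat_eq mult_ac)
  finally show ?thesis .
qed

lemma ex_dominated_form_power_Re: "\<exists>c. dominated_form k c (\<lambda>w. Re (w ^ k))"
proof (rule exI[of _ "\<lambda>i. real (k choose i) * Re (\<i> ^ (k - i))"], unfold dominated_form_def, intro conjI allI)
  show "\<bar>real (k choose i) * Re (\<i> ^ (k - i))\<bar> \<le> real (k choose i)" for i
  proof -
    have "\<bar>Re (\<i> ^ (k - i))\<bar> \<le> 1" using abs_Re_le_cmod[of "\<i> ^ (k - i)"] by (simp add: norm_power)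
    thus ?thesis by (simp add: abs_mult mult_left_le)
  qed
  show "Re (w ^ k) = (\<Sum>i\<le>k. real (k choose i) * Re (\<i> ^ (k - i)) * Re w ^ i * Im w ^ (k - i))" for w
    unfolding power_complex_binomial[of w k] Re_sum Im_sum
    by (intro sum.cong refl) (simp add: Re_power_real Im_power_real del: of_real_mult of_real_power)
qed

lemma ex_dominated_form_power_Im: "\<exists>c. dominated_form k c (\<lambda>w. Im (w ^ k))"
proof (rule exI[of _ "\<lambda>i. real (k choose i) * Im (\<i> ^ (k - i))"], unfold dominated_form_def, intro conjI allI)
  show "\<bar>real (k choose i) * Im (\<i> ^ (k - i))\<bar> \<le> real (k choose i)" for i
  proof -
    have "\<bar>Im (\<i> ^ (k - i))\<bar> \<le> 1" using abs_Im_le_cmod[of "\<i> ^ (k - i)"] by (simp add: norm_power)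
    thus ?thesis by (simp add: abs_mult mult_left_le)
  qed
  show "Im (w ^ k) = (\<Sum>i\<le>k. real (k choose i) * Im (\<i> ^ (k - i)) * Re w ^ i * Im w ^ (k - i))" for w
    unfolding power_complex_binomial[of w k] Re_sum Im_sum
    by (intro sum.cong refl) (simp add: Re_power_real Im_power_real del: of_real_mult of_real_power)
qed

lemma ex_dominated_form_cmod2: "\<exists>c. dominated_form 2 c (\<lambda>w. (cmod w)\<^sup>2)"
proof (rule exI[of _ "\<lambda>i. if i = 0 \<or> i = 2 then 1 else 0"], unfold dominated_form_def, intro conjI allI)
  show "(cmod w)\<^sup>2 = (\<Sum>i\<le>2. (if i = 0 \<or> i = 2 then 1 else 0) * Re w ^ i * Im w ^ (2 - i))" for w
  proof -
    have "{..2::nat} = {0, 1, 2}" by auto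
    thus ?thesis by (simp add: cmod_power2)
  qed
qed auto

definition mixed_monomial :: "nat \<Rightarrow> nat \<Rightarrow> nat \<Rightarrow> nat \<Rightarrow> complex \<Rightarrow> real" where
  "mixed_monomial k n m l w = cmod w ^ (n - k * m) * Re (w ^ k) ^ l * Im (w ^ k) ^ (m - l)"

text \<open>The choice is meaningful when \<open>k * m \<le> n\<close>, \<open>l \<le> m\<close> and
  n - k m is even, so that |w| enters as a power of the polynomial |w|^2. Where n - k m is odd,
  \<open>kern_weight_odd\<close> removes the term.\<close>

definition mixed_coeff :: "nat \<Rightarrow> nat \<Rightarrow> nat \<Rightarrow> nat \<Rightarrow> nat \<Rightarrow> real" where
  "mixed_coeff k n m l = (SOME c. dominated_form n c (mixed_monomial k n m l))"

lemma dominated_form_mixed_coeff: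
  assumes "k * m \<le> n" and "even (n - k * m)" and "l \<le> m"
  shows "dominated_form n (mixed_coeff k n m l) (mixed_monomial k n m l)"
proof -
  obtain h where h: "n - k * m = h * 2" using assms(2) by (metis dvd_def mult.commute)
  have n: "h * 2 + l * k + (m - l) * k = n"
  proof -
    have "l * k + (m - l) * k = m * k" using assms(3) by (simp flip: add_mult_distrib)
    thus ?thesis using h assms(1) by (simp add: mult.commute)
  qed
  have "\<exists>c. dominated_form (h * 2 + l * k + (m - l) * k) c
      (\<lambda>w. ((cmod w)\<^sup>2) ^ h * Re (w ^ k) ^ l * Im (w ^ k) ^ (m - l))"
    by (intro ex_dominated_form_mult ex_dominated_form_power ex_dominated_form_cmod2
        ex_dominated_form_power_Re ex_dominated_form_power_Im)
  moreover have "(\<lambda>w. ((cmod w)\<^sup>2) ^ h * Re (w ^ k) ^ l * Im (w ^ k) ^ (m - l)) = mixed_monomial k n m l"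
    unfolding mixed_monomial_def h by (simp add: mult.commute[of h] power_mult)
  ultimately have "\<exists>c. dominated_form n c (mixed_monomial k n m l)" unfolding n by simp
  thus ?thesis unfolding mixed_coeff_def by (rule someI_ex)
qed

text \<open>The coefficient of |zw|^n (cos q)^m in the degree n part of the symmetrised Humbert
  function. The parity test is the average over q and \<pi> - q, whose cosines are opposite.\<close>

definition kern_weight :: "nat \<Rightarrow> real \<Rightarrow> nat \<Rightarrow> nat \<Rightarrow> real" where
  "kern_weight k la n m = (if even m then pochhammer la m / fact m * (2 * (1 / 2) ^ k) ^ m *
     fps_rpow (cheb_prod k 1 (pi / 2)) (- la - real m) $ (n - k * m) / pochhammer (real k * la) n else 0)"

text \<open>\<open>T l l'\<close> stands for \<open>v ^ l * u ^ l'\<close>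
  or for its integral against the two measures.\<close>

definition kern :: "nat \<Rightarrow> real \<Rightarrow> (nat \<Rightarrow> nat \<Rightarrow> real) \<Rightarrow> complex \<Rightarrow> complex \<Rightarrow> nat \<Rightarrow> real" where
  "kern k la T z w n = (\<Sum>m\<le>n div k. kern_weight k la n m * cmod (z * w) ^ (n - k * m) *
     (\<Sum>l\<le>m. real (m choose l) * T l (m - l) * (Re (z ^ k) * Re (w ^ k)) ^ l * (Im (z ^ k) * Im (w ^ k)) ^ (m - l)))"

text \<open>The factorials turn a coefficient of the form \<open>kern\<close> of degree i + j in w
  into a partial derivative at w = 0, which is the number that p(\<partial>) reads off.\<close>

definition kern_coeff :: "nat \<Rightarrow> real \<Rightarrow> (nat \<Rightarrow> nat \<Rightarrow> real) \<Rightarrow> complex \<Rightarrow> nat \<Rightarrow> nat \<Rightarrow> real" where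
  "kern_coeff k la T z i j = fact i * fact j *
     (\<Sum>m\<le>(i + j) div k. \<Sum>l\<le>m. kern_weight k la (i + j) m * cmod z ^ (i + j - k * m) *
       real (m choose l) * T l (m - l) * Re (z ^ k) ^ l * Im (z ^ k) ^ (m - l) * mixed_coeff k (i + j) m l i)"

lemma kern_weight_odd:
  assumes "k > 0" and "odd (n - k * m)"
  shows "kern_weight k la n m = 0"
  using assms by (simp add: kern_weight_def fps_rpow_cheb_prod_odd)

lemma kern_eq_sum_kern_coeff:
  assumes "k > 0"
  shows "kern k la T z w n = (\<Sum>i\<le>n. kern_coeff k la T z i (n - i) / (fact i * fact (n - i)) * Re w ^ i * Im w ^ (n - i))"
proof -
  let ?q = "\<lambda>m l. kern_weight k la n m * cmod z ^ (n - k * m) *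
       real (m choose l) * T l (m - l) * Re (z ^ k) ^ l * Im (z ^ k) ^ (m - l)"
  have "kern k la T z w n = (\<Sum>m\<le>n div k. \<Sum>l\<le>m. ?q m l * mixed_monomial k n m l w)"
    unfolding kern_def
    by (simp add: sum_distrib_left mixed_monomial_def norm_mult power_mult_distrib mult_ac)
  also have "\<dots> = (\<Sum>m\<le>n div k. \<Sum>l\<le>m. \<Sum>i\<le>n. ?q m l * mixed_coeff k n m l i * Re w ^ i * Im w ^ (n - i))"
  proof (intro sum.cong refl)
    fix m l assume m: "m \<in> {..n div k}" and l: "l \<in> {..m}"
    hence km: "k * m \<le> n" using assms by (simp add: less_eq_div_iff_mult_less_eq mult.commute)
    show "?q m l * mixed_monomial k n m l w =
       (\<Sum>i\<le>n. ?q m l * mixed_coeff k n m l i * Re w ^ i * Im w ^ (n - i))"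
    proof (cases "even (n - k * m)")
      case True
      have "mixed_monomial k n m l w = (\<Sum>i\<le>n. mixed_coeff k n m l i * Re w ^ i * Im w ^ (n - i))"
        using dominated_form_mixed_coeff[OF km True] l unfolding dominated_form_def by auto
      thus ?thesis by (simp add: sum_distrib_left mult.assoc)
    qed (use assms kern_weight_odd in simp)
  qed
  also have "\<dots> = (\<Sum>m\<le>n div k. \<Sum>i\<le>n. \<Sum>l\<le>m. ?q m l * mixed_coeff k n m l i * Re w ^ i * Im w ^ (n - i))"
    by (intro sum.cong refl sum.swap)
  also have "\<dots> = (\<Sum>i\<le>n. \<Sum>m\<le>n div k. \<Sum>l\<le>m. ?q m l * mixed_coeff k n m l i * Re w ^ i * Im w ^ (n - i))"
    by (rule sum.swap)
  also have "\<dots> = (\<Sum>i\<le>n. (\<Sum>m\<le>n div k. \<Sum>l\<le>m. ?q m l * mixed_coeff k n m l i) * Re w ^ i * Im w ^ (n - i))"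
    by (simp only: sum_distrib_right)
  also have "\<dots> = (\<Sum>i\<le>n. kern_coeff k la T z i (n - i) / (fact i * fact (n - i)) * Re w ^ i * Im w ^ (n - i))"
    by (intro sum.cong refl) (simp add: kern_coeff_def)
  finally show ?thesis .
qed

lemma fps_prod_nth_dominated:
  fixes f g :: "nat \<Rightarrow> real fps"
  assumes "\<And>i n. \<bar>f i $ n\<bar> \<le> g i $ n"
  shows "\<bar>(\<Prod>i<k. f i) $ n\<bar> \<le> (\<Prod>i<k. g i) $ n"
proof (induction k arbitrary: n)
  case (Suc k)
  have "\<bar>(\<Prod>i<Suc k. f i) $ n\<bar> \<le> (\<Sum>i=0..n. \<bar>(\<Prod>i<k. f i) $ i\<bar> * \<bar>f k $ (n - i)\<bar>)"
    using sum_abs[of "\<lambda>i. (\<Prod>i<k. f i) $ i * f k $ (n - i)" "{0..n}"] by (simp add: fps_mult_nth abs_mult)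
  also have "\<dots> \<le> (\<Sum>i=0..n. (\<Prod>i<k. g i) $ i * g k $ (n - i))"
    by (intro sum_mono mult_mono Suc assms) (auto intro: order_trans[OF abs_ge_zero Suc])
  finally show ?case by (simp add: fps_mult_nth)
qed simp

lemma fps_rpow_power:
  assumes "f $ 0 = 1"
  shows "fps_rpow f c ^ k = fps_rpow f (real k * c)"
  by (induction k) (simp_all add: algebra_simps fps_rpow_add[OF assms])

lemma pochhammer_le_power2:
  fixes x :: real
  assumes "0 \<le> x" and "x \<le> real L"
  shows "pochhammer x i / fact i \<le> 2 ^ (L + i)"
proof -
  have "pochhammer x i \<le> pochhammer (real (Suc L)) i"
    unfolding pochhammer_prod using assms by (intro prod_mono) auto
  also have "\<dots> / fact i = real (L + i choose i)"
    by (simp add: binomial_gbinomial gbinomial_pochhammer' add.commute)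
  also have "\<dots> \<le> real (2 ^ (L + i))" using binomial_le_pow2[of "L + i" i] of_nat_le_iff by blast
  finally show ?thesis by (simp add: divide_right_mono)
qed

lemma pochhammer_nonneg': "0 \<le> x \<Longrightarrow> 0 \<le> pochhammer (x :: real) n"
  unfolding pochhammer_prod by (intro prod_nonneg) auto

text \<open>As cosines are at most 1 in modulus, each factor is majorised by (1 - X)^(-mu), the
  product by (1 - X)^(-k mu). For mu = la + m the bound L grows by k m, exactly what the degree n -
  k m has lost.\<close>

lemma fps_rpow_cheb_prod_bound:
  assumes "0 \<le> mu" and "real k * mu \<le> real L"
  shows "\<bar>fps_rpow (cheb_prod k 1 (pi / 2)) (- mu) $ i\<bar> \<le> 2 ^ (L + i)"
proof -
  define x where "x j = 1 * cos ((pi / 2 - 2 * real j * pi) / real k)" for j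
  have "fps_rpow (cheb_prod k 1 (pi / 2)) (- mu) = (\<Prod>j<k. fps_rpow (1 - fps_const (x j) * fps_X) (- mu))"
    unfolding cheb_prod_def x_def by (rule fps_rpow_prod) simp
  also have "\<bar>\<dots> $ i\<bar> \<le> (\<Prod>j<k. fps_rpow (1 - fps_const 1 * fps_X) (- mu)) $ i"
  proof (rule fps_prod_nth_dominated)
    fix j n
    have "\<bar>x j\<bar> ^ n \<le> 1" by (simp add: x_def power_le_one)
    thus "\<bar>fps_rpow (1 - fps_const (x j) * fps_X) (- mu) $ n\<bar> \<le> fps_rpow (1 - fps_const 1 * fps_X) (- mu) $ n"
      unfolding fps_rpow_linear_nth using pochhammer_nonneg'[OF assms(1), of n]
      by (auto simp: abs_mult power_abs divide_right_mono mult_left_le)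
  qed
  also have "(\<Prod>j<k. fps_rpow (1 - fps_const 1 * fps_X) (- mu)) = fps_rpow (1 - fps_const 1 * fps_X) (- (real k * mu))"
    by (simp add: fps_rpow_power)
  also have "\<dots> $ i = pochhammer (real k * mu) i / fact i"
    by (simp only: fps_rpow_linear_nth) simp
  also have "\<dots> \<le> 2 ^ (L + i)" using assms by (intro pochhammer_le_power2) auto
  finally show ?thesis .
qed

section \<open>The kernel as an entire series\<close>

text \<open>The factorials i! j! and the binomial bounding \<open>mixed_coeff\<close> combine to n!,
  which the denominator \<open>pochhammer (k la) n\<close> cancels up to d^n. Everything else grows
  at most geometrically in n = i + j.\<close>

lemma kern_coeff_bound:
  assumes k: "k > 0" and la: "la > 0"
  obtains K C where "K \<ge> 0" "C \<ge> 0"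
    "\<And>T i j. (\<And>l l'. \<bar>T l l'\<bar> \<le> 1) \<Longrightarrow> \<bar>kern_coeff k la T z i j\<bar> \<le> K * C ^ (i + j)"
proof -
  obtain L where L: "real k * la \<le> real L" using real_arch_simple by blast
  define d where "d = min (real k * la) 1"
  have d: "0 < d" "d \<le> real k * la" "d \<le> 1" using k la by (auto simp: d_def)
  \<comment> \<open>E^m collects (la + 1)^m from the weight and 2^m from a row of binomials. The 4
    in C is 2 * 2: one factor bounds the power of A, the other absorbs the number n + 1 of
    summands.\<close>
  define E where "E = 2 * (la + 1)"
  have E1: "E \<ge> 1" using la by (simp add: E_def)
  define C where "C = 4 * E * cmod z / d"
  have kw: "\<bar>kern_weight k la n m\<bar> \<le> (la + 1) ^ m * 2 ^ (L + n) / (d ^ n * fact n)" if "k * m \<le> n" for n m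
  proof -
    have b1: "\<bar>fps_rpow (cheb_prod k 1 (pi / 2)) (- (la + real m)) $ (n - k * m)\<bar> \<le> 2 ^ (L + k * m + (n - k * m))"
      using L la by (intro fps_rpow_cheb_prod_bound) (auto simp: algebra_simps)
    have b2: "pochhammer la m / fact m \<le> (la + 1) ^ m"
      using pochhammer_le_fact_power[of la m] la by (simp add: divide_le_eq)
    have h: "2 * (1 / 2 :: real) ^ k \<le> 1" using k by (cases k) (auto simp: power_le_one)
    have b3: "(2 * (1 / 2 :: real) ^ k) ^ m \<le> 1" by (rule power_le_one[OF _ h]) simp
    have pp: "pochhammer (real k * la) n > 0" using k la by (intro pochhammer_pos) auto
    have b4: "1 / pochhammer (real k * la) n \<le> 1 / (d ^ n * fact n)"
      using pochhammer_ge_fact_power[of d "real k * la" n] d pp by (intro divide_left_mono) auto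
    have pm: "pochhammer la m \<ge> 0" using la by (intro pochhammer_nonneg') auto
    have "\<bar>kern_weight k la n m\<bar> \<le> (pochhammer la m / fact m * (2 * (1 / 2) ^ k) ^ m *
       \<bar>fps_rpow (cheb_prod k 1 (pi / 2)) (- (la + real m)) $ (n - k * m)\<bar>) * (1 / pochhammer (real k * la) n)"
      using pm pp by (simp add: kern_weight_def abs_mult)
    also have "\<dots> \<le> ((la + 1) ^ m * 1 * 2 ^ (L + k * m + (n - k * m))) * (1 / (d ^ n * fact n))"
      using pm pp la by (intro mult_mono b1 b2 b3 b4) (auto intro!: mult_nonneg_nonneg)
    also have "L + k * m + (n - k * m) = L + n" using that by simp
    finally show ?thesis by simp
  qed
  have main: "\<bar>kern_coeff k la T z i j\<bar> \<le> 2 ^ L * C ^ (i + j)" if T: "\<And>l l'. \<bar>T l l'\<bar> \<le> 1" for T i j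
  proof -
    define n where "n = i + j"
    define W where "W = 2 ^ (L + n) / (d ^ n * fact n)"
    have W0: "W \<ge> 0" using d by (simp add: W_def)
    have tb: "\<bar>kern_weight k la n m * cmod z ^ (n - k * m) * real (m choose l) * T l (m - l) * Re (z ^ k) ^ l * Im (z ^ k) ^ (m - l) * mixed_coeff k n m l i\<bar>
       \<le> (la + 1) ^ m * W * cmod z ^ n * real (n choose i) * real (m choose l)"
      if m: "m \<in> {..n div k}" and l: "l \<in> {..m}" for m l
    proof -
      have km: "k * m \<le> n" using m k by (simp add: less_eq_div_iff_mult_less_eq mult.commute)
      show ?thesis
      proof (cases "even (n - k * m)")
        case True
        have c1: "\<bar>mixed_coeff k n m l i\<bar> \<le> real (n choose i)"
          using dominated_form_mixed_coeff[OF km True] l unfolding dominated_form_def by auto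
        have c2: "\<bar>Re (z ^ k)\<bar> ^ l \<le> (cmod z ^ k) ^ l"
          using abs_Re_le_cmod[of "z ^ k"] by (intro power_mono) (auto simp: norm_power)
        have c3: "\<bar>Im (z ^ k)\<bar> ^ (m - l) \<le> (cmod z ^ k) ^ (m - l)"
          using abs_Im_le_cmod[of "z ^ k"] by (intro power_mono) (auto simp: norm_power)
        have c4: "\<bar>kern_weight k la n m\<bar> \<le> (la + 1) ^ m * W"
          using kw[OF km] by (simp add: W_def)
        have "\<bar>kern_weight k la n m * cmod z ^ (n - k * m) * real (m choose l) * T l (m - l) * Re (z ^ k) ^ l * Im (z ^ k) ^ (m - l) * mixed_coeff k n m l i\<bar>
          = \<bar>kern_weight k la n m\<bar> * cmod z ^ (n - k * m) * real (m choose l) * \<bar>T l (m - l)\<bar> * \<bar>Re (z ^ k)\<bar> ^ l * \<bar>Im (z ^ k)\<bar> ^ (m - l) * \<bar>mixed_coeff k n m l i\<bar>"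
          by (simp add: abs_mult power_abs)
        also have "\<dots> \<le> ((la + 1) ^ m * W) * cmod z ^ (n - k * m) * real (m choose l) * 1 * (cmod z ^ k) ^ l * (cmod z ^ k) ^ (m - l) * real (n choose i)"
          using la W0 by (intro mult_mono c1 c2 c3 c4 T order_refl) (auto intro!: mult_nonneg_nonneg)
        also have "cmod z ^ n = cmod z ^ (n - k * m) * (cmod z ^ k) ^ l * (cmod z ^ k) ^ (m - l)"
        proof -
          have "n = (n - k * m) + k * l + k * (m - l)" using km l by (simp add: diff_mult_distrib2)
          thus ?thesis by (metis power_add power_mult)
        qed
        hence "((la + 1) ^ m * W) * cmod z ^ (n - k * m) * real (m choose l) * 1 * (cmod z ^ k) ^ l * (cmod z ^ k) ^ (m - l) * real (n choose i)
           = (la + 1) ^ m * W * cmod z ^ n * real (n choose i) * real (m choose l)"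
          by (simp only: mult_ac mult_1_left)
        finally show ?thesis .
      next
        case False
        thus ?thesis using kern_weight_odd[OF k False, of la] la W0 by simp
      qed
    qed
    have "\<bar>kern_coeff k la T z i j\<bar> \<le> fact i * fact j * (\<Sum>m\<le>n div k. \<Sum>l\<le>m. (la + 1) ^ m * W * cmod z ^ n * real (n choose i) * real (m choose l))"
      unfolding kern_coeff_def n_def[symmetric] abs_mult
      by (intro mult_mono order_trans[OF sum_abs] sum_mono tb) auto
    also have "\<dots> = fact i * fact j * real (n choose i) * W * cmod z ^ n * (\<Sum>m\<le>n div k. (la + 1) ^ m * (\<Sum>l\<le>m. real (m choose l)))"
      by (simp add: sum_distrib_left mult_ac)
    also have "(\<Sum>m\<le>n div k. (la + 1) ^ m * (\<Sum>l\<le>m. real (m choose l))) = (\<Sum>m\<le>n div k. E ^ m)"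
    proof (intro sum.cong refl)
      fix m
      have "(\<Sum>l\<le>m. real (m choose l)) = 2 ^ m" by (simp add: choose_row_sum flip: of_nat_sum)
      thus "(la + 1) ^ m * (\<Sum>l\<le>m. real (m choose l)) = E ^ m"
        by (simp only: E_def power_mult_distrib mult.commute)
    qed
    also have "fact i * fact j * real (n choose i) = fact n"
    proof -
      have "fact i * fact j * (n choose i) = (fact n :: nat)"
        using binomial_fact_lemma[of i n] by (simp add: n_def)
      thus ?thesis by (metis of_nat_fact of_nat_mult)
    qed
    also have "fact n * W * cmod z ^ n * (\<Sum>m\<le>n div k. E ^ m) \<le> fact n * W * cmod z ^ n * (2 ^ n * E ^ n)"
    proof (intro mult_left_mono)
      have "(\<Sum>m\<le>n div k. E ^ m) \<le> (\<Sum>m\<le>n. E ^ m)"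
        using E1 by (intro sum_mono2) (auto intro: order_trans[OF _ div_le_dividend])
      also have "\<dots> \<le> (\<Sum>m\<le>n. E ^ n)" using E1 by (intro sum_mono power_increasing) auto
      also have "\<dots> = (1 + real n) * E ^ n" by simp
      also have "\<dots> \<le> 2 ^ n * E ^ n"
      proof -
        have "Suc n \<le> 2 ^ n" by (rule Suc_leI[OF less_exp])
        hence "real (Suc n) \<le> real (2 ^ n)" by (rule of_nat_mono)
        thus ?thesis using E1 by (intro mult_right_mono) auto
      qed
      finally show "(\<Sum>m\<le>n div k. E ^ m) \<le> 2 ^ n * E ^ n" .
    qed (use W0 in auto)
    also have "\<dots> = 2 ^ L * C ^ n"
    proof -
      have "(2::real) ^ n * 2 ^ n = 4 ^ n" by (simp flip: power_mult_distrib)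
      hence "fact n * W * cmod z ^ n * (2 ^ n * E ^ n) = 2 ^ L * (4 ^ n * E ^ n * cmod z ^ n / d ^ n)"
        using d by (simp add: W_def power_add field_simps)
      thus ?thesis by (simp add: C_def power_mult_distrib power_divide)
    qed
    finally show ?thesis unfolding n_def .
  qed
  show ?thesis using main E1 d by (intro that[of "2 ^ L" C]) (auto simp: C_def)
qed

text \<open>This is what gives \<open>cos (arccos \<xi>) = \<xi>\<close>. Each product is at most
  the mean of two squares, and the squares of sine and cosine add up to 1 for both angles.\<close>

lemma abs_xi_uv_le_1:
  assumes "\<bar>u\<bar> \<le> 1" and "\<bar>v\<bar> \<le> 1"
  shows "\<bar>xi_uv u v s t\<bar> \<le> 1"
proof -
  have am: "\<bar>x * y\<bar> \<le> (x\<^sup>2 + y\<^sup>2) / 2" for x y :: real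
    using sum_squares_bound[of "\<bar>x\<bar>" "\<bar>y\<bar>"] by (simp add: abs_mult)
  have "\<bar>v * (cos s * cos t)\<bar> \<le> 1 * ((cos s)\<^sup>2 + (cos t)\<^sup>2) / 2"
    using mult_mono[OF assms(2) am[of "cos s" "cos t"]] by (simp add: abs_mult)
  moreover have "\<bar>u * (sin s * sin t)\<bar> \<le> 1 * ((sin s)\<^sup>2 + (sin t)\<^sup>2) / 2"
    using mult_mono[OF assms(1) am[of "sin s" "sin t"]] by (simp add: abs_mult)
  ultimately have "\<bar>xi_uv u v s t\<bar> \<le> ((cos s)\<^sup>2 + (cos t)\<^sup>2) / 2 + ((sin s)\<^sup>2 + (sin t)\<^sup>2) / 2"
    unfolding xi_uv_def mult.assoc by linarith
  thus ?thesis using sin_cos_squared_add[of s] sin_cos_squared_add[of t] by argo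
qed

lemma power_eq_cmod_cos_sin_Arg:
  assumes "k > 0"
  shows "Re (z ^ k) = cmod z ^ k * cos (real k * Arg z)" "Im (z ^ k) = cmod z ^ k * sin (real k * Arg z)"
proof -
  have "z ^ k = (of_real (cmod z) * cis (Arg z)) ^ k"
    using rcis_cmod_Arg[of z] by (simp add: rcis_def)
  also have "\<dots> = of_real (cmod z ^ k) * cis (real k * Arg z)"
    by (simp add: power_mult_distrib Complex.DeMoivre)
  finally have e: "z ^ k = of_real (cmod z ^ k) * cis (real k * Arg z)" .
  show "Re (z ^ k) = cmod z ^ k * cos (real k * Arg z)" "Im (z ^ k) = cmod z ^ k * sin (real k * Arg z)"
    unfolding e by (simp_all del: of_real_power)
qed

text \<open>\<open>Arg\<close> occurs only in |zw|^k \<xi> = v Re(z^k) Re(w^k) + u Im(z^k) Im(w^k),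
  and \<open>arccos\<close> only under a cosine. The branch cut of the one and the endpoint
  singularities of the other thus leave no trace in the expansion.\<close>

lemma J_uv_has_sum_kern:
  assumes k: "k > 0" and ab: "a + b > 0" and u: "\<bar>u\<bar> \<le> 1" and v: "\<bar>v\<bar> \<le> 1"
  shows "((\<lambda>n. kern k (a + b) (\<lambda>l l'. v ^ l * u ^ l') z w n) has_sum J_uv k a b u v z w) UNIV"
proof -
  define r where "r = cmod (z * w)"
  define x where "x = xi_uv u v (real k * Arg z) (real k * Arg w)"
  define la where "la = a + b"
  define q where "q = arccos x"
  define c where "c q n = fps_rpow (cheb_prod k r q) (- la) $ n / pochhammer (real k * la) n" for q n
  have x1: "\<bar>x\<bar> \<le> 1" unfolding x_def by (rule abs_xi_uv_le_1[OF u v])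
  have cq: "cos q = x" using x1 by (simp add: q_def cos_arccos_abs)
  have hs: "(c q has_sum humbert_Phi2 k (\<lambda>_. la) (real k * la) (\<lambda>j. r * cos ((q - 2 * real j * pi) / real k))) UNIV" for q
  proof -
    have "fps_rpow (cheb_prod k r q) (- la) = (\<Prod>i<k. fps_rpow (1 - fps_const (r * cos ((q - 2 * real i * pi) / real k)) * fps_X) (- la))"
      unfolding cheb_prod_def by (rule fps_rpow_prod) simp
    thus ?thesis unfolding c_def using humbert_Phi2_has_sum[where l = la and gam = "real k * la" and m = k] k ab by (simp add: la_def)
  qed
  have "((\<lambda>n. (c q n + c (pi - q) n) * (1 / 2)) has_sum g_fun k a b r x) UNIV"
    unfolding g_fun_def Let_def q_def[symmetric] la_def[symmetric]
    using has_sum_cmult_left[OF has_sum_add[OF hs[of q] hs[of "pi - q"]], of "1 / 2"] by simp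
  moreover have "(c q n + c (pi - q) n) * (1 / 2) = kern k la (\<lambda>l l'. v ^ l * u ^ l') z w n" for n
  proof -
    define A where "A m = fps_rpow (cheb_prod k 1 (pi / 2)) (- la - real m) $ (n - k * m)" for m
    define D where "D = pochhammer (real k * la) n"
    have "(c q n + c (pi - q) n) * (1 / 2) = (\<Sum>m\<le>n div k. pochhammer la m / fact m * (2 * (1 / 2) ^ k) ^ m * A m / D * r ^ n * ((x ^ m + (- x) ^ m) / 2))"
      unfolding c_def fps_rpow_cheb_prod[OF k] A_def[symmetric] D_def[symmetric] cos_pi_minus cq
        add_divide_distrib[symmetric] sum.distrib[symmetric] sum_divide_distrib sum_distrib_right
      by (intro sum.cong refl) (simp only: power_mult_distrib, simp add: algebra_simps add_divide_distrib)
    also have "\<dots> = kern k la (\<lambda>l l'. v ^ l * u ^ l') z w n"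
      unfolding kern_def
    proof (intro sum.cong refl)
      fix m assume "m \<in> {..n div k}"
      hence km: "k * m \<le> n" using k by (simp add: less_eq_div_iff_mult_less_eq mult.commute)
      define X where "X = v * (Re (z ^ k) * Re (w ^ k)) + u * (Im (z ^ k) * Im (w ^ k))"
      have X: "r ^ k * x = X"
        unfolding X_def power_eq_cmod_cos_sin_Arg[OF k] x_def xi_uv_def r_def norm_mult power_mult_distrib
        by (simp add: algebra_simps)
      have rn: "r ^ n = r ^ (n - k * m) * (r ^ k) ^ m"
        using km by (simp flip: power_mult power_add)
      have "(\<Sum>l\<le>m. real (m choose l) * (v ^ l * u ^ (m - l)) * (Re (z ^ k) * Re (w ^ k)) ^ l * (Im (z ^ k) * Im (w ^ k)) ^ (m - l)) = X ^ m"
        unfolding X_def binomial_ring power_mult_distrib by (intro sum.cong refl) (simp add: mult_ac)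
      moreover have "pochhammer la m / fact m * (2 * (1 / 2) ^ k) ^ m * A m / D * r ^ n * ((x ^ m + (- x) ^ m) / 2) =
         kern_weight k la n m * r ^ (n - k * m) * X ^ m"
      proof (cases "even m")
        case True
        have "r ^ n * ((x ^ m + (- x) ^ m) / 2) = r ^ (n - k * m) * X ^ m"
          unfolding rn X[symmetric] power_mult_distrib using True by simp
        thus ?thesis using True unfolding kern_weight_def A_def[symmetric] D_def[symmetric] by (simp add: mult.assoc)
      qed (simp add: kern_weight_def)
      ultimately show "pochhammer la m / fact m * (2 * (1 / 2) ^ k) ^ m * A m / D * r ^ n * ((x ^ m + (- x) ^ m) / 2) =
         kern_weight k la n m * cmod (z * w) ^ (n - k * m) *
         (\<Sum>l\<le>m. real (m choose l) * (v ^ l * u ^ (m - l)) * (Re (z ^ k) * Re (w ^ k)) ^ l * (Im (z ^ k) * Im (w ^ k)) ^ (m - l))"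
        by (simp only: r_def)
    qed
    finally show ?thesis .
  qed
  ultimately show ?thesis by (simp add: J_uv_def r_def x_def la_def)
qed

text \<open>Exponential normalisation: \<open>h i j\<close> becomes the partial derivative of order
  (i, j) at 0, and differentiation an index shift.\<close>

definition exp_series :: "(nat \<Rightarrow> nat \<Rightarrow> real) \<Rightarrow> complex \<Rightarrow> real" where
  "exp_series h w = infsum (\<lambda>(i, j). h i j / (fact i * fact j) * Re w ^ i * Im w ^ j) UNIV"

text \<open>Growth of exponential type. It survives index shifts and suffices both for convergence
  everywhere and for termwise integration against Gaussians.\<close>

definition geom_bounded :: "(nat \<Rightarrow> nat \<Rightarrow> real) \<Rightarrow> bool" where
  "geom_bounded h \<longleftrightarrow> (\<exists>K C. K \<ge> 0 \<and> C \<ge> 0 \<and> (\<forall>i j. \<bar>h i j\<bar> \<le> K * C ^ (i + j)))"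

lemma exp_terms_has_sum: "((\<lambda>n. c ^ n / fact n :: real) has_sum exp c) UNIV"
proof (rule norm_summable_imp_has_sum)
  show "summable (\<lambda>n. norm (c ^ n / fact n))"
    using summable_norm_exp[of c] by (simp add: divide_inverse mult.commute)
  show "(\<lambda>n. c ^ n / fact n) sums exp c"
    using exp_converges[of c] by (simp add: divide_inverse mult.commute)
qed

lemma summable_on_prod_nonneg:
  fixes s t :: "nat \<Rightarrow> real"
  assumes s: "s summable_on UNIV" "\<And>i. s i \<ge> 0" and t: "t summable_on UNIV" "\<And>i. t i \<ge> 0"
  shows "(\<lambda>(i, j). s i * t j) summable_on UNIV"
  unfolding UNIV_Times_UNIV[symmetric]
proof (rule summable_on_SigmaI)
  show "((\<lambda>j. case (i, j) of (i, j) \<Rightarrow> s i * t j) has_sum (s i * infsum t UNIV)) UNIV" for i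
    unfolding prod.case by (intro has_sum_cmult_right has_sum_infsum t)
  show "(\<lambda>i. s i * infsum t UNIV) summable_on UNIV"
    by (rule summable_on_cmult_left[OF s(1)])
qed (use s t in auto)

lemma exp_series_has_sum:
  assumes "geom_bounded h"
  shows "((\<lambda>(i, j). h i j / (fact i * fact j) * Re w ^ i * Im w ^ j) has_sum exp_series h w) UNIV"
proof -
  obtain K C where KC: "K \<ge> 0" "C \<ge> 0" "\<And>i j. \<bar>h i j\<bar> \<le> K * C ^ (i + j)"
    using assms unfolding geom_bounded_def by blast
  have "(\<lambda>(i, j). K * ((C * \<bar>Re w\<bar>) ^ i / fact i * ((C * \<bar>Im w\<bar>) ^ j / fact j))) summable_on UNIV"
    using summable_on_cmult_right[OF summable_on_prod_nonneg[OF exp_terms_summable_on _ exp_terms_summable_on], of "C * \<bar>Re w\<bar>" "C * \<bar>Im w\<bar>" K] KC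
    by (simp add: case_prod_unfold)
  hence "(\<lambda>(i, j). h i j / (fact i * fact j) * Re w ^ i * Im w ^ j) summable_on UNIV"
  proof (rule abs_summable_summable[OF summable_on_comparison_test], goal_cases)
    case (1 p)
    obtain i j where p: "p = (i, j)" by fastforce
    have "\<bar>h i j\<bar> * (\<bar>Re w\<bar> ^ i * \<bar>Im w\<bar> ^ j / (fact i * fact j)) \<le> K * C ^ (i + j) * (\<bar>Re w\<bar> ^ i * \<bar>Im w\<bar> ^ j / (fact i * fact j))"
      by (intro mult_right_mono KC) auto
    also have "\<dots> = K * ((C * \<bar>Re w\<bar>) ^ i / fact i * ((C * \<bar>Im w\<bar>) ^ j / fact j))"
      by (simp add: power_mult_distrib power_add)
    finally show ?case by (simp add: p abs_mult power_abs)
  qed auto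
  thus ?thesis unfolding exp_series_def by (rule has_sum_infsum)
qed

lemma geom_bounded_shift_fst:
  assumes "geom_bounded h"
  shows "geom_bounded (\<lambda>i. h (Suc i))"
proof -
  obtain K C where KC: "K \<ge> 0" "C \<ge> 0" "\<And>i j. \<bar>h i j\<bar> \<le> K * C ^ (i + j)"
    using assms unfolding geom_bounded_def by blast
  have "\<bar>h (Suc i) j\<bar> \<le> K * C * C ^ (i + j)" for i j
    using KC(3)[of "Suc i" j] by (simp add: mult.assoc)
  thus ?thesis unfolding geom_bounded_def
    by - (rule exI[of _ "K * C"], rule exI[of _ C], use KC(1,2) in auto)
qed

lemma geom_bounded_swap: "geom_bounded h \<Longrightarrow> geom_bounded (\<lambda>i j. h j i)"
  unfolding geom_bounded_def by (metis add.commute)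

lemma exp_series_0: "exp_series h 0 = h 0 0"
proof -
  have "((\<lambda>(i, j). h i j / (fact i * fact j) * Re 0 ^ i * Im 0 ^ j) has_sum h 0 0) UNIV"
    by (rule has_sum_finite_neutralI[where B = "{(0, 0)}"]) (auto simp: power_0_left split: if_splits)
  thus ?thesis unfolding exp_series_def by (rule infsumI)
qed

lemma exp_series_swap: "exp_series h w = exp_series (\<lambda>i j. h j i) (Complex (Im w) (Re w))"
  unfolding exp_series_def
  by (rule infsum_reindex_bij_witness[where i = "\<lambda>(i, j). (j, i)" and j = "\<lambda>(i, j). (j, i)"]) (auto simp: mult_ac)

text \<open>Summing over j inside leaves an ordinary power series in x for fixed y, to which
  termwise differentiation in one variable applies.\<close>

lemma exp_series_sums_fst:
  assumes h: "geom_bounded h"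
  defines "b \<equiv> \<lambda>h i y. infsum (\<lambda>j. h i j / fact j * y ^ j :: real) UNIV"
  shows "(\<lambda>i. b h i y / fact i * x ^ i) sums exp_series h (Complex x y)"
proof -
  obtain K C where KC: "K \<ge> 0" "C \<ge> 0" "\<And>i j. \<bar>h i j\<bar> \<le> K * C ^ (i + j)"
    using h unfolding geom_bounded_def by blast
  have inner: "((\<lambda>j. h i j / fact j * y ^ j) has_sum b h i y) UNIV" for i
  proof -
    have "(\<lambda>j. K * C ^ i * ((C * \<bar>y\<bar>) ^ j / fact j)) summable_on UNIV"
      by (rule summable_on_cmult_right[OF has_sum_imp_summable[OF exp_terms_has_sum]])
    hence "(\<lambda>j. h i j / fact j * y ^ j) summable_on UNIV"
    proof (rule abs_summable_summable[OF summable_on_comparison_test], goal_cases)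
      case (1 j)
      have "\<bar>h i j\<bar> * (\<bar>y\<bar> ^ j / fact j) \<le> K * C ^ (i + j) * (\<bar>y\<bar> ^ j / fact j)"
        by (intro mult_right_mono KC) auto
      also have "\<dots> = K * C ^ i * ((C * \<bar>y\<bar>) ^ j / fact j)"
        by (simp add: power_mult_distrib power_add)
      finally show ?case by (simp add: abs_mult power_abs)
    qed auto
    thus ?thesis unfolding b_def by (rule has_sum_infsum)
  qed
  have "((\<lambda>(i, j). h i j / (fact i * fact j) * x ^ i * y ^ j) has_sum exp_series h (Complex x y)) (UNIV \<times> UNIV)"
    using exp_series_has_sum[OF h, of "Complex x y"] by simp
  moreover have "((\<lambda>j. case (i, j) of (i, j) \<Rightarrow> h i j / (fact i * fact j) * x ^ i * y ^ j) has_sum b h i y / fact i * x ^ i) UNIV" for i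
    using has_sum_cmult_right[OF inner[of i], of "x ^ i / fact i"] by (simp add: mult_ac)
  ultimately have "((\<lambda>i. b h i y / fact i * x ^ i) has_sum exp_series h (Complex x y)) UNIV"
    by (rule has_sum_SigmaD)
  thus ?thesis by (rule has_sum_imp_sums)
qed

lemma pderiv_dir_1_exp_series:
  assumes h: "geom_bounded h"
  shows "pderiv_dir 1 (exp_series h) = exp_series (\<lambda>i. h (Suc i))"
proof
  fix w
  define b where "b h i = infsum (\<lambda>j. h i j / fact j * Im w ^ j :: real) UNIV" for h :: "nat \<Rightarrow> nat \<Rightarrow> real" and i
  define c where "c i = b h i / fact i" for i
  have s: "(\<lambda>i. c i * x ^ i) sums exp_series h (Complex x (Im w))" for x
    unfolding c_def b_def by (rule exp_series_sums_fst[OF h])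
  have s': "(\<lambda>i. diffs c i * x ^ i) sums exp_series (\<lambda>i. h (Suc i)) (Complex x (Im w))" for x
  proof -
    have "diffs c i = b (\<lambda>i. h (Suc i)) i / fact i" for i
    proof -
      have "real (Suc i) * (x / fact (Suc i)) = x / fact i" for x :: real
        by (simp only: fact_Suc) (simp del: of_nat_Suc)
      thus ?thesis by (simp only: diffs_def c_def b_def)
    qed
    thus ?thesis unfolding b_def using exp_series_sums_fst[OF geom_bounded_shift_fst[OF h], of "Im w" x] by simp
  qed
  have "((\<lambda>x. suminf (\<lambda>i. c i * x ^ i)) has_field_derivative suminf (\<lambda>i. diffs c i * Re w ^ i)) (at (Re w))"
    by (rule termdiffs_strong_converges_everywhere) (use s sums_summable in blast)
  hence "((\<lambda>x. exp_series h (Complex x (Im w))) has_field_derivative exp_series (\<lambda>i. h (Suc i)) w) (at (Re w + 0))"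
    using sums_unique[OF s] sums_unique[OF s', of "Re w"] by simp
  hence "((\<lambda>t. exp_series h (Complex (Re w + t) (Im w))) has_field_derivative exp_series (\<lambda>i. h (Suc i)) w) (at 0)"
    using DERIV_shift[of "\<lambda>x. exp_series h (Complex x (Im w))" "exp_series (\<lambda>i. h (Suc i)) w" 0 "Re w"]
    by (simp add: add.commute)
  moreover have "Complex (Re w + t) (Im w) = w + of_real t * 1" for t by (simp add: complex_eq_iff)
  ultimately show "pderiv_dir 1 (exp_series h) w = exp_series (\<lambda>i. h (Suc i)) w"
    unfolding pderiv_dir_def by (intro DERIV_imp_deriv) simp
qed

text \<open>Exchanging the coordinates reduces this to the other direction.\<close>

lemma pderiv_dir_ii_exp_series:
  assumes h: "geom_bounded h"
  shows "pderiv_dir \<i> (exp_series h) = exp_series (\<lambda>i j. h i (Suc j))"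
proof
  fix w
  let ?w = "Complex (Im w) (Re w)"
  have "pderiv_dir \<i> (exp_series h) w = pderiv_dir 1 (exp_series (\<lambda>i j. h j i)) ?w"
  proof -
    have "exp_series h (w + of_real t * \<i>) = exp_series (\<lambda>i j. h j i) (?w + of_real t * 1)" for t
      by (subst exp_series_swap) (simp add: complex_eq_iff plus_complex.code)
    thus ?thesis by (simp add: pderiv_dir_def)
  qed
  also have "\<dots> = exp_series (\<lambda>i j. h j (Suc i)) ?w"
    by (simp add: pderiv_dir_1_exp_series geom_bounded_swap[OF h])
  also have "\<dots> = exp_series (\<lambda>i j. h i (Suc j)) w" by (subst (2) exp_series_swap) simp
  finally show "pderiv_dir \<i> (exp_series h) w = exp_series (\<lambda>i j. h i (Suc j)) w" .
qed

lemma geom_bounded_shift_snd: "geom_bounded h \<Longrightarrow> geom_bounded (\<lambda>i j. h i (Suc j))"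
  by (drule geom_bounded_swap, drule geom_bounded_shift_fst, drule geom_bounded_swap)

lemma iterated_pderiv_exp_series:
  assumes "geom_bounded h"
  shows "(pderiv_dir 1 ^^ i) ((pderiv_dir \<i> ^^ j) (exp_series h)) 0 = h i j"
proof -
  have 1: "geom_bounded (\<lambda>i' j'. h i' (j + j')) \<and>
      (pderiv_dir \<i> ^^ j) (exp_series h) = exp_series (\<lambda>i' j'. h i' (j + j'))" for j
  proof (induction j)
    case (Suc j)
    show ?case using geom_bounded_shift_snd[of "\<lambda>i' j'. h i' (j + j')"] Suc
      by (simp add: pderiv_dir_ii_exp_series)
  qed (simp add: assms)
  have "geom_bounded (\<lambda>i' j'. h (i + i') (j + j')) \<and>
      (pderiv_dir 1 ^^ i) (exp_series (\<lambda>i' j'. h i' (j + j'))) = exp_series (\<lambda>i' j'. h (i + i') (j + j'))" for i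
  proof (induction i)
    case (Suc i)
    show ?case using geom_bounded_shift_fst[of "\<lambda>i' j'. h (i + i') (j + j')"] Suc
      by (simp add: pderiv_dir_1_exp_series)
  qed (use 1 in simp)
  thus ?thesis using 1[of j] by (simp add: exp_series_0)
qed

text \<open>Summability over all pairs permits summation along i + j = n, the order in which
  \<open>kern\<close> delivers the terms.\<close>

lemma exp_series_eq_if_antidiagonal_has_sum:
  assumes h: "geom_bounded h"
    and "((\<lambda>n. \<Sum>i\<le>n. h i (n - i) / (fact i * fact (n - i)) * Re w ^ i * Im w ^ (n - i)) has_sum S) UNIV"
  shows "exp_series h w = S"
proof -
  define f where "f = (\<lambda>(i, j). h i j / (fact i * fact j) * Re w ^ i * Im w ^ j)"
  have "((\<lambda>(n, i). f (i, n - i)) has_sum exp_series h w) (SIGMA n:UNIV. {..n}) \<longleftrightarrow> (f has_sum exp_series h w) UNIV"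
    by (rule has_sum_reindex_bij_witness[where i = "\<lambda>(i, j). (i + j, i)" and j = "\<lambda>(n, i). (i, n - i)"]) auto
  hence "((\<lambda>(n, i). f (i, n - i)) has_sum exp_series h w) (SIGMA n:UNIV. {..n})"
    using exp_series_has_sum[OF h, of w] by (simp add: f_def)
  moreover have "((\<lambda>i. case (n, i) of (n, i) \<Rightarrow> f (i, n - i)) has_sum
      (\<Sum>i\<le>n. h i (n - i) / (fact i * fact (n - i)) * Re w ^ i * Im w ^ (n - i))) {..n}" for n
    by (rule has_sum_finiteI) (auto simp: f_def)
  ultimately have "((\<lambda>n. \<Sum>i\<le>n. h i (n - i) / (fact i * fact (n - i)) * Re w ^ i * Im w ^ (n - i)) has_sum exp_series h w) UNIV"
    by (rule has_sum_SigmaD)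
  thus ?thesis using assms(2) has_sum_unique by blast
qed

lemma geom_bounded_kern_coeff:
  assumes "k > 0" and "la > 0" and "\<And>l l'. \<bar>T l l'\<bar> \<le> 1"
  shows "geom_bounded (kern_coeff k la T z)"
proof -
  obtain K C where "K \<ge> 0" "C \<ge> 0"
    "\<And>T i j. (\<And>l l'. \<bar>T l l'\<bar> \<le> 1) \<Longrightarrow> \<bar>kern_coeff k la T z i j\<bar> \<le> K * C ^ (i + j)"
    using kern_coeff_bound[OF assms(1,2)] by metis
  thus ?thesis unfolding geom_bounded_def using assms(3) by metis
qed

lemma J_uv_eq_exp_series:
  assumes k: "k > 0" and ab: "a + b > 0" and u: "\<bar>u\<bar> \<le> 1" and v: "\<bar>v\<bar> \<le> 1"
  shows "J_uv k a b u v z = exp_series (kern_coeff k (a + b) (\<lambda>l l'. v ^ l * u ^ l') z)"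
    and "geom_bounded (kern_coeff k (a + b) (\<lambda>l l'. v ^ l * u ^ l') z)"
proof -
  show g: "geom_bounded (kern_coeff k (a + b) (\<lambda>l l'. v ^ l * u ^ l') z)"
    using k ab u v by (intro geom_bounded_kern_coeff) (auto simp: abs_mult power_abs power_le_one mult_le_one)
  show "J_uv k a b u v z = exp_series (kern_coeff k (a + b) (\<lambda>l l'. v ^ l * u ^ l') z)"
    using J_uv_has_sum_kern[OF k ab u v]
    by (intro ext exp_series_eq_if_antidiagonal_has_sum[OF g, symmetric]) (simp add: kern_eq_sum_kern_coeff[OF k])
qed

lemma p_uv_eq_sum_kern_coeff:
  assumes "k > 0" and "a + b > 0" and "\<bar>u\<bar> \<le> 1" and "\<bar>v\<bar> \<le> 1"
  shows "p_uv k a b p u v z = (\<Sum>(i, j)\<in>{ij. poly_coeffs p ij \<noteq> 0}.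
     poly_coeffs p (i, j) * kern_coeff k (a + b) (\<lambda>l l'. v ^ l * u ^ l') z i j)"
  unfolding p_uv_def poly_diff_op_def Let_def J_uv_eq_exp_series(1)[OF assms]
  by (simp add: iterated_pderiv_exp_series[OF J_uv_eq_exp_series(2)[OF assms]])

section \<open>A solution of the Dunkl recursion\<close>

text \<open>The rank-one intertwiner sends x^n to \<open>rank1_coeff b n\<close> times x^n, because
  the rank-one Dunkl operator maps x^n to (n + b (1 - (-1)^n)) x^(n - 1).\<close>

primrec rank1_coeff :: "real \<Rightarrow> nat \<Rightarrow> real" where
  "rank1_coeff b 0 = 1"
| "rank1_coeff b (Suc n) = real (Suc n) / (real (Suc n) + b * (1 - (- 1) ^ Suc n)) * rank1_coeff b n"

lemma rank1_coeff_rec: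
  assumes "b > 0"
  shows "(real (Suc n) + b * (1 - (- 1) ^ Suc n)) * rank1_coeff b (Suc n) = real (Suc n) * rank1_coeff b n"
proof -
  have "(- 1 :: real) ^ Suc n \<le> 1" by (cases "even n") auto
  hence "real (Suc n) + b * (1 - (- 1) ^ Suc n) > 0" using assms by (intro add_pos_nonneg) auto
  thus ?thesis by (simp del: of_nat_Suc power_Suc)
qed

text \<open>For \<open>X = Re \<zeta> * Re \<eta>\<close>, \<open>Y = Im \<zeta> * Im \<eta>\<close> this is the image of \<open>(\<lambda>\<zeta>. (\<zeta> \<bullet> \<eta>) ^ m)\<close>
  under the (product) intertwining operator of the group generated by the two coordinate reflections.\<close>

definition rank2_poly :: "real \<Rightarrow> real \<Rightarrow> real \<Rightarrow> real \<Rightarrow> nat \<Rightarrow> real" where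
  "rank2_poly a b X Y m = (\<Sum>i\<le>m. real (m choose i) * rank1_coeff b i * rank1_coeff a (m - i) * X ^ i * Y ^ (m - i))"

text \<open>Euler's identity for two commuting reflections, Y changing sign with weight a and X with
  weight b. Termwise, n = i + (n - i) splits the left side into two rank-one recursions, and
  binomial absorption reassembles degree m.\<close>

lemma rank2_poly_rec:
  assumes a: "a > 0" and b: "b > 0"
  shows "(real (Suc m) + (a + b)) * rank2_poly a b X Y (Suc m) - a * rank2_poly a b X (- Y) (Suc m)
      - b * rank2_poly a b (- X) Y (Suc m) = real (Suc m) * (X + Y) * rank2_poly a b X Y m"
proof -
  let ?a = "rank1_coeff a" and ?b = "rank1_coeff b" and ?Q = "rank2_poly a b"
  define n where "n = Suc m"
  have absorb: "C * p * (w * x) * y * (s * q) = N * w * (M * q * p * x * y)"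
      "C * q * x * (w * y) * (s * p) = N * w * (M * q * p * x * y)"
    if "s * C = N * M" for C M N p q s w x y :: real
    using that by algebra+
  have "(real n + (a + b)) * ?Q X Y n - a * ?Q X (- Y) n - b * ?Q (- X) Y n =
    (\<Sum>i\<le>n. real (n choose i) * ?b i * ?a (n - i) * X ^ i * Y ^ (n - i) *
       ((real i + b * (1 - (- 1) ^ i)) + (real (n - i) + a * (1 - (- 1) ^ (n - i)))))"
    unfolding rank2_poly_def sum_distrib_left sum_subtractf[symmetric]
  proof (intro sum.cong refl)
    fix i assume "i \<in> {..n}"
    hence e: "real n = real i + real (n - i)" by simp
    have alg: "(I + J + (a + b)) * (C * x * y) - a * (C * x * (s * y)) - b * (C * (t * x) * y) =
        C * x * y * ((I + b * (1 - t)) + (J + a * (1 - s)))" for I J C x y s t :: real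
      by (simp add: algebra_simps)
    show "(real n + (a + b)) * (real (n choose i) * ?b i * ?a (n - i) * X ^ i * Y ^ (n - i)) -
      a * (real (n choose i) * ?b i * ?a (n - i) * X ^ i * (- Y) ^ (n - i)) -
      b * (real (n choose i) * ?b i * ?a (n - i) * (- X) ^ i * Y ^ (n - i)) =
      real (n choose i) * ?b i * ?a (n - i) * X ^ i * Y ^ (n - i) *
       ((real i + b * (1 - (- 1) ^ i)) + (real (n - i) + a * (1 - (- 1) ^ (n - i))))"
      unfolding power_minus[of X] power_minus[of Y] by (subst e) (rule alg)
  qed
  also have "\<dots> = (\<Sum>i\<le>n. real (n choose i) * ?a (n - i) * X ^ i * Y ^ (n - i) * ((real i + b * (1 - (- 1) ^ i)) * ?b i))
     + (\<Sum>i\<le>n. real (n choose i) * ?b i * X ^ i * Y ^ (n - i) * ((real (n - i) + a * (1 - (- 1) ^ (n - i))) * ?a (n - i)))"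
    unfolding sum.distrib[symmetric] by (intro sum.cong refl) algebra
  also have "(\<Sum>i\<le>n. real (n choose i) * ?a (n - i) * X ^ i * Y ^ (n - i) * ((real i + b * (1 - (- 1) ^ i)) * ?b i))
     = real n * X * ?Q X Y m"
  proof -
    have "(\<Sum>i\<le>n. real (n choose i) * ?a (n - i) * X ^ i * Y ^ (n - i) * ((real i + b * (1 - (- 1) ^ i)) * ?b i)) =
      (\<Sum>i\<le>m. real (Suc m choose Suc i) * ?a (m - i) * X ^ Suc i * Y ^ (m - i) * (real (Suc i) * ?b i))"
      unfolding n_def sum.atMost_Suc_shift rank1_coeff_rec[OF b] by simp
    also have "\<dots> = (\<Sum>i\<le>m. real n * X * (real (m choose i) * ?b i * ?a (m - i) * X ^ i * Y ^ (m - i)))"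
    proof (intro sum.cong refl)
      fix i
      have "real (Suc i) * real (Suc m choose Suc i) = real n * real (m choose i)"
        unfolding n_def of_nat_mult[symmetric] Suc_times_binomial by simp
      thus "real (Suc m choose Suc i) * ?a (m - i) * X ^ Suc i * Y ^ (m - i) * (real (Suc i) * ?b i) =
         real n * X * (real (m choose i) * ?b i * ?a (m - i) * X ^ i * Y ^ (m - i))"
        unfolding power_Suc by (rule absorb)
    qed
    finally show ?thesis by (simp only: rank2_poly_def sum_distrib_left)
  qed
  also have "(\<Sum>i\<le>n. real (n choose i) * ?b i * X ^ i * Y ^ (n - i) * ((real (n - i) + a * (1 - (- 1) ^ (n - i))) * ?a (n - i)))
     = real n * Y * ?Q X Y m"
  proof -
    have "(\<Sum>i\<le>n. real (n choose i) * ?b i * X ^ i * Y ^ (n - i) * ((real (n - i) + a * (1 - (- 1) ^ (n - i))) * ?a (n - i))) =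
      (\<Sum>i\<le>m. real (Suc m choose i) * ?b i * X ^ i * Y ^ (Suc m - i) * ((real (Suc m - i) + a * (1 - (- 1) ^ (Suc m - i))) * ?a (Suc m - i)))"
      unfolding n_def sum.atMost_Suc by simp
    also have "\<dots> = (\<Sum>i\<le>m. real n * Y * (real (m choose i) * ?b i * ?a (m - i) * X ^ i * Y ^ (m - i)))"
    proof (intro sum.cong refl)
      fix i assume "i \<in> {..m}"
      hence s: "Suc m - i = Suc (m - i)" by auto
      have "(Suc m - i) * (Suc m choose i) = Suc m * (m choose i)"
        using binomial_absorb_comp[of "Suc m" i] by simp
      hence "real (Suc (m - i)) * real (Suc m choose i) = real n * real (m choose i)"
        unfolding n_def of_nat_mult[symmetric] s by simp
      thus "real (Suc m choose i) * ?b i * X ^ i * Y ^ (Suc m - i) * ((real (Suc m - i) + a * (1 - (- 1) ^ (Suc m - i))) * ?a (Suc m - i)) =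
         real n * Y * (real (m choose i) * ?b i * ?a (m - i) * X ^ i * Y ^ (m - i))"
        unfolding s rank1_coeff_rec[OF a] power_Suc[of Y] by (rule absorb)
    qed
    finally show ?thesis by (simp only: rank2_poly_def sum_distrib_left)
  qed
  finally show ?thesis unfolding n_def by (simp add: algebra_simps)
qed

text \<open>The Pochhammer weights are the rescaling of Euler's identity with total multiplicity a +
  b, and 2 (1/2)^k is the Chebyshev constant in front of X^k, so that t = X^k / A can be
  substituted.\<close>

definition rank2_series :: "nat \<Rightarrow> real \<Rightarrow> real \<Rightarrow> real \<Rightarrow> real \<Rightarrow> real fps" where
  "rank2_series k a b X Y = Abs_fps (\<lambda>m. pochhammer (a + b + 1) m / fact m * (2 * (1 / 2) ^ k) ^ m * rank2_poly a b X Y m)"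

lemma rank2_series_rec:
  fixes a b X Y :: real and k :: nat
  assumes a: "a > 0" and b: "b > 0"
  defines "d \<equiv> (1 - fps_const (2 * (1 / 2) ^ k * (X + Y)) * fps_X) * rank2_series k a b X Y"
  shows "fps_const (a + b) * d + fps_X * fps_deriv d =
    fps_const a * rank2_series k a b X (- Y) + fps_const b * rank2_series k a b (- X) Y"
proof (rule fps_ext)
  fix n
  define H where "H X Y m = pochhammer (a + b + 1) m / fact m * (2 * (1 / 2) ^ k) ^ m * rank2_poly a b X Y m" for X Y m
  define B :: real where "B = 2 * (1 / 2) ^ k"
  have H: "rank2_series k a b X Y $ m = H X Y m" for X Y m by (simp add: rank2_series_def H_def)
  have "(fps_const (a + b) * d + fps_X * fps_deriv d) $ n = (a + b + real n) * d $ n"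
    by (cases n) (simp_all add: algebra_simps)
  also have "\<dots> = a * H X (- Y) n + b * H (- X) Y n"
  proof (cases n)
    case 0
    thus ?thesis by (simp add: d_def H H_def rank2_poly_def algebra_simps)
  next
    case (Suc m)
    have dn: "d $ Suc m = H X Y (Suc m) - B * (X + Y) * H X Y m"
      unfolding d_def left_diff_distrib fps_sub_nth mult.assoc fps_mult_left_const_nth B_def[symmetric] by (simp add: H)
    define P where "P m = pochhammer (a + b + 1) m / fact m * B ^ m" for m
    have HP: "H X Y m = P m * rank2_poly a b X Y m" for X Y m by (simp add: H_def P_def B_def)
    have PS: "real (Suc m) * P (Suc m) = (a + b + real (Suc m)) * B * P m"
    proof -
      have "real (Suc m) * (x * y / (real (Suc m) * f) * (B * c)) = y * B * (x / f * c)" for x y f c :: real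
        by (simp del: of_nat_Suc)
      thus ?thesis by (simp only: P_def pochhammer_Suc fact_Suc power_Suc) (simp add: algebra_simps)
    qed
    have "(a + b + real (Suc m)) * d $ Suc m - (a * H X (- Y) (Suc m) + b * H (- X) Y (Suc m)) =
       P (Suc m) * ((real (Suc m) + (a + b)) * rank2_poly a b X Y (Suc m) - a * rank2_poly a b X (- Y) (Suc m)
      - b * rank2_poly a b (- X) Y (Suc m)) - ((a + b + real (Suc m)) * B * P m) * (X + Y) * rank2_poly a b X Y m"
      unfolding dn HP by algebra
    also have "\<dots> = 0"
      unfolding rank2_poly_rec[OF a b] PS[symmetric] by algebra
    finally show ?thesis using Suc by simp
  qed
  finally show "(fps_const (a + b) * d + fps_X * fps_deriv d) $ n =
     (fps_const a * rank2_series k a b X (- Y) + fps_const b * rank2_series k a b (- X) Y) $ n"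
    by (simp add: H)
qed

text \<open>A linear factor f with constant term 1 satisfies f - X f' = 1. Hence omitting it from
  the product P leaves P - X P f' / f, and the sum over all factors is a logarithmic
  derivative.\<close>

lemma sum_prod_linear_factors_omit:
  fixes c :: "'i \<Rightarrow> real"
  assumes "finite I"
  shows "(\<Sum>l\<in>I. \<Prod>i\<in>I - {l}. 1 - fps_const (c i) * fps_X) =
     fps_const (real (card I)) * (\<Prod>i\<in>I. 1 - fps_const (c i) * fps_X) - fps_X * fps_deriv (\<Prod>i\<in>I. 1 - fps_const (c i) * fps_X)"
  using assms
proof (induction I rule: finite_induct)
  case (insert x I)
  define f where "f i = 1 - fps_const (c i) * fps_X" for i
  define P where "P = (\<Prod>i\<in>I. f i)"
  have "(\<Sum>l\<in>insert x I. \<Prod>i\<in>insert x I - {l}. f i) = P + (\<Sum>l\<in>I. f x * (\<Prod>i\<in>I - {l}. f i))"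
  proof -
    have "(\<Prod>i\<in>insert x I - {l}. f i) = f x * (\<Prod>i\<in>I - {l}. f i)" if "l \<in> I" for l
    proof -
      have "insert x I - {l} = insert x (I - {l})" using that insert by auto
      thus ?thesis using insert by simp
    qed
    moreover have "insert x I - {x} = I" using insert by auto
    ultimately show ?thesis using insert by (simp add: P_def)
  qed
  also have "\<dots> = P + f x * (fps_const (real (card I)) * P - fps_X * fps_deriv P)"
    using insert.IH by (simp only: sum_distrib_left[symmetric] f_def P_def)
  also have "\<dots> = fps_const (real (card (insert x I))) * (f x * P) - fps_X * fps_deriv (f x * P)"
  proof -
    have fx: "f x - fps_X * fps_deriv (f x) = 1" by (simp add: f_def algebra_simps)
    have "fps_const (real (card (insert x I))) = 1 + fps_const (real (card I))"
      using insert by (simp flip: fps_const_add)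
    hence "fps_const (real (card (insert x I))) * (f x * P) - fps_X * fps_deriv (f x * P) =
      f x * (fps_const (real (card I)) * P - fps_X * fps_deriv P) + P * (f x - fps_X * fps_deriv (f x))"
      by (simp only: fps_deriv_mult) (simp add: algebra_simps)
    thus ?thesis by (simp only: fx mult_1_right add.commute)
  qed
  finally show ?case using insert by (simp add: f_def P_def)
qed simp

text \<open>In the rescaled recursion the sum over the reflections is invariant under rotation of z
  by 2 \<pi> / k, so 1 - (z . w) X times the solution must be too. The product over j from 1 is what
  completes that factor to the full orbit product; the other two factors depend on z only through
  |z| and \<open>z ^ k\<close>.\<close>

definition dunkl_series :: "nat \<Rightarrow> real \<Rightarrow> real \<Rightarrow> complex \<Rightarrow> complex \<Rightarrow> real fps" where
  "dunkl_series k a b z w =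
     (let A = cheb_prod k (cmod (z * w)) (pi / 2) in
      fps_rpow A (- (a + b) - 1) *
      (rank2_series k a b (Re (z ^ k) * Re (w ^ k)) (Im (z ^ k) * Im (w ^ k)) oo (fps_X ^ k * inverse A)) *
      (\<Prod>j\<in>{1..<k}. 1 - fps_const ((z * cis (2 * pi * real j / real k)) \<bullet> w) * fps_X))"

lemma cis_power_eq: "(z * cis (2 * pi * real l / real k)) ^ k = z ^ k" if "k > 0" for z l
proof -
  have "cis (2 * pi * real l) = 1" using cis_multiple_2pi[of "real l"] by simp
  thus ?thesis using that by (simp add: power_mult_distrib Complex.DeMoivre)
qed

lemma inner_rotation_eq_cos:
  assumes "k > 0"
  shows "(z * cis (2 * pi * real j / real k)) \<bullet> w =
    cmod (z * w) * cos ((real k * (Arg w - Arg z) - 2 * real j * pi) / real k)"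
proof -
  have z: "z = of_real (cmod z) * cis (Arg z)" and w: "w = of_real (cmod w) * cis (Arg w)"
    using rcis_cmod_Arg[of z] rcis_cmod_Arg[of w] by (simp_all add: rcis_def)
  have "(z * cis (2 * pi * real j / real k)) \<bullet> w =
     (of_real (cmod z) * cis (Arg z + 2 * pi * real j / real k)) \<bullet> (of_real (cmod w) * cis (Arg w))"
    using z w by (metis (no_types, lifting) cis_mult mult.assoc)
  also have "\<dots> = cmod z * cmod w * cos (Arg z + 2 * pi * real j / real k - Arg w)"
    by (simp add: inner_complex_def cos_diff algebra_simps)
  also have "cos (Arg z + 2 * pi * real j / real k - Arg w) = cos (- (Arg z + 2 * pi * real j / real k - Arg w))"
    by (rule cos_minus[symmetric])
  also have "- (Arg z + 2 * pi * real j / real k - Arg w) = (real k * (Arg w - Arg z) - 2 * real j * pi) / real k"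
    using assms by (simp add: field_simps)
  finally show ?thesis by (simp add: norm_mult)
qed

text \<open>The orbit product is a Chebyshev product with angle k (Arg w - Arg z), and the addition
  formula expands the cosine of that angle.\<close>

lemma prod_rotations_eq:
  assumes "k > 0"
  shows "(\<Prod>j<k. 1 - fps_const ((z * cis (2 * pi * real j / real k)) \<bullet> w) * fps_X) =
    cheb_prod k (cmod (z * w)) (pi / 2) -
    fps_const (2 * (1 / 2) ^ k * (Re (z ^ k) * Re (w ^ k) + Im (z ^ k) * Im (w ^ k))) * fps_X ^ k"
proof -
  define q where "q = real k * (Arg w - Arg z)"
  have "(\<Prod>j<k. 1 - fps_const ((z * cis (2 * pi * real j / real k)) \<bullet> w) * fps_X) = cheb_prod k (cmod (z * w)) q"
    unfolding cheb_prod_def q_def by (simp only: inner_rotation_eq_cos[OF assms])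
  also have "\<dots> = cheb_prod k (cmod (z * w)) (pi / 2) - fps_const (2 * (cmod (z * w) / 2) ^ k * cos q) * fps_X ^ k"
    by (rule cheb_prod_eq[OF assms])
  also have "2 * (cmod (z * w) / 2) ^ k * cos q = 2 * (1 / 2) ^ k * (Re (z ^ k) * Re (w ^ k) + Im (z ^ k) * Im (w ^ k))"
    unfolding power_eq_cmod_cos_sin_Arg[OF assms] q_def right_diff_distrib cos_diff norm_mult power_divide power_mult_distrib
    by (simp add: algebra_simps)
  finally show ?thesis .
qed

text \<open>Rotations fix A and \<open>z ^ k\<close> and permute the linear factors cyclically, so
  term l contains the orbit product P without its factor l. In k P - X P' the X^k term cancels, so P
  may be replaced by A and the relative angle disappears.\<close>

lemma sum_rotations_dunkl_series:
  assumes k: "k > 0"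
  shows "(\<Sum>l<k. dunkl_series k a b (z * cis (2 * pi * real l / real k)) w) =
    (let A = cheb_prod k (cmod (z * w)) (pi / 2) in
      (fps_const (real k) * A - fps_X * fps_deriv A) * (fps_rpow A (- (a + b) - 1) *
      (rank2_series k a b (Re (z ^ k) * Re (w ^ k)) (Im (z ^ k) * Im (w ^ k)) oo (fps_X ^ k * inverse A))))"
proof -
  define A where "A = cheb_prod k (cmod (z * w)) (pi / 2)"
  define h where "h = rank2_series k a b (Re (z ^ k) * Re (w ^ k)) (Im (z ^ k) * Im (w ^ k))"
  define c where "c j = (z * cis (2 * pi * real j / real k)) \<bullet> w" for j :: nat
  define P where "P = (\<Prod>j<k. 1 - fps_const (c j) * fps_X)"
  define y where "y = 2 * (1 / 2) ^ k * (Re (z ^ k) * Re (w ^ k) + Im (z ^ k) * Im (w ^ k))"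
  have Pe: "P = A - fps_const y * fps_X ^ k"
    unfolding P_def c_def A_def y_def by (rule prod_rotations_eq[OF k])
  have cper: "c (j mod k) = c j" for j
  proof -
    have "2 * pi * real j / real k = 2 * pi * real (j mod k) / real k + 2 * pi * real (j div k)"
    proof -
      have "real j = real (j div k) * real k + real (j mod k)" by (metis div_mult_mod_eq of_nat_add of_nat_mult)
      thus ?thesis using k by (simp add: field_simps)
    qed
    hence "cis (2 * pi * real j / real k) = cis (2 * pi * real (j mod k) / real k) * cis (2 * pi * real (j div k))"
      by (simp only: cis_mult)
    moreover have "cis (2 * pi * real (j div k)) = 1" using cis_multiple_2pi[of "real (j div k)"] by simp
    ultimately show ?thesis by (simp add: c_def)
  qed
  have R: "(\<Prod>j\<in>{1..<k}. 1 - fps_const ((z * cis (2 * pi * real l / real k) * cis (2 * pi * real j / real k)) \<bullet> w) * fps_X) =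
      (\<Prod>i\<in>{..<k} - {l}. 1 - fps_const (c i) * fps_X)" if l: "l < k" for l
  proof -
    have cl: "(z * cis (2 * pi * real l / real k) * cis (2 * pi * real j / real k)) \<bullet> w = c ((j + l) mod k)" for j
      unfolding cper unfolding c_def by (simp add: cis_mult mult.assoc add_divide_distrib distrib_left add.commute)
    have md: "(i + l) mod k = (if i + l < k then i + l else i + l - k)" if "i < k" for i
      using that l by (auto simp: le_mod_geq not_less)
    have inj: "inj_on (\<lambda>j. (j + l) mod k) {1..<k}"
      by (rule inj_onI) (auto simp: md split: if_splits)
    have "(\<lambda>j. (j + l) mod k) ` {1..<k} \<subseteq> {..<k} - {l}"
    proof clarify
      fix j assume j: "j \<in> {1..<k}"
      have "(j + l) mod k \<noteq> l"
        using j l by (auto simp: md)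
      thus "(j + l) mod k \<in> {..<k} - {l}" using k by auto
    qed
    moreover have "card ((\<lambda>j. (j + l) mod k) ` {1..<k}) = card ({..<k} - {l})"
      unfolding card_image[OF inj] using l by simp
    ultimately have "(\<lambda>j. (j + l) mod k) ` {1..<k} = {..<k} - {l}" by (intro card_subset_eq) auto
    hence "bij_betw (\<lambda>j. (j + l) mod k) {1..<k} ({..<k} - {l})" using inj by (simp add: bij_betw_def)
    thus ?thesis unfolding cl by (rule prod.reindex_bij_betw)
  qed
  have "(\<Sum>l<k. dunkl_series k a b (z * cis (2 * pi * real l / real k)) w) =
     (\<Sum>l<k. fps_rpow A (- (a + b) - 1) * (h oo (fps_X ^ k * inverse A)) * (\<Prod>i\<in>{..<k} - {l}. 1 - fps_const (c i) * fps_X))"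
    unfolding dunkl_series_def Let_def cis_power_eq[OF k]
    by (intro sum.cong refl) (simp add: R A_def h_def norm_mult del: One_nat_def)
  also have "\<dots> = fps_rpow A (- (a + b) - 1) * (h oo (fps_X ^ k * inverse A)) * (fps_const (real k) * P - fps_X * fps_deriv P)"
    unfolding P_def using sum_prod_linear_factors_omit[of "{..<k}" c] by (simp add: sum_distrib_left[symmetric])
  also have "fps_const (real k) * P - fps_X * fps_deriv P = fps_const (real k) * A - fps_X * fps_deriv A"
  proof -
    have dP: "fps_X * fps_deriv P = fps_X * fps_deriv A - fps_const y * (fps_const (real k) * fps_X ^ k)"
      unfolding Pe fps_X_mult_deriv_X_power[symmetric]
      by (simp only: fps_deriv_sub fps_deriv_mult fps_deriv_const) (simp add: algebra_simps)
    show ?thesis unfolding dP unfolding Pe by (simp add: algebra_simps)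
  qed
  finally show ?thesis unfolding Let_def A_def[symmetric] h_def[symmetric] by (simp only: mult_ac)
qed

lemma sum_lessThan_double:
  fixes k :: nat
  shows "(\<Sum>j<2 * k. f j) = (\<Sum>l<k. f (2 * l) + f (2 * l + 1) :: 'a :: comm_monoid_add)"
  by (induction k) (simp_all add: add.assoc)

lemma dih_refl_even: "dih_refl k (2 * l) z = cnj z * cis (2 * pi * real l / real k)"
  by (simp add: dih_refl_def mult_ac)

lemma dih_refl_odd:
  "dih_refl k (2 * l + 1) z = cnj z * cis (pi / real k) * cis (2 * pi * real l / real k)"
proof -
  have "real (2 * l + 1) * pi / real k = pi / real k + 2 * pi * real l / real k"
    by (simp only: of_nat_add of_nat_mult distrib_right add_divide_distrib) (simp add: mult_ac)
  thus ?thesis by (simp only: dih_refl_def cis_mult mult.assoc)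
qed

lemma cis_pi_power: "k > 0 \<Longrightarrow> (z * cis (pi / real k)) ^ k = - (z ^ k)"
  by (simp add: power_mult_distrib Complex.DeMoivre)

lemma dunkl_series_nth_0: "dunkl_series k a b z w $ 0 = 1"
  by (simp add: dunkl_series_def Let_def rank2_series_def rank2_poly_def fps_prod_nth_0)

text \<open>The factor 1 - (z . w) X completes the orbit product to A (1 - 2 (1/2)^k (X + Y) t).
  Then \<open>fps_euler_rpow_compose\<close> passes n + k (a + b) on to the series in t, where
  \<open>rank2_series_rec\<close> applies. Reflections with even j flip Y, those with odd j flip
  X.\<close>

lemma dunkl_series_rec:
  assumes k: "k > 0" and a: "a > 0" and b: "b > 0"
  shows "(real n + real k * (a + b)) * ((1 - fps_const (z \<bullet> w) * fps_X) * dunkl_series k a b z w) $ n =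
     (\<Sum>j<2 * k. dih_kappa a b j * dunkl_series k a b (dih_refl k j z) w $ n)"
proof -
  define A where "A = cheb_prod k (cmod (z * w)) (pi / 2)"
  define t where "t = fps_X ^ k * inverse A"
  define X where "X = Re (z ^ k) * Re (w ^ k)"
  define Y where "Y = Im (z ^ k) * Im (w ^ k)"
  define h where "h X Y = rank2_series k a b X Y" for X Y
  define d where "d = (1 - fps_const (2 * (1 / 2) ^ k * (X + Y)) * fps_X) * h X Y"
  have A0: "A $ 0 = 1" by (simp add: A_def)
  have t0: "t $ 0 = 0" using k by (simp add: t_def)
  have split: "{..<k} = insert 0 {1..<k}" using k by auto
  have "(1 - fps_const (z \<bullet> w) * fps_X) * dunkl_series k a b z w =
     fps_rpow A (- (a + b) - 1) * (h X Y oo t) * (\<Prod>j<k. 1 - fps_const ((z * cis (2 * pi * real j / real k)) \<bullet> w) * fps_X)"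
    unfolding split by (simp add: dunkl_series_def Let_def A_def X_def Y_def h_def t_def mult_ac)
  also have "(\<Prod>j<k. 1 - fps_const ((z * cis (2 * pi * real j / real k)) \<bullet> w) * fps_X) =
     A * (1 - fps_const (2 * (1 / 2) ^ k * (X + Y)) * t)"
  proof -
    have At: "A * t = fps_X ^ k" using A0 by (simp add: t_def mult.left_commute inverse_mult_eq_1')
    show ?thesis unfolding prod_rotations_eq[OF k] A_def[symmetric] X_def[symmetric] Y_def[symmetric] At[symmetric]
      by (simp only: right_diff_distrib mult_1_right mult_ac)
  qed
  also have "fps_rpow A (- (a + b) - 1) * (h X Y oo t) * (A * (1 - fps_const (2 * (1 / 2) ^ k * (X + Y)) * t)) =
     (A * fps_rpow A (- (a + b) - 1)) * ((1 - fps_const (2 * (1 / 2) ^ k * (X + Y)) * t) * (h X Y oo t))"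
    by (simp only: mult_ac)
  also have "A * fps_rpow A (- (a + b) - 1) = fps_rpow A (- (a + b))"
    using fps_rpow_add[OF A0, of 1 "- (a + b) - 1"] fps_rpow_1[OF A0] by simp
  also have "(1 - fps_const (2 * (1 / 2) ^ k * (X + Y)) * t) * (h X Y oo t) = d oo t"
    unfolding d_def using t0 by (simp add: fps_compose_mult_distrib fps_compose_sub_distrib fps_X_fps_compose_startby0)
  finally have G: "(1 - fps_const (z \<bullet> w) * fps_X) * dunkl_series k a b z w = fps_rpow A (- (a + b)) * (d oo t)" .
  have "(real n + real k * (a + b)) * (fps_rpow A (- (a + b)) * (d oo t)) $ n =
    (fps_X * fps_deriv (fps_rpow A (- (a + b)) * (d oo t)) + fps_const (real k * (a + b)) * (fps_rpow A (- (a + b)) * (d oo t))) $ n"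
    by (cases n) (simp_all only: fps_add_nth fps_mult_left_const_nth fps_X_mult_nth fps_deriv_nth, simp_all add: algebra_simps)
  also have "\<dots> = ((fps_const (real k) * A - fps_X * fps_deriv A) * (fps_rpow A (- (a + b) - 1) *
      ((fps_const (a + b) * d + fps_X * fps_deriv d) oo t))) $ n"
    unfolding t_def by (subst fps_euler_rpow_compose[OF A0 k]) simp
  also have "(fps_const (a + b) * d + fps_X * fps_deriv d) oo t = fps_const a * (h X (- Y) oo t) + fps_const b * (h (- X) Y oo t)"
    unfolding d_def h_def rank2_series_rec[OF a b] using t0
    by (simp add: fps_compose_add_distrib fps_compose_mult_distrib)
  also have "(fps_const (real k) * A - fps_X * fps_deriv A) * (fps_rpow A (- (a + b) - 1) *
      (fps_const a * (h X (- Y) oo t) + fps_const b * (h (- X) Y oo t))) =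
      fps_const a * ((fps_const (real k) * A - fps_X * fps_deriv A) * (fps_rpow A (- (a + b) - 1) * (h X (- Y) oo t))) +
      fps_const b * ((fps_const (real k) * A - fps_X * fps_deriv A) * (fps_rpow A (- (a + b) - 1) * (h (- X) Y oo t)))"
    by (simp only: distrib_left mult_ac)
  also have "(fps_const (real k) * A - fps_X * fps_deriv A) * (fps_rpow A (- (a + b) - 1) * (h X (- Y) oo t)) =
     (\<Sum>l<k. dunkl_series k a b (dih_refl k (2 * l) z) w)"
    unfolding dih_refl_even sum_rotations_dunkl_series[OF k] Let_def
    by (simp add: A_def h_def t_def X_def Y_def norm_mult flip: complex_cnj_power)
  also have "(fps_const (real k) * A - fps_X * fps_deriv A) * (fps_rpow A (- (a + b) - 1) * (h (- X) Y oo t)) =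
     (\<Sum>l<k. dunkl_series k a b (dih_refl k (2 * l + 1) z) w)"
    unfolding dih_refl_odd sum_rotations_dunkl_series[OF k] Let_def cis_pi_power[OF k]
    by (simp add: A_def h_def t_def X_def Y_def norm_mult flip: complex_cnj_power)
  finally show ?thesis unfolding G sum_lessThan_double
    by (simp add: sum.distrib sum_distrib_left fps_sum_nth dih_kappa_def)
qed

section \<open>Euler's identity for the intertwining operator\<close>

lemma poly_repI:
  assumes "finite S" and "\<And>ij. ij \<notin> S \<Longrightarrow> c ij = 0"
    and "\<And>x. f x = (\<Sum>(i, j)\<in>S. c (i, j) * Re x ^ i * Im x ^ j)"
  shows "poly_rep c f"
  unfolding poly_rep_def
proof (intro conjI allI)
  have sub: "{ij. c ij \<noteq> 0} \<subseteq> S" using assms(2) by auto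
  thus "finite {ij. c ij \<noteq> 0}" using assms(1) finite_subset by blast
  show "f x = (\<Sum>(i, j)\<in>{ij. c ij \<noteq> 0}. c (i, j) * Re x ^ i * Im x ^ j)" for x
    unfolding assms(3) by (rule sum.mono_neutral_right[OF assms(1) sub]) auto
qed

lemma poly_rep_eq_sum:
  assumes "poly_rep c f" and "finite S" and "{ij. c ij \<noteq> 0} \<subseteq> S"
  shows "f x = (\<Sum>(i, j)\<in>S. c (i, j) * Re x ^ i * Im x ^ j)"
proof -
  have "f x = (\<Sum>(i, j)\<in>{ij. c ij \<noteq> 0}. c (i, j) * Re x ^ i * Im x ^ j)"
    using assms(1) by (simp add: poly_rep_def)
  also have "\<dots> = (\<Sum>(i, j)\<in>S. c (i, j) * Re x ^ i * Im x ^ j)"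
    by (rule sum.mono_neutral_left[OF assms(2,3)]) auto
  finally show ?thesis .
qed

lemma poly_rep_poly_coeffs: "polyfun p \<Longrightarrow> poly_rep (poly_coeffs p) p"
  unfolding polyfun_def poly_coeffs_def by (rule someI_ex[of "\<lambda>c. poly_rep c p"])

lemma polyfun_lincomb:
  assumes "polyfun f" and "polyfun g"
  shows "polyfun (\<lambda>x. s * f x + t * g x)"
proof -
  obtain c d where c: "poly_rep c f" and d: "poly_rep d g" using assms by (auto simp: polyfun_def)
  define S where "S = {ij. c ij \<noteq> 0} \<union> {ij. d ij \<noteq> 0}"
  have S: "finite S" using c d by (simp add: S_def poly_rep_def)
  have "poly_rep (\<lambda>ij. s * c ij + t * d ij) (\<lambda>x. s * f x + t * g x)"
  proof (rule poly_repI[OF S])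
    show "s * f x + t * g x = (\<Sum>(i, j)\<in>S. (s * c (i, j) + t * d (i, j)) * Re x ^ i * Im x ^ j)" for x
      using poly_rep_eq_sum[OF c S] poly_rep_eq_sum[OF d S]
      by (simp add: S_def sum_distrib_left sum.distrib[symmetric] case_prod_unfold algebra_simps)
  qed (auto simp: S_def)
  thus ?thesis by (auto simp: polyfun_def)
qed

lemma polyfun_monomial: "polyfun (\<lambda>x. Re x ^ i * Im x ^ j)"
  unfolding polyfun_def
  by (rule exI[of _ "\<lambda>ij. if ij = (i, j) then 1 else 0"], rule poly_repI[where S = "{(i, j)}"]) auto

lemma polyfun_zero: "polyfun (\<lambda>x. 0)"
  using polyfun_lincomb[OF polyfun_monomial polyfun_monomial, of 0 0 0 0 0 0] by simp

lemma polyfun_sum: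
  assumes "finite I" and "\<And>i. i \<in> I \<Longrightarrow> polyfun (f i)"
  shows "polyfun (\<lambda>x. \<Sum>i\<in>I. c i * f i x)"
  using assms
proof (induction I rule: finite_induct)
  case (insert i I)
  have "polyfun (\<lambda>x. c i * f i x + 1 * (\<Sum>i\<in>I. c i * f i x))"
    using insert by (intro polyfun_lincomb) auto
  thus ?case using insert by simp
qed (simp add: polyfun_zero)

lemma polyfun_mult:
  assumes "polyfun f" and "polyfun g"
  shows "polyfun (\<lambda>x. f x * g x)"
proof -
  obtain c d where c: "poly_rep c f" and d: "poly_rep d g" using assms by (auto simp: polyfun_def)
  define S where "S = {ij. c ij \<noteq> 0}"
  define T where "T = {ij. d ij \<noteq> 0}"
  have fin: "finite (S \<times> T)" using c d by (simp add: S_def T_def poly_rep_def)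
  have "f x * g x = (\<Sum>pq\<in>S \<times> T. (c (fst pq) * d (snd pq)) *
      (Re x ^ (fst (fst pq) + fst (snd pq)) * Im x ^ (snd (fst pq) + snd (snd pq))))" for x
  proof -
    have "f x * g x = (\<Sum>p\<in>S. c p * Re x ^ fst p * Im x ^ snd p) * (\<Sum>q\<in>T. d q * Re x ^ fst q * Im x ^ snd q)"
      using c d by (simp add: poly_rep_def S_def T_def case_prod_unfold)
    thus ?thesis by (simp add: sum_product sum.cartesian_product case_prod_unfold power_add mult_ac)
  qed
  moreover have "polyfun (\<lambda>x. \<Sum>pq\<in>S \<times> T. (c (fst pq) * d (snd pq)) *
      (Re x ^ (fst (fst pq) + fst (snd pq)) * Im x ^ (snd (fst pq) + snd (snd pq))))"
    by (rule polyfun_sum[OF fin polyfun_monomial])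
  ultimately show ?thesis by simp
qed

lemma polyfun_power: "polyfun f \<Longrightarrow> polyfun (\<lambda>x. f x ^ n)"
  by (induction n) (use polyfun_monomial[of 0 0] in \<open>auto intro: polyfun_mult\<close>)

lemma polyfun_linear: "polyfun (\<lambda>x. s * Re x + t * Im x)"
  using polyfun_lincomb[OF polyfun_monomial[of 1 0] polyfun_monomial[of 0 1]] by simp

lemma polyfun_continuous:
  assumes "polyfun f"
  shows "continuous_on UNIV f"
proof -
  obtain c where "poly_rep c f" using assms by (auto simp: polyfun_def)
  hence "f = (\<lambda>x. \<Sum>(i, j)\<in>{ij. c ij \<noteq> 0}. c (i, j) * Re x ^ i * Im x ^ j)"
    by (auto simp: poly_rep_def)
  thus ?thesis by (auto simp: case_prod_unfold intro!: continuous_intros)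
qed

lemma inner_power_eq_sum:
  "(x \<bullet> w) ^ n = (\<Sum>i\<le>n. real (n choose i) * Re w ^ i * Im w ^ (n - i) * (Re x ^ i * Im x ^ (n - i)))"
proof -
  have "(x \<bullet> w) ^ n = (Re x * Re w + Im x * Im w) ^ n" by (simp add: inner_complex_def)
  thus ?thesis by (simp add: binomial_ring power_mult_distrib mult_ac)
qed

lemma homog_polyfun_inner_power: "homog_polyfun n (\<lambda>x. (x \<bullet> w) ^ n)"
proof -
  define c where "c = (\<lambda>(i, j). if i + j = n then real (n choose i) * Re w ^ i * Im w ^ j else 0)"
  have "poly_rep c (\<lambda>x. (x \<bullet> w) ^ n)"
  proof (rule poly_repI[where S = "(\<lambda>i. (i, n - i)) ` {..n}"])
    show "c ij = 0" if "ij \<notin> (\<lambda>i. (i, n - i)) ` {..n}" for ij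
    proof -
      obtain i j where ij: "ij = (i, j)" by fastforce
      have "i + j \<noteq> n"
      proof
        assume "i + j = n"
        hence "(i, j) = (\<lambda>i. (i, n - i)) i" "i \<in> {..n}" by auto
        thus False using that ij by blast
      qed
      thus ?thesis by (simp add: c_def ij)
    qed
    have inj: "inj_on (\<lambda>i. (i, n - i)) {..n}" by (rule inj_onI) auto
    show "(x \<bullet> w) ^ n = (\<Sum>(i, j)\<in>(\<lambda>i. (i, n - i)) ` {..n}. c (i, j) * Re x ^ i * Im x ^ j)" for x
      unfolding sum.reindex[OF inj] by (simp add: inner_power_eq_sum c_def mult_ac)
  qed auto
  thus ?thesis unfolding homog_polyfun_def by (auto simp: c_def split: if_splits)
qed

lemma homog_polyfun_imp_polyfun: "homog_polyfun n f \<Longrightarrow> polyfun f"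
  by (auto simp: homog_polyfun_def polyfun_def)

lemma homog_polyfun_euler:
  assumes "homog_polyfun n q"
  shows "Re z * pderiv_dir 1 q z + Im z * pderiv_dir \<i> q z = real n * q z"
proof -
  obtain c where c: "poly_rep c q" and n: "\<And>i j. c (i, j) \<noteq> 0 \<Longrightarrow> i + j = n"
    using assms unfolding homog_polyfun_def by blast
  define S where "S = {ij. c ij \<noteq> 0}"
  have q: "q x = (\<Sum>p\<in>S. c p * Re x ^ fst p * Im x ^ snd p)" for x
    using c by (simp add: poly_rep_def S_def case_prod_unfold)
  have "((\<lambda>t. q (z + of_real t * 1)) has_real_derivative (\<Sum>p\<in>S. c p * (real (fst p) * Re z ^ (fst p - 1)) * Im z ^ snd p)) (at 0)"
    unfolding q by (auto intro!: derivative_eq_intros sum.cong simp: mult_ac)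
  hence 1: "pderiv_dir 1 q z = (\<Sum>p\<in>S. c p * (real (fst p) * Re z ^ (fst p - 1)) * Im z ^ snd p)"
    unfolding pderiv_dir_def by (rule DERIV_imp_deriv)
  have "((\<lambda>t. q (z + of_real t * \<i>)) has_real_derivative (\<Sum>p\<in>S. c p * Re z ^ fst p * (real (snd p) * Im z ^ (snd p - 1)))) (at 0)"
    unfolding q by (auto intro!: derivative_eq_intros sum.cong simp: mult_ac)
  hence 2: "pderiv_dir \<i> q z = (\<Sum>p\<in>S. c p * Re z ^ fst p * (real (snd p) * Im z ^ (snd p - 1)))"
    unfolding pderiv_dir_def by (rule DERIV_imp_deriv)
  have pw: "x * (real i * x ^ (i - 1)) = real i * x ^ i" for x :: real and i by (cases i) auto
  have "Re z * pderiv_dir 1 q z + Im z * pderiv_dir \<i> q z = (\<Sum>p\<in>S. c p * (Re z * (real (fst p) * Re z ^ (fst p - 1))) * Im z ^ snd p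
     + c p * Re z ^ fst p * (Im z * (real (snd p) * Im z ^ (snd p - 1))))"
    unfolding 1 2 sum_distrib_left sum.distrib[symmetric] by (intro sum.cong refl) (simp only: mult_ac)
  also have "\<dots> = (\<Sum>p\<in>S. real n * (c p * Re z ^ fst p * Im z ^ snd p))"
    unfolding pw
  proof (intro sum.cong refl)
    fix p assume "p \<in> S"
    hence "real n = real (fst p) + real (snd p)" using n[of "fst p" "snd p"] by (auto simp: S_def)
    thus "c p * (real (fst p) * Re z ^ fst p) * Im z ^ snd p + c p * Re z ^ fst p * (real (snd p) * Im z ^ snd p)
       = real n * (c p * Re z ^ fst p * Im z ^ snd p)" by (simp add: algebra_simps)
  qed
  finally show ?thesis by (simp add: q sum_distrib_left)
qed

lemma pderiv_dir_inner_power: "pderiv_dir e (\<lambda>x. (x \<bullet> w) ^ n) = (\<lambda>x. (real n * (e \<bullet> w)) * (x \<bullet> w) ^ (n - 1))"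
proof
  fix x
  have i: "(x + of_real t * e) \<bullet> w = x \<bullet> w + t * (e \<bullet> w)" for t
    by (simp add: inner_add_left flip: scaleR_conv_of_real)
  have "((\<lambda>t. (x \<bullet> w + t * (e \<bullet> w)) ^ n) has_real_derivative (real n * (e \<bullet> w)) * (x \<bullet> w) ^ (n - 1)) (at 0)"
    by (auto intro!: derivative_eq_intros)
  thus "pderiv_dir e (\<lambda>x. (x \<bullet> w) ^ n) x = (real n * (e \<bullet> w)) * (x \<bullet> w) ^ (n - 1)"
    unfolding pderiv_dir_def i by (rule DERIV_imp_deriv)
qed

text \<open>Points of mirror j are real multiples of e^(i j \<pi> / (2k)), so their power 2k is
  real: one algebraic condition excludes all mirrors at once.\<close>

lemma inner_root_nonzero:
  assumes "k > 0" and "Im (z ^ (2 * k)) \<noteq> 0"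
  shows "dih_root k j \<bullet> z \<noteq> 0"
proof
  assume 0: "dih_root k j \<bullet> z = 0"
  define psi where "psi = real j * pi / (2 * real k)"
  define x where "x = z * cis (- psi)"
  have root: "dih_root k j = cis (psi + pi / 2)" by (simp add: dih_root_def psi_def)
  have "Im x = 0" using 0 unfolding root x_def by (simp add: inner_complex_def cos_add sin_add algebra_simps)
  hence xr: "x = of_real (Re x)" by (simp add: complex_eq_iff)
  have "z = x * cis psi" by (simp add: x_def mult.assoc cis_mult)
  hence "z ^ (2 * k) = of_real (Re x) ^ (2 * k) * cis (real (2 * k) * psi)"
    using xr by (metis Complex.DeMoivre power_mult_distrib)
  also have "real (2 * k) * psi = real j * pi" using assms(1) by (simp add: psi_def)
  also have "of_real (Re x) ^ (2 * k) * cis (real j * pi) = of_real (Re x ^ (2 * k) * (- 1) ^ j)"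
    by (simp add: complex_eq_iff cos_npi)
  finally show False using assms(2) by (metis Im_complex_of_real)
qed

context
  fixes k :: nat and a b :: real and V :: "(complex \<Rightarrow> real) \<Rightarrow> (complex \<Rightarrow> real)"
  assumes k: "k > 0" and a: "a > 0" and b: "b > 0" and V: "is_intertwiner k a b V"
begin

lemma intertwiner_lincomb:
  "polyfun f \<Longrightarrow> polyfun g \<Longrightarrow> V (\<lambda>x. s * f x + t * g x) = (\<lambda>x. s * V f x + t * V g x)"
  using V unfolding is_intertwiner_def by blast

lemma intertwiner_scale: "polyfun f \<Longrightarrow> V (\<lambda>x. s * f x) = (\<lambda>x. s * V f x)"
  using intertwiner_lincomb[of f f s 0] by simp

lemma intertwiner_zero: "V (\<lambda>x. 0) = (\<lambda>x. 0)"
  using intertwiner_scale[OF polyfun_zero, of 0] by simp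

lemma intertwiner_sum:
  assumes "finite I" and "\<And>i. i \<in> I \<Longrightarrow> polyfun (f i)"
  shows "V (\<lambda>x. \<Sum>i\<in>I. c i * f i x) = (\<lambda>x. \<Sum>i\<in>I. c i * V (f i) x)"
  using assms
proof (induction I rule: finite_induct)
  case (insert i I)
  have "V (\<lambda>x. c i * f i x + 1 * (\<Sum>i\<in>I. c i * f i x)) = (\<lambda>x. c i * V (f i) x + 1 * V (\<lambda>x. \<Sum>i\<in>I. c i * f i x) x)"
    using insert by (intro intertwiner_lincomb polyfun_sum) auto
  thus ?case using insert by simp
qed (simp add: intertwiner_zero)

lemma intertwiner_polyfun: "polyfun f \<Longrightarrow> polyfun (V f)"
  using V unfolding is_intertwiner_def bij_betw_def by auto

lemma sum_dih_kappa: "(\<Sum>j<2 * k. dih_kappa a b j) = real k * (a + b)"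
  by (simp add: sum_lessThan_double dih_kappa_def)

text \<open>Pairing the Dunkl operators with the coordinates of z cancels the denominators
  \<open>dih_root k j \<bullet> z\<close> and leaves plain differences. The gradient part gives the
  factor n because V preserves homogeneity.\<close>

lemma intertwiner_euler:
  assumes "Im (z ^ (2 * k)) \<noteq> 0"
  shows "(real n + real k * (a + b)) * V (\<lambda>x. (x \<bullet> w) ^ n) z
     - (\<Sum>j<2 * k. dih_kappa a b j * V (\<lambda>x. (x \<bullet> w) ^ n) (dih_refl k j z))
     = real n * (z \<bullet> w) * V (\<lambda>x. (x \<bullet> w) ^ (n - 1)) z"
proof -
  define f where "f n = (\<lambda>x. (x \<bullet> w) ^ n)" for n :: nat
  define q where "q = V (f n)"
  have pf: "polyfun (f n)" for n unfolding f_def using homog_polyfun_imp_polyfun[OF homog_polyfun_inner_power] .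
  have hq: "homog_polyfun n q"
    unfolding q_def f_def using V homog_polyfun_inner_power unfolding is_intertwiner_def by blast
  have nz: "dih_root k j \<bullet> z \<noteq> 0" for j by (rule inner_root_nonzero[OF k assms])
  have D: "dunkl k a b e q z = (real n * (e \<bullet> w)) * V (f (n - 1)) z" if "e \<in> Basis" for e
  proof -
    have "dunkl k a b e q z = V (pderiv_dir e (f n)) z"
      unfolding q_def using V pf that nz unfolding is_intertwiner_def by blast
    also have "\<dots> = (real n * (e \<bullet> w)) * V (f (n - 1)) z"
      unfolding f_def pderiv_dir_inner_power using intertwiner_scale[OF pf, of _ "n - 1"] by (simp add: f_def)
    finally show ?thesis .
  qed
  have "Re z * dunkl k a b 1 q z + Im z * dunkl k a b \<i> q z = real n * (z \<bullet> w) * V (f (n - 1)) z"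
    by (simp add: D Basis_complex_def inner_complex_def algebra_simps)
  moreover have "Re z * dunkl k a b 1 q z + Im z * dunkl k a b \<i> q z =
     (Re z * pderiv_dir 1 q z + Im z * pderiv_dir \<i> q z) + (\<Sum>j<2 * k. dih_kappa a b j * (q z - q (dih_refl k j z)))"
  proof -
    have "Re z * (\<Sum>j<2*k. dih_kappa a b j * (dih_root k j \<bullet> 1) * (q z - q (dih_refl k j z)) / (dih_root k j \<bullet> z))
      + Im z * (\<Sum>j<2*k. dih_kappa a b j * (dih_root k j \<bullet> \<i>) * (q z - q (dih_refl k j z)) / (dih_root k j \<bullet> z))
      = (\<Sum>j<2 * k. dih_kappa a b j * (q z - q (dih_refl k j z)))"
      unfolding sum_distrib_left sum.distrib[symmetric]
    proof (intro sum.cong refl)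
      fix j
      have alg: "x * (c * r * m / D) + y * (c * s * m / D) = c * m * (x * r + y * s) / D" for c m r s x y D :: real
        by (simp add: algebra_simps add_divide_distrib)
      have e: "Re z * (dih_root k j \<bullet> 1) + Im z * (dih_root k j \<bullet> \<i>) = dih_root k j \<bullet> z"
        by (simp add: inner_complex_def mult.commute)
      show "Re z * (dih_kappa a b j * (dih_root k j \<bullet> 1) * (q z - q (dih_refl k j z)) / (dih_root k j \<bullet> z)) +
         Im z * (dih_kappa a b j * (dih_root k j \<bullet> \<i>) * (q z - q (dih_refl k j z)) / (dih_root k j \<bullet> z)) =
         dih_kappa a b j * (q z - q (dih_refl k j z))"
        unfolding alg e using nz[of j] by simp
    qed
    thus ?thesis unfolding dunkl_def distrib_left by linarith
  qed
  moreover have "(\<Sum>j<2 * k. dih_kappa a b j * (q z - q (dih_refl k j z))) =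
     real k * (a + b) * q z - (\<Sum>j<2 * k. dih_kappa a b j * q (dih_refl k j z))"
    by (simp add: right_diff_distrib sum_subtractf sum_dih_kappa flip: sum_distrib_right)
  moreover note homog_polyfun_euler[OF hq, of z]
  ultimately show ?thesis unfolding q_def f_def distrib_right by linarith
qed

lemma intertwiner_eq_dunkl_series:
  assumes "Im (z ^ (2 * k)) \<noteq> 0"
  shows "pochhammer (real k * (a + b) + 1) n / fact n * V (\<lambda>x. (x \<bullet> w) ^ n) z = dunkl_series k a b z w $ n"
  using assms
proof (induction n arbitrary: z)
  case 0
  have "V (\<lambda>_. 1) = (\<lambda>_. 1)" using V unfolding is_intertwiner_def by blast
  thus ?case by (simp add: dunkl_series_nth_0)
next
  case (Suc n)
  let ?V = "\<lambda>n. V (\<lambda>x. (x \<bullet> w) ^ n)" and ?G = "\<lambda>x. dunkl_series k a b x w"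
  define P where "P n = pochhammer (real k * (a + b) + 1) n / fact n" for n
  define K where "K = real k * (a + b)"
  have K0: "K > 0" using k a b by (simp add: K_def)
  define d where "d x = P (Suc n) * ?V (Suc n) x - ?G x $ Suc n" for x
  \<comment> \<open>Two fibres of \<open>x ^ (2 * k)\<close> serve as the orbit: a finite set of
    regular points that every reflection maps into itself.\<close>
  define S where "S = {x. x ^ (2 * k) = z ^ (2 * k)} \<union> {x. x ^ (2 * k) = cnj (z ^ (2 * k))}"
  have finS: "finite S" unfolding S_def using k by (intro finite_UnI finite_nth_roots) auto
  have zS: "z \<in> S" by (simp add: S_def)
  have reg: "Im (x ^ (2 * k)) \<noteq> 0" if "x \<in> S" for x using that Suc.prems by (auto simp: S_def simp del: complex_cnj_power)
  have refl: "dih_refl k j x \<in> S" if "x \<in> S" for x j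
  proof -
    have "dih_refl k j x ^ (2 * k) = cnj (x ^ (2 * k)) * cis (2 * pi * real j)"
      using k by (simp add: dih_refl_def power_mult_distrib Complex.DeMoivre mult_ac)
    also have "cis (2 * pi * real j) = 1" using cis_multiple_2pi[of "real j"] by simp
    finally show ?thesis using that by (auto simp: S_def simp del: complex_cnj_power)
  qed
  \<comment> \<open>The rescaling at work: the factor n + 1 of Euler's identity becomes n + 1 +
    K.\<close>
  have PS: "P (Suc n) * real (Suc n) = (real (Suc n) + K) * P n"
    unfolding P_def K_def pochhammer_Suc fact_Suc by (simp add: divide_simps)
  have rec: "(real (Suc n) + K) * d x = (\<Sum>j<2 * k. dih_kappa a b j * d (dih_refl k j x))" if x: "x \<in> S" for x
  proof -
    have 1: "P (Suc n) * ((real (Suc n) + K) * ?V (Suc n) x) = (\<Sum>j<2 * k. dih_kappa a b j * (P (Suc n) * ?V (Suc n) (dih_refl k j x)))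
       + (real (Suc n) + K) * ((x \<bullet> w) * (P n * ?V n x))"
    proof -
      have "(real (Suc n) + K) * ?V (Suc n) x = (\<Sum>j<2 * k. dih_kappa a b j * ?V (Suc n) (dih_refl k j x))
         + real (Suc n) * (x \<bullet> w) * ?V n x"
        using intertwiner_euler[OF reg[OF x], of "Suc n" w] unfolding K_def by simp
      hence "P (Suc n) * ((real (Suc n) + K) * ?V (Suc n) x) =
         P (Suc n) * (\<Sum>j<2 * k. dih_kappa a b j * ?V (Suc n) (dih_refl k j x))
         + (P (Suc n) * real (Suc n)) * ((x \<bullet> w) * ?V n x)"
        by (simp only: distrib_left mult_ac)
      thus ?thesis unfolding PS by (simp only: sum_distrib_left mult_ac)
    qed
    have "((1 - fps_const (x \<bullet> w) * fps_X) * dunkl_series k a b x w) $ Suc n =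
        ?G x $ Suc n - (x \<bullet> w) * ?G x $ n"
      by (simp add: left_diff_distrib mult.assoc)
    hence 2: "(real (Suc n) + K) * (?G x $ Suc n - (x \<bullet> w) * ?G x $ n) =
       (\<Sum>j<2 * k. dih_kappa a b j * ?G (dih_refl k j x) $ Suc n)"
      using dunkl_series_rec[OF k a b, of "Suc n" x w] unfolding K_def by simp
    have 3: "P n * ?V n x = ?G x $ n"
      unfolding P_def by (rule Suc.IH[OF reg[OF x]])
    have "(real (Suc n) + K) * d x = P (Suc n) * ((real (Suc n) + K) * ?V (Suc n) x) - (real (Suc n) + K) * ?G x $ Suc n"
      unfolding d_def by (simp only: right_diff_distrib mult_ac)
    also have "\<dots> = (\<Sum>j<2 * k. dih_kappa a b j * (P (Suc n) * ?V (Suc n) (dih_refl k j x)))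
       - (real (Suc n) + K) * (?G x $ Suc n - (x \<bullet> w) * ?G x $ n)"
      unfolding 1 3 by (simp only: right_diff_distrib)
    also have "\<dots> = (\<Sum>j<2 * k. dih_kappa a b j * d (dih_refl k j x))"
      unfolding 2 unfolding d_def right_diff_distrib sum_subtractf ..
    finally show ?thesis .
  qed
  define M where "M = Max ((\<lambda>x. \<bar>d x\<bar>) ` S)"
  have "M \<in> (\<lambda>x. \<bar>d x\<bar>) ` S" unfolding M_def using finS zS by (intro Max_in) auto
  then obtain x0 where x0: "x0 \<in> S" "M = \<bar>d x0\<bar>" by auto
  have le: "\<bar>d x\<bar> \<le> M" if "x \<in> S" for x unfolding M_def using finS that by (intro Max_ge) auto
  \<comment> \<open>At a maximum point the recursion yields (n + 1 + K) M \<le> K M, since the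
    multiplicities are positive with sum K.\<close>
  have "(real (Suc n) + K) * M = \<bar>\<Sum>j<2 * k. dih_kappa a b j * d (dih_refl k j x0)\<bar>"
    using K0 unfolding x0(2) rec[OF x0(1), symmetric] by (simp add: abs_mult)
  also have "\<dots> \<le> (\<Sum>j<2 * k. dih_kappa a b j * M)"
    using a b by (intro order_trans[OF sum_abs] sum_mono)
      (auto simp: abs_mult dih_kappa_def intro!: mult_left_mono le refl x0(1))
  also have "\<dots> = K * M" by (simp add: K_def sum_dih_kappa flip: sum_distrib_right)
  finally have "real (Suc n) * M \<le> 0" by (simp add: algebra_simps)
  hence "M \<le> 0" by (simp add: mult_le_0_iff)
  hence "d z = 0" using le[OF zS] by simp
  thus ?case by (simp add: d_def P_def)
qed

end

section \<open>Averaging over the dihedral group\<close>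

text \<open>These are the moments of the two measures, l belonging to v and l' to u, as
  \<open>nu_density_moment\<close> shows. In the group average they arise independently, by
  cancellation of signs.\<close>

definition even_moments :: "real \<Rightarrow> real \<Rightarrow> nat \<Rightarrow> nat \<Rightarrow> real" where
  "even_moments a b l l' = (if even l \<and> even l' then rank1_coeff b l * rank1_coeff a l' else 0)"

lemma sum_signs_rank2_poly:
  "rank2_poly a b X Y m + rank2_poly a b (- X) (- Y) m + rank2_poly a b X (- Y) m + rank2_poly a b (- X) Y m =
     4 * (\<Sum>i\<le>m. real (m choose i) * even_moments a b i (m - i) * X ^ i * Y ^ (m - i))"
  unfolding rank2_poly_def sum_distrib_left sum.distrib[symmetric]
proof (intro sum.cong refl)
  fix i
  show "real (m choose i) * rank1_coeff b i * rank1_coeff a (m - i) * X ^ i * Y ^ (m - i) +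
       real (m choose i) * rank1_coeff b i * rank1_coeff a (m - i) * (- X) ^ i * (- Y) ^ (m - i) +
       real (m choose i) * rank1_coeff b i * rank1_coeff a (m - i) * X ^ i * (- Y) ^ (m - i) +
       real (m choose i) * rank1_coeff b i * rank1_coeff a (m - i) * (- X) ^ i * Y ^ (m - i) =
       4 * (real (m choose i) * even_moments a b i (m - i) * X ^ i * Y ^ (m - i))"
    by (cases "even i"; cases "even (m - i)") (simp_all add: even_moments_def)
qed

text \<open>Rotations and conjugation produce the four sign patterns of (X, Y), each on k group
  elements, so only even powers of X and of Y survive.\<close>

lemma sum_group_dunkl_series:
  assumes k: "k > 0" and a: "a > 0" and b: "b > 0"
  shows "(\<Sum>j<2 * k. dunkl_series k a b (z * cis (pi * real j / real k)) w + dunkl_series k a b (z * cis (pi * real j / real k)) (cnj w)) $ n =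
    4 * (real n + real k * (a + b)) / (a + b) * pochhammer (real k * (a + b)) n * kern k (a + b) (even_moments a b) z w n"
proof -
  define la where "la = a + b"
  have la: "la > 0" using a b by (simp add: la_def)
  define A where "A = cheb_prod k (cmod (z * w)) (pi / 2)"
  define t where "t = fps_X ^ k * inverse A"
  define X where "X = Re (z ^ k) * Re (w ^ k)"
  define Y where "Y = Im (z ^ k) * Im (w ^ k)"
  define h where "h X Y = rank2_series k a b X Y" for X Y
  define E where "E m = (\<Sum>i\<le>m. real (m choose i) * even_moments a b i (m - i) * X ^ i * Y ^ (m - i))" for m
  define B :: real where "B = 2 * (1 / 2) ^ k"
  define q where "q = Abs_fps (\<lambda>m. pochhammer la m / fact m * B ^ m * E m)"
  define C where "C = (fps_const (real k) * A - fps_X * fps_deriv A)"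
  define R where "R = fps_rpow A (- la - 1)"
  have A0: "A $ 0 = 1" by (simp add: A_def)
  have t0: "t $ 0 = 0" using k by (simp add: t_def)
  have ev: "z * cis (pi * real (2 * l) / real k) = z * cis (2 * pi * real l / real k)" for l
    by (simp add: mult_ac)
  have od: "z * cis (pi * real (2 * l + 1) / real k) = z * cis (pi / real k) * cis (2 * pi * real l / real k)" for l
  proof -
    have "pi * real (2 * l + 1) / real k = pi / real k + 2 * pi * real l / real k"
      by (simp only: of_nat_add of_nat_mult distrib_left add_divide_distrib) (simp add: mult_ac)
    thus ?thesis by (simp only: cis_mult mult.assoc)
  qed
  have s1: "(\<Sum>l<k. dunkl_series k a b (z * cis (2 * pi * real l / real k)) w) = C * (R * (h X Y oo t))"
    unfolding sum_rotations_dunkl_series[OF k] Let_def by (simp add: A_def h_def t_def X_def Y_def C_def R_def la_def)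
  have s2: "(\<Sum>l<k. dunkl_series k a b (z * cis (pi / real k) * cis (2 * pi * real l / real k)) w) = C * (R * (h (- X) (- Y) oo t))"
    unfolding sum_rotations_dunkl_series[OF k] Let_def cis_pi_power[OF k]
    by (simp add: A_def h_def t_def X_def Y_def C_def R_def la_def norm_mult)
  have s3: "(\<Sum>l<k. dunkl_series k a b (z * cis (2 * pi * real l / real k)) (cnj w)) = C * (R * (h X (- Y) oo t))"
    unfolding sum_rotations_dunkl_series[OF k] Let_def
    by (simp add: A_def h_def t_def X_def Y_def C_def R_def la_def norm_mult flip: complex_cnj_power)
  have s4: "(\<Sum>l<k. dunkl_series k a b (z * cis (pi / real k) * cis (2 * pi * real l / real k)) (cnj w)) = C * (R * (h (- X) Y oo t))"
    unfolding sum_rotations_dunkl_series[OF k] Let_def cis_pi_power[OF k]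
    by (simp add: A_def h_def t_def X_def Y_def C_def R_def la_def norm_mult flip: complex_cnj_power)
  \<comment> \<open>Since \<lambda> (\<lambda> + 1)_m = (\<lambda> + m) (\<lambda>)_m, the sum of
    the rank-two series is the operator \<lambda> + X d/dX applied to q up to constants. This allows
    \<open>fps_euler_rpow_compose\<close> to be used backwards.\<close>
  have hsum: "fps_const la * (h X Y + h (- X) (- Y) + h X (- Y) + h (- X) Y) = fps_const 4 * (fps_const la * q + fps_X * fps_deriv q)"
  proof (rule fps_ext)
    fix m
    have r: "(fps_const la * q + fps_X * fps_deriv q) $ m = (la + real m) * q $ m"
      by (cases m) (simp_all add: algebra_simps)
    have p: "la * pochhammer (la + 1) m = (la + real m) * pochhammer la m"
      using pochhammer_rec[of la m] by (simp add: pochhammer_Suc mult.commute)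
    define c where "c = pochhammer (la + 1) m / fact m * B ^ m"
    have hm: "h X Y $ m = c * rank2_poly a b X Y m" for X Y
      by (simp add: h_def rank2_series_def c_def la_def B_def)
    have "(fps_const la * (h X Y + h (- X) (- Y) + h X (- Y) + h (- X) Y)) $ m =
       (la * pochhammer (la + 1) m) / fact m * B ^ m * (rank2_poly a b X Y m + rank2_poly a b (- X) (- Y) m + rank2_poly a b X (- Y) m + rank2_poly a b (- X) Y m)"
      by (simp only: fps_mult_left_const_nth fps_add_nth hm distrib_left[symmetric]) (simp add: c_def)
    also have "\<dots> = 4 * ((la + real m) * q $ m)"
      unfolding p sum_signs_rank2_poly E_def[symmetric] by (simp add: q_def)
    finally show "(fps_const la * (h X Y + h (- X) (- Y) + h X (- Y) + h (- X) Y)) $ m = (fps_const 4 * (fps_const la * q + fps_X * fps_deriv q)) $ m"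
      by (simp only: r fps_mult_left_const_nth)
  qed
  define S where "S = (\<Sum>j<2 * k. dunkl_series k a b (z * cis (pi * real j / real k)) w + dunkl_series k a b (z * cis (pi * real j / real k)) (cnj w))"
  have "S = C * (R * (h X Y oo t)) + C * (R * (h (- X) (- Y) oo t)) + C * (R * (h X (- Y) oo t)) + C * (R * (h (- X) Y oo t))"
    unfolding S_def sum_lessThan_double ev od sum.distrib s1 s2 s3 s4 by (simp only: ac_simps)
  hence "fps_const la * S = C * (R * ((fps_const la * (h X Y + h (- X) (- Y) + h X (- Y) + h (- X) Y)) oo t))"
    using t0 by (simp add: fps_compose_add_distrib fps_compose_mult_distrib algebra_simps)
  also have "\<dots> = fps_const 4 * (C * (R * ((fps_const la * q + fps_X * fps_deriv q) oo t)))"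
    unfolding hsum using t0 by (simp add: fps_compose_mult_distrib[of _ "fps_const 4"] mult_ac)
  also have "C * (R * ((fps_const la * q + fps_X * fps_deriv q) oo t)) =
     fps_X * fps_deriv (fps_rpow A (- la) * (q oo t)) + fps_const (real k * la) * (fps_rpow A (- la) * (q oo t))"
    unfolding C_def R_def t_def by (rule fps_euler_rpow_compose[OF A0 k, symmetric])
  finally have "la * S $ n = 4 * ((real n + real k * la) * (fps_rpow A (- la) * (q oo t)) $ n)"
  proof -
    assume e: "fps_const la * S = fps_const 4 * (fps_X * fps_deriv (fps_rpow A (- la) * (q oo t)) + fps_const (real k * la) * (fps_rpow A (- la) * (q oo t)))"
    have "(fps_X * fps_deriv F + fps_const (real k * la) * F) $ n = (real n + real k * la) * F $ n" for F
      by (cases n) (simp_all add: algebra_simps)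
    thus ?thesis using arg_cong[OF e, of "\<lambda>f. f $ n"] by (simp only: fps_mult_left_const_nth)
  qed
  moreover have "(fps_rpow A (- la) * (q oo t)) $ n = pochhammer (real k * la) n * kern k la (even_moments a b) z w n"
  proof -
    have pp: "pochhammer (real k * la) n > 0" using k la by (intro pochhammer_pos) auto
    have E_odd: "E m = 0" if "odd m" for m
      unfolding E_def using that by (intro sum.neutral) (auto simp: even_moments_def)
    show ?thesis
      unfolding t_def fps_rpow_compose_nth[OF A0 k] kern_def sum_distrib_left[of "pochhammer (real k * la) n"]
    proof (intro sum.cong refl)
      fix m
      show "q $ m * fps_rpow A (- la - real m) $ (n - k * m) = pochhammer (real k * la) n *
        (kern_weight k la n m * cmod (z * w) ^ (n - k * m) * (\<Sum>l\<le>m. real (m choose l) * even_moments a b l (m - l) *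
          (Re (z ^ k) * Re (w ^ k)) ^ l * (Im (z ^ k) * Im (w ^ k)) ^ (m - l)))"
        unfolding X_def[symmetric] Y_def[symmetric] E_def[symmetric] A_def fps_rpow_cheb_prod_nth[of k "cmod (z * w)"]
        using pp E_odd[of m] by (cases "even m") (simp_all add: q_def kern_weight_def B_def)
    qed
  qed
  ultimately show ?thesis using la unfolding S_def[symmetric] la_def[symmetric] by (simp add: field_simps)
qed

lemma inner_mult_cis: "(x * cis t) \<bullet> y = x \<bullet> (y * cis (- t))"
  by (simp add: inner_complex_def algebra_simps)

lemma inner_cnj: "x \<bullet> cnj y = cnj x \<bullet> y"
  by (simp add: inner_complex_def)

text \<open>The rotation is moved to w, where it is a substitution inside the polynomial to which V
  is applied; on z it would move the point of evaluation.\<close>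

lemma dunkl_series_rotate:
  assumes "k > 0"
  shows "dunkl_series k a b (z * cis (pi * real j / real k)) w = dunkl_series k a b z (w * cis (- (pi * real j / real k)))"
proof -
  define t where "t = pi * real j / real k"
  have kt: "real k * t = real j * pi" using assms by (simp add: t_def)
  have c: "cis (real j * pi) = of_real ((- 1) ^ j)" by (simp add: complex_eq_iff cos_npi)
  have c': "cis (- (real j * pi)) = of_real ((- 1) ^ j)" by (simp add: complex_eq_iff cos_npi)
  have p1: "(z * cis t) ^ k = z ^ k * of_real ((- 1) ^ j)"
    by (simp only: power_mult_distrib Complex.DeMoivre kt c)
  have p2: "(w * cis (- t)) ^ k = w ^ k * of_real ((- 1) ^ j)"
    by (simp only: power_mult_distrib Complex.DeMoivre mult_minus_right kt c')
  have p3: "(z * cis t * cis s) \<bullet> w = (z * cis s) \<bullet> (w * cis (- t))" for s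
  proof -
    have "z * cis t * cis s = z * cis s * cis t" by (simp only: mult_ac)
    thus ?thesis by (simp only: inner_mult_cis)
  qed
  have p4: "cmod (z * cis t * w) = cmod (z * (w * cis (- t)))" by (simp add: norm_mult)
  have p5: "Re (x * of_real r) * Re y = Re x * Re (y * of_real r)"
    "Im (x * of_real r) * Im y = Im x * Im (y * of_real r)" for x y r by simp_all
  show ?thesis unfolding t_def[symmetric] dunkl_series_def p1 p2 p3 p4 p5 ..
qed

lemma polyfun_rotated_monomial:
  "polyfun (\<lambda>x. Re (x * cis t) ^ i * Im (x * cis t) ^ l)"
  "polyfun (\<lambda>x. Re (cnj (x * cis t)) ^ i * Im (cnj (x * cis t)) ^ l)"
proof -
  have e: "Re (x * cis t) = cos t * Re x + (- sin t) * Im x" "Im (x * cis t) = sin t * Re x + cos t * Im x"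
    "Re (cnj (x * cis t)) = cos t * Re x + (- sin t) * Im x" "Im (cnj (x * cis t)) = (- sin t) * Re x + (- cos t) * Im x" for x
    by (simp_all add: mult.commute)
  show "polyfun (\<lambda>x. Re (x * cis t) ^ i * Im (x * cis t) ^ l)"
    "polyfun (\<lambda>x. Re (cnj (x * cis t)) ^ i * Im (cnj (x * cis t)) ^ l)"
    unfolding e by (intro polyfun_mult polyfun_power polyfun_linear)+
qed

lemma kern_coeff_continuous: "continuous_on UNIV (\<lambda>z. kern_coeff k la T z i j)"
  unfolding kern_coeff_def by (intro continuous_intros)

context
  fixes k :: nat and a b :: real and V :: "(complex \<Rightarrow> real) \<Rightarrow> (complex \<Rightarrow> real)"
  assumes k: "k > 0" and a: "a > 0" and b: "b > 0" and V: "is_intertwiner k a b V"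
begin

lemma sum_group_intertwiner:
  assumes z: "Im (z ^ (2 * k)) \<noteq> 0"
  shows "(\<Sum>j<2 * k. V (\<lambda>x. (x \<bullet> (w * cis (- (pi * real j / real k)))) ^ n) z
       + V (\<lambda>x. (x \<bullet> (cnj w * cis (- (pi * real j / real k)))) ^ n) z) / fact n
     = 4 * real k * kern k (a + b) (even_moments a b) z w n"
proof -
  define K where "K = real k * (a + b)"
  have K0: "K > 0" using k a b by (simp add: K_def)
  define P where "P = pochhammer (K + 1) n"
  have P0: "P > 0" unfolding P_def using K0 by (intro pochhammer_pos) auto
  have p: "K * P = (K + real n) * pochhammer K n"
    unfolding P_def using pochhammer_rec[of K n] by (simp add: pochhammer_Suc mult.commute)
  have "P * ((\<Sum>j<2 * k. V (\<lambda>x. (x \<bullet> (w * cis (- (pi * real j / real k)))) ^ n) z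
       + V (\<lambda>x. (x \<bullet> (cnj w * cis (- (pi * real j / real k)))) ^ n) z) / fact n) =
     (\<Sum>j<2 * k. dunkl_series k a b (z * cis (pi * real j / real k)) w + dunkl_series k a b (z * cis (pi * real j / real k)) (cnj w)) $ n"
    unfolding fps_sum_nth fps_add_nth dunkl_series_rotate[OF k] intertwiner_eq_dunkl_series[OF k a b V z, symmetric]
      P_def K_def sum_divide_distrib sum_distrib_left
    by (intro sum.cong refl) (simp add: algebra_simps add_divide_distrib)
  also have "\<dots> = 4 * real k * (((K + real n) * pochhammer K n) / K * kern k (a + b) (even_moments a b) z w n)"
    unfolding sum_group_dunkl_series[OF k a b] K_def[symmetric] using k a b by (simp add: K_def add.commute)
  also have "\<dots> = P * (4 * real k * kern k (a + b) (even_moments a b) z w n)"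
    unfolding p[symmetric] using K0 by simp
  finally show ?thesis using P0 by (subst (asm) mult_left_cancel) simp_all
qed

text \<open>Expanding the powers of the inner product turns \<open>sum_group_intertwiner\<close>
  into an equality of two forms in w, valid for every w; the claim compares their
  coefficients.\<close>

lemma kern_coeff_eq_average:
  assumes z: "Im (z ^ (2 * k)) \<noteq> 0"
  shows "4 * real k * kern_coeff k (a + b) (even_moments a b) z i l =
    (\<Sum>j<2 * k. V (\<lambda>x. Re (x * cis (pi * real j / real k)) ^ i * Im (x * cis (pi * real j / real k)) ^ l) z
       + V (\<lambda>x. Re (cnj (x * cis (pi * real j / real k))) ^ i * Im (cnj (x * cis (pi * real j / real k))) ^ l) z)"
proof -
  let ?c = "kern_coeff k (a + b) (even_moments a b) z"
  define g where "g j x = x * cis (pi * real j / real k)" for j :: nat and x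
  define M where "M i l = (\<Sum>j<2 * k. V (\<lambda>x. Re (g j x) ^ i * Im (g j x) ^ l) z + V (\<lambda>x. Re (cnj (g j x)) ^ i * Im (cnj (g j x)) ^ l) z)" for i l
  have pf1: "polyfun (\<lambda>x. Re (g j x) ^ i * Im (g j x) ^ l)"
    and pf2: "polyfun (\<lambda>x. Re (cnj (g j x)) ^ i * Im (cnj (g j x)) ^ l)" for i j l
    unfolding g_def by (rule polyfun_rotated_monomial)+
  let ?d = "\<lambda>n i. (M i (n - i) - 4 * real k * ?c i (n - i)) / (fact i * fact (n - i))"
  have eq: "(\<Sum>i\<le>n. ?d n i * Re w ^ i * Im w ^ (n - i)) = 0" for n w
  proof -
    have e1: "V (\<lambda>x. (x \<bullet> (w * cis (- (pi * real j / real k)))) ^ n) z =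
       (\<Sum>i\<le>n. (real (n choose i) * Re w ^ i * Im w ^ (n - i)) * V (\<lambda>x. Re (g j x) ^ i * Im (g j x) ^ (n - i)) z)" for j
      unfolding inner_mult_cis[symmetric] g_def[symmetric] inner_power_eq_sum
      by (simp only: intertwiner_sum[OF k a b V finite_atMost pf1])
    have e2: "V (\<lambda>x. (x \<bullet> (cnj w * cis (- (pi * real j / real k)))) ^ n) z =
       (\<Sum>i\<le>n. (real (n choose i) * Re w ^ i * Im w ^ (n - i)) * V (\<lambda>x. Re (cnj (g j x)) ^ i * Im (cnj (g j x)) ^ (n - i)) z)" for j
      unfolding inner_mult_cis[symmetric] g_def[symmetric] inner_cnj inner_power_eq_sum
      by (simp only: intertwiner_sum[OF k a b V finite_atMost pf2])
    have "(\<Sum>j<2 * k. V (\<lambda>x. (x \<bullet> (w * cis (- (pi * real j / real k)))) ^ n) z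
       + V (\<lambda>x. (x \<bullet> (cnj w * cis (- (pi * real j / real k)))) ^ n) z) =
       (\<Sum>i\<le>n. real (n choose i) * Re w ^ i * Im w ^ (n - i) * M i (n - i))"
      unfolding e1 e2 sum.distrib[symmetric] M_def sum_distrib_left
      by (subst sum.swap) (simp add: distrib_left)
    hence "(\<Sum>i\<le>n. real (n choose i) * Re w ^ i * Im w ^ (n - i) * M i (n - i)) / fact n = 4 * real k * kern k (a + b) (even_moments a b) z w n"
      using sum_group_intertwiner[OF z, of w n] by simp
    moreover have "(\<Sum>i\<le>n. real (n choose i) * Re w ^ i * Im w ^ (n - i) * M i (n - i)) / fact n =
       (\<Sum>i\<le>n. M i (n - i) / (fact i * fact (n - i)) * Re w ^ i * Im w ^ (n - i))"
      unfolding sum_divide_distrib by (intro sum.cong refl) (simp add: binomial_fact)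
    ultimately have "(\<Sum>i\<le>n. M i (n - i) / (fact i * fact (n - i)) * Re w ^ i * Im w ^ (n - i)) -
        4 * real k * (\<Sum>i\<le>n. ?c i (n - i) / (fact i * fact (n - i)) * Re w ^ i * Im w ^ (n - i)) = 0"
      unfolding kern_eq_sum_kern_coeff[OF k] by linarith
    moreover have "(M - K * c) / f * x * y = M / f * x * y - K * (c / f * x * y)" for M K c f x y :: real
      by (simp add: diff_divide_distrib left_diff_distrib)
    ultimately show ?thesis by (simp only: sum_subtractf sum_distrib_left)
  qed
  have "?d n i = 0" if "i \<le> n" for i n
  proof -
    \<comment> \<open>On the line Im w = 1 the form is a polynomial in Re w that vanishes
      identically.\<close>
    have "(\<Sum>i\<le>n. ?d n i * x ^ i) = 0" for x
      using eq[of n "Complex x 1"] by simp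
    thus ?thesis using that polyfun_eq_0[of "\<lambda>i. ?d n i" n] by blast
  qed
  from this[of i "i + l"] show ?thesis by (simp add: M_def g_def)
qed

text \<open>An invariant p has one expansion into transformed monomials for each of the 4k group
  elements. Averaging V over these expansions is what \<open>kern_coeff_eq_average\<close>
  evaluates.\<close>

lemma intertwiner_invariant_regular:
  assumes z: "Im (z ^ (2 * k)) \<noteq> 0" and p: "polyfun p"
    and inv: "\<And>j z. j < 2 * k \<Longrightarrow> p (dih_refl k j z) = p z"
  shows "V p z = (\<Sum>(i, j)\<in>{ij. poly_coeffs p ij \<noteq> 0}. poly_coeffs p (i, j) * kern_coeff k (a + b) (even_moments a b) z i j)"
proof -
  define c where "c = poly_coeffs p"
  define S where "S = {ij. c ij \<noteq> 0}"
  have rep: "poly_rep c p" unfolding c_def by (rule poly_rep_poly_coeffs[OF p])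
  hence finS: "finite S" by (simp add: S_def poly_rep_def)
  have ps: "p x = (\<Sum>ij\<in>S. c ij * (Re x ^ fst ij * Im x ^ snd ij))" for x
    using rep by (simp add: poly_rep_def S_def case_prod_unfold mult.assoc)
  define g where "g j x = x * cis (pi * real j / real k)" for j :: nat and x
  have pg: "p (cnj x) = p x" for x using inv[of 0 x] k by (simp add: dih_refl_def)
  have pr: "p (g j x) = p x" if "j < 2 * k" for j x
    using inv[OF that, of "cnj x"] pg[of x] by (simp add: dih_refl_def g_def mult.commute)
  have pf1: "polyfun (\<lambda>x. Re (g j x) ^ i * Im (g j x) ^ l)"
    and pf2: "polyfun (\<lambda>x. Re (cnj (g j x)) ^ i * Im (cnj (g j x)) ^ l)" for i j l
    unfolding g_def by (rule polyfun_rotated_monomial)+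
  have v1: "V p z = (\<Sum>ij\<in>S. c ij * V (\<lambda>x. Re (g j x) ^ fst ij * Im (g j x) ^ snd ij) z)" if "j < 2 * k" for j
  proof -
    have "p = (\<lambda>x. \<Sum>ij\<in>S. c ij * (Re (g j x) ^ fst ij * Im (g j x) ^ snd ij))"
      using pr[OF that] ps[of "g j _"] by (auto simp: fun_eq_iff)
    hence "V p = V (\<lambda>x. \<Sum>ij\<in>S. c ij * (Re (g j x) ^ fst ij * Im (g j x) ^ snd ij))" by simp
    also have "\<dots> = (\<lambda>x. \<Sum>ij\<in>S. c ij * V (\<lambda>x. Re (g j x) ^ fst ij * Im (g j x) ^ snd ij) x)"
      by (rule intertwiner_sum[OF k a b V finS pf1])
    finally show ?thesis by simp
  qed
  have v2: "V p z = (\<Sum>ij\<in>S. c ij * V (\<lambda>x. Re (cnj (g j x)) ^ fst ij * Im (cnj (g j x)) ^ snd ij) z)" if "j < 2 * k" for j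
  proof -
    have "p = (\<lambda>x. \<Sum>ij\<in>S. c ij * (Re (cnj (g j x)) ^ fst ij * Im (cnj (g j x)) ^ snd ij))"
    proof
      fix x
      show "p x = (\<Sum>ij\<in>S. c ij * (Re (cnj (g j x)) ^ fst ij * Im (cnj (g j x)) ^ snd ij))"
        unfolding ps[of "cnj (g j x)", symmetric] using pr[OF that, of x] pg[of "g j x"] by simp
    qed
    hence "V p = V (\<lambda>x. \<Sum>ij\<in>S. c ij * (Re (cnj (g j x)) ^ fst ij * Im (cnj (g j x)) ^ snd ij))" by simp
    also have "\<dots> = (\<lambda>x. \<Sum>ij\<in>S. c ij * V (\<lambda>x. Re (cnj (g j x)) ^ fst ij * Im (cnj (g j x)) ^ snd ij) x)"
      by (rule intertwiner_sum[OF k a b V finS pf2])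
    finally show ?thesis by simp
  qed
  have "4 * real k * V p z = (\<Sum>j<2 * k. V p z + V p z)" by simp
  also have "\<dots> = (\<Sum>j<2 * k. \<Sum>ij\<in>S. c ij * (V (\<lambda>x. Re (g j x) ^ fst ij * Im (g j x) ^ snd ij) z
      + V (\<lambda>x. Re (cnj (g j x)) ^ fst ij * Im (cnj (g j x)) ^ snd ij) z))"
    using v1 v2 by (intro sum.cong refl) (simp add: distrib_left sum.distrib)
  also have "\<dots> = (\<Sum>ij\<in>S. c ij * (4 * real k * kern_coeff k (a + b) (even_moments a b) z (fst ij) (snd ij)))"
    unfolding kern_coeff_eq_average[OF z] g_def by (subst sum.swap) (simp only: sum_distrib_left)
  also have "\<dots> = 4 * real k * (\<Sum>ij\<in>S. c ij * kern_coeff k (a + b) (even_moments a b) z (fst ij) (snd ij))"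
    by (simp add: sum_distrib_left mult_ac)
  finally have "V p z = (\<Sum>ij\<in>S. c ij * kern_coeff k (a + b) (even_moments a b) z (fst ij) (snd ij))"
    using k by simp
  thus ?thesis by (simp add: S_def c_def case_prod_unfold)
qed

lemma intertwiner_invariant:
  assumes p: "polyfun p" and inv: "\<And>j z. j < 2 * k \<Longrightarrow> p (dih_refl k j z) = p z"
  shows "V p z = (\<Sum>(i, j)\<in>{ij. poly_coeffs p ij \<noteq> 0}. poly_coeffs p (i, j) * kern_coeff k (a + b) (even_moments a b) z i j)"
proof -
  define F where "F z = V p z - (\<Sum>(i, j)\<in>{ij. poly_coeffs p ij \<noteq> 0}. poly_coeffs p (i, j) * kern_coeff k (a + b) (even_moments a b) z i j)" for z
  have cF: "continuous_on UNIV F"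
    unfolding F_def case_prod_unfold
    by (intro continuous_intros polyfun_continuous intertwiner_polyfun[OF k a b V p] kern_coeff_continuous)
  have F0: "F z = 0" if "Im (z ^ (2 * k)) \<noteq> 0" for z
    using intertwiner_invariant_regular[OF that p inv] by (simp add: F_def)
  have reg: "F z = 0" if "z \<noteq> 0" for z
  proof (cases "Im (z ^ (2 * k)) = 0")
    case True
    \<comment> \<open>2k times this angle is 1 / (n + 1), which lies below \<pi>, so rotating z by
      it moves the nonzero real number \<open>z ^ (2 * k)\<close> off the real axis.\<close>
    define e where "e n = 1 / (2 * real k * (real n + 1))" for n
    define y where "y n = z * cis (e n)" for n
    have e: "e \<longlonglongrightarrow> 0"
      unfolding e_def using tendsto_mult_right_zero[OF LIMSEQ_Suc[OF lim_1_over_n], of "1 / (2 * real k)"]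
      by (simp add: add.commute)
    have "y \<longlonglongrightarrow> z * cis 0" unfolding y_def by (intro tendsto_intros e)
    hence "(\<lambda>n. F (y n)) \<longlonglongrightarrow> F z"
      using cF by (intro isCont_tendsto_compose[of z F]) (auto simp: continuous_on_eq_continuous_at)
    moreover have "F (y n) = 0" for n
    proof (rule F0)
      have "z ^ (2 * k) = of_real (Re (z ^ (2 * k)))" using True by (simp add: complex_eq_iff)
      hence "y n ^ (2 * k) = of_real (Re (z ^ (2 * k))) * cis (real (2 * k) * e n)"
        by (metis y_def power_mult_distrib Complex.DeMoivre)
      also have "real (2 * k) * e n = 1 / (real n + 1)" using k by (simp add: e_def)
      finally have "Im (y n ^ (2 * k)) = Re (z ^ (2 * k)) * sin (1 / (real n + 1))" by simp
      moreover have "Re (z ^ (2 * k)) \<noteq> 0" using True that by (metis complex_eq_iff power_eq_0_iff zero_complex.simps)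
      moreover have "sin (1 / (real n + 1)) > 0"
      proof (rule sin_gt_zero)
        have "1 / (real n + 1) \<le> 1" by simp
        thus "1 / (real n + 1) < pi" using pi_gt3 by linarith
      qed simp
      ultimately show "Im (y n ^ (2 * k)) \<noteq> 0" by simp
    qed
    ultimately show ?thesis by (simp add: LIMSEQ_const_iff)
  qed (rule F0)
  have "F z = 0"
  proof (cases "z = 0")
    case True
    \<comment> \<open>Rotations fix the origin, so it is approached through nonzero points, where F
      is already known to vanish.\<close>
    define y where "y n = complex_of_real (1 / (real n + 1))" for n
    have "(\<lambda>n. 1 / (real n + 1)) \<longlonglongrightarrow> 0"
      using LIMSEQ_Suc[OF lim_1_over_n] by (simp add: add.commute)
    hence "y \<longlonglongrightarrow> of_real 0" unfolding y_def by (rule tendsto_of_real)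
    hence "(\<lambda>n. F (y n)) \<longlonglongrightarrow> F z"
      using cF True by (intro isCont_tendsto_compose[of z F]) (auto simp: continuous_on_eq_continuous_at)
    moreover have "F (y n) = 0" for n
    proof (rule reg)
      have "1 / (real n + 1) \<noteq> 0" by simp
      thus "y n \<noteq> 0" unfolding y_def of_real_eq_0_iff .
    qed
    ultimately show ?thesis by (simp add: LIMSEQ_const_iff)
  qed (rule reg)
  thus ?thesis by (simp add: F_def)
qed

end

section \<open>Integration against the beta measures\<close>

definition nu_density :: "real \<Rightarrow> real \<Rightarrow> real" where
  "nu_density b v = nu_const b * (1 - v\<^sup>2) powr (b - 1)"

lemma Gamma_duplication_real:
  fixes b :: real
  assumes "b > 0"
  shows "Gamma b * Gamma (b + 1 / 2) = 2 powr (1 - 2 * b) * sqrt pi * Gamma (2 * b)"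
proof -
  have np: "x \<notin> \<int>\<^sub>\<le>\<^sub>0" if "x > 0" for x :: real using that by (auto elim!: nonpos_Ints_cases)
  have "complex_of_real b \<notin> \<int>\<^sub>\<le>\<^sub>0" "complex_of_real b + 1 / 2 \<notin> \<int>\<^sub>\<le>\<^sub>0"
  proof -
    show "complex_of_real b \<notin> \<int>\<^sub>\<le>\<^sub>0" using np[of b] assms by (simp add: of_real_in_nonpos_Ints_iff)
    have "complex_of_real (b + 1 / 2) \<notin> \<int>\<^sub>\<le>\<^sub>0" unfolding of_real_in_nonpos_Ints_iff using np[of "b + 1 / 2"] assms by auto
    thus "complex_of_real b + 1 / 2 \<notin> \<int>\<^sub>\<le>\<^sub>0" by simp
  qed
  note dup = Gamma_legendre_duplication[OF this]
  have e: "complex_of_real b + 1 / 2 = of_real (b + 1 / 2)" "2 * complex_of_real b = of_real (2 * b)"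
    "(1 - of_real (2 * b)) * complex_of_real (ln 2) = of_real ((1 - 2 * b) * ln 2)" by simp_all
  have "Gamma b * Gamma (b + 1 / 2) = exp ((1 - 2 * b) * ln 2) * sqrt pi * Gamma (2 * b)"
    using dup unfolding e Gamma_complex_of_real exp_of_real of_real_mult[symmetric] of_real_eq_iff .
  thus ?thesis by (simp add: powr_def mult.commute)
qed

text \<open>x = 2 t - 1 carries the density to the integrand of Beta(b, b), with 1 - x^2 = 4 t (1 -
  t). Legendre's duplication formula then evaluates the constant.\<close>

lemma nu_density_has_integral_1:
  assumes b: "b > 0"
  shows "(nu_density b has_integral 1) {-1..1}"
proof -
  have "((\<lambda>t. t powr (b - 1) * (1 - t) powr (b - 1)) has_integral Beta b b) (cbox 0 1)"
    using has_integral_Beta_real[OF b b] by simp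
  from has_integral_affinity'[OF this, of "1 / 2" "1 / 2"]
  have "((\<lambda>x. (x / 2 + 1 / 2) powr (b - 1) * (1 - (x / 2 + 1 / 2)) powr (b - 1)) has_integral 2 * Beta b b) {-1..1}"
    by simp
  hence hi: "((\<lambda>x. (nu_const b * 4 powr (b - 1)) * ((x / 2 + 1 / 2) powr (b - 1) * (1 - (x / 2 + 1 / 2)) powr (b - 1))) has_integral
     (nu_const b * 4 powr (b - 1)) * (2 * Beta b b)) {-1..1}"
    by (rule has_integral_mult_right)
  have one: "(nu_const b * 4 powr (b - 1)) * (2 * Beta b b) = 1"
  proof -
    have G: "Gamma b > 0" "Gamma (2 * b) > 0" using b by (auto intro: Gamma_real_pos)
    have "4 powr (b - 1) = (2 powr 2) powr (b - 1)" by simp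
    hence "4 powr (b - 1) = 2 powr (2 * (b - 1))" by (simp only: powr_powr)
    hence p: "2 * 4 powr (b - 1) * 2 powr (1 - 2 * b) = (1 :: real)"
    proof -
      assume e: "4 powr (b - 1) = 2 powr (2 * (b - 1))"
      have "2 * 4 powr (b - 1) * 2 powr (1 - 2 * b) = (2 powr 1 * 2 powr (2 * (b - 1))) * 2 powr (1 - 2 * b)"
        unfolding e by simp
      also have "\<dots> = 1" unfolding powr_add[symmetric] by (simp add: algebra_simps)
      finally show ?thesis .
    qed
    have "(nu_const b * 4 powr (b - 1)) * (2 * Beta b b) =
        (Gamma b * Gamma (b + 1 / 2)) * (2 * 4 powr (b - 1)) / (sqrt pi * Gamma (2 * b))"
      using G by (simp add: nu_const_def Beta_def field_simps)
    also have "\<dots> = 2 * 4 powr (b - 1) * 2 powr (1 - 2 * b)"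
      unfolding Gamma_duplication_real[OF b] using G by simp
    finally show ?thesis using p by simp
  qed
  have eq: "(nu_const b * 4 powr (b - 1)) * ((x / 2 + 1 / 2) powr (b - 1) * (1 - (x / 2 + 1 / 2)) powr (b - 1)) = nu_density b x"
    if "x \<in> {-1..1}" for x
  proof -
    have "4 powr (b - 1) * ((x / 2 + 1 / 2) powr (b - 1) * (1 - (x / 2 + 1 / 2)) powr (b - 1)) =
       (4 * ((x / 2 + 1 / 2) * (1 - (x / 2 + 1 / 2)))) powr (b - 1)"
      using that by (subst powr_mult, simp, simp, subst powr_mult) (auto simp: field_simps)
    also have "4 * ((x / 2 + 1 / 2) * (1 - (x / 2 + 1 / 2))) = 1 - x\<^sup>2"
      by (simp add: field_simps power2_eq_square)
    finally show ?thesis by (simp add: nu_density_def)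
  qed
  show ?thesis using has_integral_eq[OF eq hi] unfolding one .
qed

lemma nu_density_measurable [measurable]: "nu_density b \<in> borel_measurable borel"
  unfolding nu_density_def by measurable

lemma nu_const_nonneg: "b > 0 \<Longrightarrow> nu_const b \<ge> 0"
  unfolding nu_const_def by (intro divide_nonneg_nonneg mult_nonneg_nonneg less_imp_le[OF Gamma_real_pos]) auto

lemma nu_density_moment_integrable:
  assumes b: "b > 0"
  shows "set_integrable lborel {-1..1} (\<lambda>v. nu_density b v * v ^ n)"
proof -
  have nn: "nu_density b v \<ge> 0" for v using nu_const_nonneg[OF b] by (simp add: nu_density_def)
  have "nu_density b absolutely_integrable_on {-1..1}"
    using nu_density_has_integral_1[OF b] nn by (intro nonnegative_absolutely_integrable_1) (auto simp: integrable_on_def)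
  hence "set_integrable lborel {-1..1} (nu_density b)"
    unfolding set_integrable_def by (subst (asm) integrable_completion) auto
  thus ?thesis
  proof (rule set_integrable_bound)
    show "set_borel_measurable lborel {- 1..1} (\<lambda>v. nu_density b v * v ^ n)"
      unfolding set_borel_measurable_def by measurable
    show "AE v in lborel. v \<in> {- 1..1} \<longrightarrow> norm (nu_density b v * v ^ n) \<le> norm (nu_density b v)"
      using nn by (intro AE_I2 impI) (auto simp: abs_mult power_abs mult_left_le power_le_one abs_le_iff)
  qed
qed

text \<open>The integrand is the derivative of a multiple of v^n (1 - v^2)^b, which vanishes at both
  ends because b > 0. For b < 1 the derivative may be unbounded there, hence the fundamental theorem
  with derivatives in the interior only.\<close>

lemma nu_density_FTC:
  assumes b: "b > 0"
  shows "((\<lambda>v. (real n * v ^ (n - 1) * (1 - v\<^sup>2) - 2 * b * v ^ (n + 1)) * nu_density b v) has_integral 0) {-1..1}"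
proof -
  let ?F = "\<lambda>v. nu_const b * (v ^ n * (1 - v\<^sup>2) powr b)"
  have "((\<lambda>v. (real n * v ^ (n - 1) * (1 - v\<^sup>2) - 2 * b * v ^ (n + 1)) * nu_density b v) has_integral (?F 1 - ?F (- 1))) {-1..1}"
  proof (rule fundamental_theorem_of_calculus_interior)
    have sq: "v\<^sup>2 \<le> 1" if "v \<in> {-1..1}" for v :: real using that by (simp add: abs_square_le_1 abs_le_iff)
    show "continuous_on {- 1..1} ?F"
      using b sq by (intro continuous_intros continuous_on_powr') auto
    fix v :: real assume v: "v \<in> {-1<..<1}"
    have pos: "1 - v\<^sup>2 > 0" using v by (simp add: abs_square_less_1 abs_less_iff)
    have e: "(1 - v\<^sup>2) powr b = (1 - v\<^sup>2) * (1 - v\<^sup>2) powr (b - 1)"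
      using pos by (simp add: powr_diff)
    have "(?F has_real_derivative nu_const b * (real n * v ^ (n - 1) * (1 - v\<^sup>2) powr b + v ^ n * (b * (1 - v\<^sup>2) powr (b - 1) * (- 2 * v)))) (at v)"
      using pos by (auto intro!: derivative_eq_intros simp: algebra_simps)
    also have "nu_const b * (real n * v ^ (n - 1) * (1 - v\<^sup>2) powr b + v ^ n * (b * (1 - v\<^sup>2) powr (b - 1) * (- 2 * v))) =
       (real n * v ^ (n - 1) * (1 - v\<^sup>2) - 2 * b * v ^ (n + 1)) * nu_density b v"
      unfolding e nu_density_def by (simp add: algebra_simps)
    finally show "(?F has_vector_derivative (real n * v ^ (n - 1) * (1 - v\<^sup>2) - 2 * b * v ^ (n + 1)) * nu_density b v) (at v)"
      by (simp add: has_real_derivative_iff_has_vector_derivative)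
  qed simp
  thus ?thesis using b by simp
qed

text \<open>\<open>nu_density_FTC\<close> at n + 1 gives (n + 1 + 2 b) I(n + 2) = (n + 1) I(n),
  which for even n is two steps of \<open>rank1_coeff\<close>; at 0 it gives I(1) = 0.\<close>

lemma nu_density_moment:
  assumes b: "b > 0"
  shows "(LINT v:{-1..1}|lborel. nu_density b v * v ^ n) = (if even n then rank1_coeff b n else 0)"
proof -
  define I where "I n = integral {-1..1} (\<lambda>v. nu_density b v * v ^ n)" for n
  have LI: "(LINT v:{-1..1}|lborel. nu_density b v * v ^ n) = I n" for n
    unfolding I_def by (rule set_borel_integral_eq_integral(2)[OF nu_density_moment_integrable[OF b]])
  have hi: "((\<lambda>v. nu_density b v * v ^ n) has_integral I n) {-1..1}" for n
    unfolding I_def using set_borel_integral_eq_integral(1)[OF nu_density_moment_integrable[OF b]] by (rule integrable_integral)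
  have I0: "I 0 = 1" unfolding I_def using nu_density_has_integral_1[OF b] by (simp add: integral_unique)
  have I1: "I 1 = 0"
  proof -
    have "((\<lambda>v. (- 2 * b) * (nu_density b v * v ^ 1)) has_integral 0) {-1..1}"
      using nu_density_FTC[OF b, of 0] by (simp add: mult_ac)
    moreover have "((\<lambda>v. (- 2 * b) * (nu_density b v * v ^ 1)) has_integral (- 2 * b) * I 1) {-1..1}"
      by (rule has_integral_mult_right[OF hi])
    ultimately have "(- 2 * b) * I 1 = 0" using has_integral_unique by blast
    thus ?thesis using b by simp
  qed
  have rec: "(real n + 1 + 2 * b) * I (n + 2) = (real n + 1) * I n" for n
  proof -
    have "((\<lambda>v. (real n + 1) * (nu_density b v * v ^ n) - (real n + 1 + 2 * b) * (nu_density b v * v ^ (n + 2))) has_integral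
       (real n + 1) * I n - (real n + 1 + 2 * b) * I (n + 2)) {-1..1}"
      by (intro has_integral_diff has_integral_mult_right hi)
    moreover have "((\<lambda>v. (real n + 1) * (nu_density b v * v ^ n) - (real n + 1 + 2 * b) * (nu_density b v * v ^ (n + 2))) has_integral 0) {-1..1}"
    proof -
      have "(real (n + 1) * v ^ (n + 1 - 1) * (1 - v\<^sup>2) - 2 * b * v ^ (n + 1 + 1)) * nu_density b v =
        (real n + 1) * (nu_density b v * v ^ n) - (real n + 1 + 2 * b) * (nu_density b v * v ^ (n + 2))" for v
        by (simp add: power_add power2_eq_square algebra_simps)
      thus ?thesis using nu_density_FTC[OF b, of "n + 1"] by simp
    qed
    ultimately have "(real n + 1) * I n - (real n + 1 + 2 * b) * I (n + 2) = 0" using has_integral_unique by blast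
    thus ?thesis by simp
  qed
  have "I n = (if even n then rank1_coeff b n else 0) \<and> I (Suc n) = (if even (Suc n) then rank1_coeff b (Suc n) else 0)" for n
  proof (induction n)
    case 0
    show ?case using I0 I1 by simp
  next
    case (Suc n)
    have nz: "real n + 1 + 2 * b \<noteq> 0" using b by (metis add_pos_pos add_pos_nonneg less_numeral_extra(1) mult_2 of_nat_0_le_iff add.commute less_irrefl)
    have I2: "I (Suc (Suc n)) = (real n + 1) / (real n + 1 + 2 * b) * I n"
      using rec[of n] nz by (simp add: field_simps)
    show ?case
    proof (cases "even n")
      case True
      have "rank1_coeff b (Suc (Suc n)) = (real n + 1) / (real n + 1 + 2 * b) * rank1_coeff b n"
        using True by (simp add: add.commute mult.commute)
      thus ?thesis using Suc True I2 by simp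
    next
      case False
      thus ?thesis using Suc I2 by simp
    qed
  qed
  thus ?thesis unfolding LI by blast
qed

lemma nu_density_integral_sum:
  assumes b: "b > 0" and I: "finite I"
  shows "(LINT v:{-1..1}|lborel. nu_density b v * (\<Sum>i\<in>I. q i * v ^ n i)) =
    (\<Sum>i\<in>I. q i * (if even (n i) then rank1_coeff b (n i) else 0))"
proof -
  have "(LINT v:{-1..1}|lborel. nu_density b v * (\<Sum>i\<in>I. q i * v ^ n i)) =
     (LINT v|lborel. (\<Sum>i\<in>I. q i * (indicator {-1..1} v *\<^sub>R (nu_density b v * v ^ n i))))"
    unfolding set_lebesgue_integral_def by (simp add: sum_distrib_left sum_distrib_right mult_ac)
  also have "\<dots> = (\<Sum>i\<in>I. q i * (LINT v:{-1..1}|lborel. nu_density b v * v ^ n i))"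
    unfolding set_lebesgue_integral_def
    using nu_density_moment_integrable[OF b] unfolding set_integrable_def
    by (subst Bochner_Integration.integral_sum) auto
  finally show ?thesis by (simp only: nu_density_moment[OF b])
qed

text \<open>\<open>p_uv\<close> is a finite combination of monomials \<open>v ^ l * u ^ l'\<close>,
  and \<open>kern_coeff\<close> is linear in T. Integration replaces each monomial by its moment,
  hence T by \<open>even_moments\<close>.\<close>

lemma double_integral_p_uv:
  assumes k: "k > 0" and a: "a > 0" and b: "b > 0" and p: "polyfun p"
  shows "(LINT v:{-1..1}|lborel. nu_const b * (1 - v\<^sup>2) powr (b - 1) *
      (LINT u:{-1..1}|lborel. nu_const a * (1 - u\<^sup>2) powr (a - 1) * p_uv k a b p u v z)) =
    (\<Sum>(i, j)\<in>{ij. poly_coeffs p ij \<noteq> 0}. poly_coeffs p (i, j) * kern_coeff k (a + b) (even_moments a b) z i j)"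
proof -
  define S where "S = {ij. poly_coeffs p ij \<noteq> 0}"
  have finS: "finite S" using poly_rep_poly_coeffs[OF p] by (simp add: S_def poly_rep_def)
  \<comment> \<open>The nested sums over (i, j), m and l become one finite sum in which the
    dependence on T is isolated.\<close>
  define I where "I = (SIGMA ij:S. SIGMA m:{..(fst ij + snd ij) div k}. {..m})"
  have finI: "finite I" unfolding I_def using finS by auto
  define Q where "Q ij m l = poly_coeffs p ij * (fact (fst ij) * fact (snd ij)) * (kern_weight k (a + b) (fst ij + snd ij) m * cmod z ^ (fst ij + snd ij - k * m) *
       real (m choose l) * Re (z ^ k) ^ l * Im (z ^ k) ^ (m - l) * mixed_coeff k (fst ij + snd ij) m l (fst ij))" for ij m l
  have flat: "(\<Sum>(i, j)\<in>S. poly_coeffs p (i, j) * kern_coeff k (a + b) T z i j) =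
     (\<Sum>x\<in>I. Q (fst x) (fst (snd x)) (snd (snd x)) * T (snd (snd x)) (fst (snd x) - snd (snd x)))" for T
  proof -
    have "(\<Sum>(i, j)\<in>S. poly_coeffs p (i, j) * kern_coeff k (a + b) T z i j) =
       (\<Sum>ij\<in>S. \<Sum>m\<le>(fst ij + snd ij) div k. \<Sum>l\<le>m. Q ij m l * T l (m - l))"
      unfolding case_prod_unfold kern_coeff_def sum_distrib_left Q_def
      by (intro sum.cong refl) (simp add: mult_ac)
    also have "\<dots> = (\<Sum>ij\<in>S. \<Sum>x\<in>(SIGMA m:{..(fst ij + snd ij) div k}. {..m}). Q ij (fst x) (snd x) * T (snd x) (fst x - snd x))"
      by (intro sum.cong refl) (simp add: sum.Sigma case_prod_unfold)
    also have "\<dots> = (\<Sum>x\<in>I. Q (fst x) (fst (snd x)) (snd (snd x)) * T (snd (snd x)) (fst (snd x) - snd (snd x)))"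
      unfolding I_def using finS by (subst sum.Sigma) (auto simp: case_prod_unfold)
    finally show ?thesis .
  qed
  define l where "l x = snd (snd x)" for x :: "(nat \<times> nat) \<times> nat \<times> nat"
  define l' where "l' x = fst (snd x) - snd (snd x)" for x :: "(nat \<times> nat) \<times> nat \<times> nat"
  define q where "q x = Q (fst x) (fst (snd x)) (snd (snd x))" for x
  have puv: "p_uv k a b p u v z = (\<Sum>x\<in>I. (q x * v ^ l x) * u ^ l' x)" if "u \<in> {-1..1}" "v \<in> {-1..1}" for u v
  proof -
    have "\<bar>u\<bar> \<le> 1" "\<bar>v\<bar> \<le> 1" using that by auto
    moreover have "a + b > 0" using a b by simp
    ultimately have "p_uv k a b p u v z = (\<Sum>(i, j)\<in>S. poly_coeffs p (i, j) * kern_coeff k (a + b) (\<lambda>l l'. v ^ l * u ^ l') z i j)"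
      unfolding S_def using p_uv_eq_sum_kern_coeff[OF k] by blast
    thus ?thesis unfolding flat by (simp add: l_def l'_def q_def mult.assoc)
  qed
  have inner: "(LINT u:{-1..1}|lborel. nu_const a * (1 - u\<^sup>2) powr (a - 1) * p_uv k a b p u v z) =
     (\<Sum>x\<in>I. (q x * (if even (l' x) then rank1_coeff a (l' x) else 0)) * v ^ l x)" if "v \<in> {-1..1}" for v
  proof -
    have "(LINT u:{-1..1}|lborel. nu_const a * (1 - u\<^sup>2) powr (a - 1) * p_uv k a b p u v z) =
      (LINT u:{-1..1}|lborel. nu_density a u * (\<Sum>x\<in>I. (q x * v ^ l x) * u ^ l' x))"
      by (rule set_lebesgue_integral_cong) (auto simp: nu_density_def puv[OF _ that])
    thus ?thesis unfolding nu_density_integral_sum[OF a finI] by (simp add: mult_ac)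
  qed
  have "(LINT v:{-1..1}|lborel. nu_const b * (1 - v\<^sup>2) powr (b - 1) *
      (LINT u:{-1..1}|lborel. nu_const a * (1 - u\<^sup>2) powr (a - 1) * p_uv k a b p u v z)) =
     (LINT v:{-1..1}|lborel. nu_density b v * (\<Sum>x\<in>I. (q x * (if even (l' x) then rank1_coeff a (l' x) else 0)) * v ^ l x))"
    by (rule set_lebesgue_integral_cong) (auto simp: nu_density_def inner)
  also have "\<dots> = (\<Sum>x\<in>I. (q x * (if even (l' x) then rank1_coeff a (l' x) else 0)) * (if even (l x) then rank1_coeff b (l x) else 0))"
    by (rule nu_density_integral_sum[OF b finI])
  also have "\<dots> = (\<Sum>x\<in>I. q x * even_moments a b (l x) (l' x))"
    by (intro sum.cong refl) (simp add: even_moments_def)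
  also have "\<dots> = (\<Sum>(i, j)\<in>S. poly_coeffs p (i, j) * kern_coeff k (a + b) (even_moments a b) z i j)"
    unfolding flat by (simp add: q_def l_def l'_def)
  finally show ?thesis unfolding S_def .
qed

section \<open>The Fourier pairing\<close>

text \<open>One factor 1 / sqrt (2 \<pi>) per coordinate accounts for the 1 / (2 \<pi>) of
  \<open>fourier2\<close>. Complex exponentials throughout allow the derivative to be taken as that
  of a holomorphic function on the real line.\<close>

definition gauss_wave :: "nat \<Rightarrow> real \<Rightarrow> real \<Rightarrow> complex" where
  "gauss_wave n y x = of_real (1 / sqrt (2 * pi)) * exp (- (of_real x)\<^sup>2 / 2) * of_real x ^ n * exp (- (\<i> * of_real x * of_real y))"

lemma gauss_wave_eq: "gauss_wave n y x = of_real (std_normal_density x * x ^ n) * exp (- (\<i> * of_real x * of_real y))"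
proof -
  have "exp (- (complex_of_real x)\<^sup>2 / 2) = of_real (exp (- x\<^sup>2 / 2))"
    by (simp add: exp_of_real[symmetric])
  thus ?thesis by (simp add: gauss_wave_def std_normal_density_def)
qed

lemma norm_gauss_wave: "norm (gauss_wave n y x) = std_normal_density x * \<bar>x\<bar> ^ n"
  by (simp add: gauss_wave_eq norm_mult norm_power)

lemma gauss_wave_measurable [measurable]: "gauss_wave n y \<in> borel_measurable borel"
  unfolding gauss_wave_def by (intro borel_measurable_continuous_onI continuous_intros) auto

lemma gauss_wave_integrable: "integrable lborel (gauss_wave n y)"
  by (rule Bochner_Integration.integrable_bound[OF integrable_std_normal_moment_abs[of n]]) (auto simp: norm_gauss_wave)

lemma gauss_wave_tendsto_0:
  "(gauss_wave n y \<longlongrightarrow> 0) at_top" "(gauss_wave n y \<longlongrightarrow> 0) at_bot"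
proof -
  define C where "C = exp (1 / 2) / sqrt (2 * pi)"
  have C: "C \<ge> 0" by (simp add: C_def)
  have le: "norm (gauss_wave n y x) \<le> C * (\<bar>x\<bar> ^ n / exp \<bar>x\<bar>)" for x y
  proof -
    \<comment> \<open>This square trades the Gaussian for exp (-|x|), against which powers are known
      to be negligible.\<close>
    have "0 \<le> (\<bar>x\<bar> - 1)\<^sup>2" by simp
    hence "- x\<^sup>2 / 2 \<le> 1 / 2 - \<bar>x\<bar>" by (simp add: power2_eq_square algebra_simps)
    hence "exp (- x\<^sup>2 / 2) \<le> exp (1 / 2) / exp \<bar>x\<bar>" by (simp add: exp_diff[symmetric])
    hence "exp (- x\<^sup>2 / 2) * \<bar>x\<bar> ^ n / sqrt (2 * pi) \<le> (exp (1 / 2) / exp \<bar>x\<bar>) * \<bar>x\<bar> ^ n / sqrt (2 * pi)"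
      by (intro divide_right_mono mult_right_mono) auto
    thus ?thesis by (simp add: norm_gauss_wave std_normal_density_def C_def mult_ac)
  qed
  have lim: "((\<lambda>x. C * (x ^ n / exp x)) \<longlongrightarrow> 0) at_top"
    by (intro tendsto_mult_right_zero tendsto_power_div_exp_0)
  show "(gauss_wave n y \<longlongrightarrow> 0) at_top"
  proof (rule Lim_null_comparison[OF _ lim], rule eventually_at_top_linorderI[of 0])
    fix x :: real assume "0 \<le> x"
    thus "norm (gauss_wave n y x) \<le> C * (x ^ n / exp x)" using le[of y x] by simp
  qed
  have "((\<lambda>x. gauss_wave n y (- x)) \<longlongrightarrow> 0) at_top"
  proof (rule Lim_null_comparison[OF _ lim], rule eventually_at_top_linorderI[of 0])
    fix x :: real assume "0 \<le> x"
    thus "norm (gauss_wave n y (- x)) \<le> C * (x ^ n / exp x)" using le[of y "- x"] by simp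
  qed
  thus "(gauss_wave n y \<longlongrightarrow> 0) at_bot" by (simp add: filterlim_at_bot_mirror)
qed

definition gauss_fourier :: "nat \<Rightarrow> real \<Rightarrow> complex" where
  "gauss_fourier n y = integral\<^sup>L lborel (gauss_wave n y)"

text \<open>The derivative of \<open>gauss_wave n y\<close> has integral 0, as the function vanishes
  at both infinities. For n = 0 the factor n removes the term with the truncated index.\<close>

lemma gauss_fourier_Suc:
  "gauss_fourier (Suc n) y = of_nat n * gauss_fourier (n - 1) y - \<i> * of_real y * gauss_fourier n y"
proof -
  define F' where "F' x = of_nat n * gauss_wave (n - 1) y x - gauss_wave (Suc n) y x - \<i> * of_real y * gauss_wave n y x" for x
  have int: "integrable lborel F'"
    unfolding F'_def by (intro Bochner_Integration.integrable_diff integrable_mult_right gauss_wave_integrable)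
  have "(LBINT x=-\<infinity>..\<infinity>. F' x) = 0 - 0"
  proof (rule interval_integral_FTC_integrable)
    show "(gauss_wave n y has_vector_derivative F' x) (at x)" for x
    proof -
      define c where "c = complex_of_real (1 / sqrt (2 * pi))"
      have gw: "gauss_wave m y x = c * exp (- (of_real x)\<^sup>2 / 2) * of_real x ^ m * exp (- (\<i> * of_real x * of_real y))" for m x
        by (simp only: gauss_wave_def c_def)
      have "((\<lambda>z. c * exp (- z\<^sup>2 / 2) * z ^ n * exp (- (\<i> * z * of_real y))) has_field_derivative F' x) (at (of_real x))"
        unfolding F'_def gw
        by (auto intro!: derivative_eq_intros simp: algebra_simps power2_eq_square)
      thus ?thesis unfolding gw[abs_def] by (rule has_vector_derivative_real_field)
    qed
    show "isCont F' x" for x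
      unfolding F'_def gauss_wave_def by (intro continuous_intros) auto
    show "set_integrable lborel (einterval (- \<infinity>) \<infinity>) F'"
      using int by (simp add: einterval_eq_UNIV set_integrable_def)
    show "((gauss_wave n y \<circ> real_of_ereal) \<longlongrightarrow> 0) (at_right (- \<infinity>))" "((gauss_wave n y \<circ> real_of_ereal) \<longlongrightarrow> 0) (at_left \<infinity>)"
      using gauss_wave_tendsto_0 by (simp_all add: ereal_tendsto_simps)
  qed simp
  hence "integral\<^sup>L lborel F' = 0"
    by (simp add: interval_lebesgue_integral_def einterval_eq_UNIV set_lebesgue_integral_def)
  moreover have "integral\<^sup>L lborel F' = of_nat n * gauss_fourier (n - 1) y - gauss_fourier (Suc n) y - \<i> * of_real y * gauss_fourier n y"
    unfolding F'_def gauss_fourier_def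
    by (simp add: gauss_wave_integrable)
  ultimately show ?thesis by (simp add: algebra_simps)
qed

lemma gauss_fourier_0: "gauss_fourier 0 y = of_real (exp (- y\<^sup>2 / 2))"
proof -
  have "char std_normal_distribution (- y) = (LINT x|lborel. std_normal_density x *\<^sub>R iexp (- y * x))"
    unfolding char_def by (subst integral_density) auto
  also have "(\<lambda>x. std_normal_density x *\<^sub>R iexp (- y * x)) = gauss_wave 0 y"
    by (auto simp: gauss_wave_eq fun_eq_iff scaleR_conv_of_real mult_ac)
  finally show ?thesis by (simp add: gauss_fourier_def char_std_normal_distribution)
qed

section \<open>Hermite polynomials and Gaussian means\<close>

primrec hermite :: "nat \<Rightarrow> real poly" where
  "hermite 0 = 1"
| "hermite (Suc n) = [:0, 1:] * hermite n - pderiv (hermite n)"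

lemma pderiv_hermite_Suc: "pderiv (hermite (Suc n)) = smult (real (Suc n)) (hermite n)"
proof (induction n)
  case 0
  show ?case by (simp add: pderiv_pCons)
next
  case (Suc n)
  define h where "h = hermite n"
  define h1 where "h1 = hermite (Suc n)"
  have h1: "h1 = [:0, 1:] * h - pderiv h" by (simp add: h_def h1_def)
  have d: "pderiv h1 = smult (real (Suc n)) h" using Suc by (simp add: h_def h1_def)
  have "pderiv (hermite (Suc (Suc n))) = pderiv ([:0, 1:] * h1 - pderiv h1)" by (simp add: h1_def)
  also have "\<dots> = h1 + [:0, 1:] * pderiv h1 - pderiv (pderiv h1)"
    by (simp add: pderiv_diff pderiv_mult pderiv_pCons)
  also have "\<dots> = h1 + smult (real (Suc n)) ([:0, 1:] * h - pderiv h)"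
    unfolding d by (simp add: pderiv_smult smult_diff_right)
  also have "\<dots> = smult (real (Suc (Suc n))) h1"
    unfolding h1[symmetric] of_nat_Suc[of "Suc n"] smult_add_left smult_1_left ..
  finally show ?case by (simp add: h1_def)
qed

text \<open>These are the probabilists' Hermite polynomials. By \<open>pderiv_hermite_Suc\<close>
  they satisfy He_(m+1) = y He_m - m He_(m-1), which is \<open>gauss_fourier_Suc\<close> after
  division by the powers of -i.\<close>

lemma gauss_fourier_eq_hermite:
  "gauss_fourier n y = (- \<i>) ^ n * of_real (poly (hermite n) y * exp (- y\<^sup>2 / 2))"
proof (induction n rule: less_induct)
  case (less n)
  show ?case
  proof (cases n)
    case 0
    thus ?thesis by (simp add: gauss_fourier_0)
  next
    case (Suc m)
    define e where "e = complex_of_real (exp (- y\<^sup>2 / 2))"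
    have m: "gauss_fourier m y = (- \<i>) ^ m * (of_real (poly (hermite m) y) * e)" using less[of m] Suc by (simp add: e_def)
    show ?thesis
    proof (cases m)
      case 0
      thus ?thesis unfolding Suc by (simp add: gauss_fourier_Suc gauss_fourier_0)
    next
      case (Suc l)
      have l: "gauss_fourier l y = (- \<i>) ^ l * (of_real (poly (hermite l) y) * e)" using less[of l] Suc \<open>n = Suc m\<close> by (simp add: e_def)
      define P where "P = (- \<i>) ^ l"
      define A where "A = complex_of_real (poly (hermite m) y)"
      define B where "B = complex_of_real (poly (hermite l) y)"
      have "poly (hermite (Suc m)) y = y * poly (hermite m) y - real m * poly (hermite l) y"
        using pderiv_hermite_Suc[of l] Suc by (simp only: hermite.simps(2)[of m]) simp
      hence h: "of_real (poly (hermite (Suc m)) y * exp (- y\<^sup>2 / 2)) = (of_real y * A - of_nat m * B) * e"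
        by (simp only: e_def A_def B_def) simp
      have p: "(- \<i>) ^ Suc m = - P" "(- \<i>) ^ m = - \<i> * P" using Suc by (simp_all add: P_def)
      have "of_nat m * (P * (B * e)) - \<i> * of_real y * ((- \<i> * P) * (A * e)) = - P * ((of_real y * A - of_nat m * B) * e)"
        by (simp add: algebra_simps)
      moreover have "gauss_fourier (m - 1) y = P * (B * e)" using l Suc by (simp add: P_def B_def)
      moreover have "gauss_fourier m y = (- \<i> * P) * (A * e)" using m p(2) by (simp only: A_def)
      ultimately show ?thesis unfolding \<open>n = Suc m\<close> gauss_fourier_Suc h p(1) by (simp only:)
    qed
  qed
qed

definition gauss_mean :: "real poly \<Rightarrow> real" where
  "gauss_mean q = integral\<^sup>L lborel (\<lambda>x. std_normal_density x * poly q x)"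

lemma gauss_poly_integrable: "integrable lborel (\<lambda>x. std_normal_density x * poly q x)"
proof -
  have "(\<lambda>x. std_normal_density x * poly q x) = (\<lambda>x. \<Sum>i\<le>degree q. coeff q i * (std_normal_density x * x ^ i))"
    by (simp add: poly_altdef sum_distrib_left mult_ac)
  thus ?thesis by (simp add: integrable_std_normal_moment)
qed

lemma gauss_mean_add: "gauss_mean (p + q) = gauss_mean p + gauss_mean q"
  using gauss_poly_integrable by (simp add: gauss_mean_def distrib_left)

lemma gauss_mean_diff: "gauss_mean (p - q) = gauss_mean p - gauss_mean q"
  using gauss_poly_integrable by (simp add: gauss_mean_def right_diff_distrib)

lemma gauss_mean_smult: "gauss_mean (smult c q) = c * gauss_mean q"
  by (simp add: gauss_mean_def mult.left_commute)

lemma gauss_mean_1: "gauss_mean 1 = 1"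
  using integral_std_normal_moment_even[of 0] by (simp add: gauss_mean_def)

lemma gauss_mean_monom_Suc: "gauss_mean (monom 1 (Suc n)) = real n * gauss_mean (monom 1 (n - 1))"
proof -
  have "gauss_fourier n 0 = of_real (gauss_mean (monom 1 n))" for n
  proof -
    have "gauss_wave n 0 = (\<lambda>x. complex_of_real (std_normal_density x * poly (monom 1 n) x))"
      by (simp add: fun_eq_iff gauss_wave_eq poly_monom)
    thus ?thesis unfolding gauss_fourier_def gauss_mean_def by (simp only: integral_complex_of_real)
  qed
  from gauss_fourier_Suc[of n 0, unfolded this]
  have "complex_of_real (gauss_mean (monom 1 (Suc n))) = of_real (real n * gauss_mean (monom 1 (n - 1)))" by simp
  thus ?thesis by (simp only: of_real_eq_iff)
qed

text \<open>Stein's identity. On monomials it is the case y = 0 of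
  \<open>gauss_fourier_Suc\<close>.\<close>

lemma gauss_mean_X_mult: "gauss_mean ([:0, 1:] * q) = gauss_mean (pderiv q)"
proof -
  have mon: "gauss_mean ([:0, 1:] * monom c i) = gauss_mean (pderiv (monom c i))" for c i
  proof -
    have "[:0, 1:] * monom c i = smult c (monom 1 (Suc i))" by (simp add: smult_monom monom_Suc)
    moreover have "pderiv (monom c i) = smult (c * real i) (monom 1 (i - 1))"
      by (simp add: pderiv_monom smult_monom mult.commute)
    ultimately show ?thesis by (simp only: gauss_mean_smult gauss_mean_monom_Suc mult.assoc)
  qed
  have "gauss_mean ([:0, 1:] * (\<Sum>i\<in>I. monom (c i) i)) = gauss_mean (pderiv (\<Sum>i\<in>I. monom (c i) i))" if "finite I" for I c
    using that
  proof (induction I rule: finite_induct)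
    case (insert i I)
    have e: "(\<Sum>i\<in>insert i I. monom (c i) i) = monom (c i) i + (\<Sum>i\<in>I. monom (c i) i)"
      using insert by simp
    show ?case unfolding e distrib_left pderiv_add gauss_mean_add insert.IH mon ..
  qed (simp add: gauss_mean_def)
  from this[of "{..degree q}" "coeff q"] show ?thesis by (simp only: poly_as_sum_of_monoms) simp
qed

text \<open>X - d/dx is the adjoint of d/dx for the Gaussian weight, so each step of the Hermite
  recursion moves one derivative to q.\<close>

lemma gauss_mean_hermite_mult: "gauss_mean (hermite n * q) = gauss_mean ((pderiv ^^ n) q)"
proof (induction n arbitrary: q)
  case (Suc n)
  have "gauss_mean (hermite (Suc n) * q) = gauss_mean ([:0, 1:] * (hermite n * q)) - gauss_mean (pderiv (hermite n) * q)"
    by (simp only: hermite.simps left_diff_distrib gauss_mean_diff mult.assoc)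
  also have "\<dots> = gauss_mean (hermite n * pderiv q)"
    unfolding gauss_mean_X_mult pderiv_mult gauss_mean_add by (simp add: mult.commute)
  finally show ?case by (simp add: Suc funpow_swap1)
qed simp

lemma pderiv_funpow_hermite: "(pderiv ^^ n) (hermite n) = [:fact n:]"
proof (induction n)
  case (Suc n)
  have sm: "(pderiv ^^ n) (smult c q) = smult c ((pderiv ^^ n) q)" for c :: real and q
    by (induction n) (simp_all add: pderiv_smult)
  have "(pderiv ^^ Suc n) (hermite (Suc n)) = (pderiv ^^ n) (pderiv (hermite (Suc n)))" by (simp add: funpow_swap1)
  thus ?case unfolding pderiv_hermite_Suc sm Suc by simp
qed (simp add: one_pCons)

lemma gauss_mean_hermite: "gauss_mean (hermite n * hermite m) = (if n = m then fact n else 0)"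
proof -
  have less: "gauss_mean (hermite n * hermite m) = 0" if "m < n" for m n
  proof -
    obtain d where d: "n = Suc d + m" using less_imp_Suc_add[OF \<open>m < n\<close>] by (auto simp: add.commute)
    have z: "(pderiv ^^ d) 0 = (0 :: real poly)" by (induction d) simp_all
    have "(pderiv ^^ n) (hermite m) = (pderiv ^^ Suc d) [:fact m:]"
      unfolding d funpow_add comp_def pderiv_funpow_hermite ..
    also have "\<dots> = 0" by (simp only: funpow_Suc_right comp_def pderiv_singleton z)
    finally show ?thesis unfolding gauss_mean_hermite_mult by (simp add: gauss_mean_def)
  qed
  consider "n = m" | "m < n" | "n < m" by linarith
  thus ?thesis
  proof cases
    case 1
    have "gauss_mean [:fact m:] = fact m"
      using gauss_mean_smult[of "fact m" 1] by (simp add: gauss_mean_1)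
    thus ?thesis using 1 by (simp add: gauss_mean_hermite_mult pderiv_funpow_hermite)
  next
    case 2
    thus ?thesis using less by simp
  next
    case 3
    thus ?thesis using less[of n m] by (simp add: mult.commute)
  qed
qed

text \<open>The inequality 2 X Y \<le> s X^2 + Y^2 / s stands in for Cauchy-Schwarz. It leaves s
  free, to be chosen degree by degree so that the majorants become summable.\<close>

lemma gauss_mean_abs_mult_le:
  assumes "s > 0"
  shows "(LINT x|lborel. std_normal_density x * \<bar>poly (p * q) x\<bar>) \<le> (s * gauss_mean (p * p) + gauss_mean (q * q) / s) / 2"
proof -
  have "(LINT x|lborel. std_normal_density x * \<bar>poly (p * q) x\<bar>) \<le>
     (LINT x|lborel. (s * (std_normal_density x * poly (p * p) x) + (std_normal_density x * poly (q * q) x) / s) / 2)"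
  proof (rule integral_mono)
    have "integrable lborel (\<lambda>x. \<bar>std_normal_density x * poly (p * q) x\<bar>)"
      using gauss_poly_integrable by (rule integrable_abs)
    thus "integrable lborel (\<lambda>x. std_normal_density x * \<bar>poly (p * q) x\<bar>)" by (simp add: abs_mult)
    show "integrable lborel (\<lambda>x. (s * (std_normal_density x * poly (p * p) x) + (std_normal_density x * poly (q * q) x) / s) / 2)"
      using gauss_poly_integrable[of "p * p"] gauss_poly_integrable[of "q * q"]
      by (intro integrable_divide_zero Bochner_Integration.integrable_add integrable_mult_right) auto
    fix x
    define X where "X = \<bar>poly p x\<bar>"
    define Y where "Y = \<bar>poly q x\<bar>"
    have "0 \<le> (s * X - Y)\<^sup>2" by simp
    hence "2 * s * (X * Y) \<le> s * s * (X * X) + Y * Y" by (simp add: power2_eq_square algebra_simps)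
    hence "X * Y \<le> (s * (X * X) + (Y * Y) / s) / 2" using assms by (simp add: field_simps)
    hence "std_normal_density x * (X * Y) \<le> std_normal_density x * ((s * (X * X) + (Y * Y) / s) / 2)"
      by (intro mult_left_mono) auto
    thus "std_normal_density x * \<bar>poly (p * q) x\<bar> \<le> (s * (std_normal_density x * poly (p * p) x) + (std_normal_density x * poly (q * q) x) / s) / 2"
      by (simp add: X_def Y_def abs_mult algebra_simps add_divide_distrib)
  qed
  also have "\<dots> = (s * gauss_mean (p * p) + gauss_mean (q * q) / s) / 2"
    unfolding gauss_mean_def using gauss_poly_integrable[of "p * p"] gauss_poly_integrable[of "q * q"] by simp
  finally show ?thesis .
qed

section \<open>Product integrals over the plane and termwise integration\<close>

lemma lborel_complex_eq_distr: "lborel = distr (lborel \<Otimes>\<^sub>M lborel) borel (\<lambda>(x, y). Complex x y)"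
proof (rule lborel_eqI)
  have meas[measurable]: "(\<lambda>(x, y). Complex x y) \<in> borel_measurable (lborel \<Otimes>\<^sub>M lborel)"
  proof -
    have "(\<lambda>(x, y). Complex x y) = (\<lambda>p. of_real (fst p) + \<i> * of_real (snd p))" by (auto simp: complex_eq_iff)
    thus ?thesis by simp
  qed
  fix l u :: complex assume lu: "\<And>b. b \<in> Basis \<Longrightarrow> l \<bullet> b \<le> u \<bullet> b"
  have 1: "Re l \<le> Re u" "Im l \<le> Im u" using lu[of 1] lu[of \<i>] by (auto simp: Basis_complex_def)
  have "(\<lambda>(x, y). Complex x y) -` box l u \<inter> space (lborel \<Otimes>\<^sub>M lborel) = {Re l<..<Re u} \<times> {Im l<..<Im u}"
    by (auto simp: in_box_complex_iff space_pair_measure)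
  hence "emeasure (distr (lborel \<Otimes>\<^sub>M lborel) borel (\<lambda>(x, y). Complex x y)) (box l u) = emeasure (lborel \<Otimes>\<^sub>M lborel) ({Re l<..<Re u} \<times> {Im l<..<Im u})"
    by (subst emeasure_distr) auto
  also have "\<dots> = ennreal (Re u - Re l) * ennreal (Im u - Im l)"
    using 1 by (subst lborel.emeasure_pair_measure_Times) auto
  also have "\<dots> = (\<Prod>b\<in>Basis. (u - l) \<bullet> b)"
    using 1 by (simp add: Basis_complex_def ennreal_mult)
  finally show "emeasure (distr (lborel \<Otimes>\<^sub>M lborel) borel (\<lambda>(x, y). Complex x y)) (box l u) = (\<Prod>b\<in>Basis. (u - l) \<bullet> b)" .
qed simp

lemma integral_complex_product:
  fixes f g :: "real \<Rightarrow> complex"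
  assumes f: "integrable lborel f" and g: "integrable lborel g"
  shows "integrable lborel (\<lambda>z. f (Re z) * g (Im z))"
    and "integral\<^sup>L lborel (\<lambda>z. f (Re z) * g (Im z)) = integral\<^sup>L lborel f * integral\<^sup>L lborel g"
proof -
  have [measurable]: "f \<in> borel_measurable borel" "g \<in> borel_measurable borel"
    using borel_measurable_integrable[OF f] borel_measurable_integrable[OF g] by auto
  have meas[measurable]: "(\<lambda>(x, y). Complex x y) \<in> borel_measurable (lborel \<Otimes>\<^sub>M lborel)"
  proof -
    have "(\<lambda>(x, y). Complex x y) = (\<lambda>p. of_real (fst p) + \<i> * of_real (snd p))" by (auto simp: complex_eq_iff)
    thus ?thesis by simp
  qed
  have int: "integrable (lborel \<Otimes>\<^sub>M lborel) (\<lambda>p. f (fst p) * g (snd p))"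
  proof (rule lborel_pair.Fubini_integrable)
    show "integrable lborel (\<lambda>x. LINT y|lborel. norm (f (fst (x, y)) * g (snd (x, y))))"
      using f by (simp add: norm_mult)
    show "AE x in lborel. integrable lborel (\<lambda>y. f (fst (x, y)) * g (snd (x, y)))"
      using g by simp
  qed measurable
  have fgm: "(\<lambda>z. f (Re z) * g (Im z)) \<in> borel_measurable borel" by measurable
  have e: "(\<lambda>p. f (Re (case p of (x, y) \<Rightarrow> Complex x y)) * g (Im (case p of (x, y) \<Rightarrow> Complex x y))) = (\<lambda>p. f (fst p) * g (snd p))"
    by (auto simp: fun_eq_iff)
  show "integrable lborel (\<lambda>z. f (Re z) * g (Im z))"
    by (subst lborel_complex_eq_distr, subst integrable_distr_eq) (auto simp: e int)
  have "integral\<^sup>L lborel (\<lambda>z. f (Re z) * g (Im z)) = integral\<^sup>L (lborel \<Otimes>\<^sub>M lborel) (\<lambda>p. f (fst p) * g (snd p))"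
    by (subst lborel_complex_eq_distr, subst integral_distr) (auto simp: e)
  also have "\<dots> = (LINT x|lborel. LINT y|lborel. f x * g y)"
    using lborel_pair.integral_fst'[OF int] by simp
  finally show "integral\<^sup>L lborel (\<lambda>z. f (Re z) * g (Im z)) = integral\<^sup>L lborel f * integral\<^sup>L lborel g" by simp
qed

text \<open>\<open>prod_decode\<close> enumerates the pairs, so that termwise integration of
  ordinary series applies; absolute summability undoes the enumeration.\<close>

lemma has_sum_integral:
  fixes f :: "nat \<times> nat \<Rightarrow> 'a \<Rightarrow> complex"
  assumes int: "\<And>p. integrable M (f p)"
    and sm: "(\<lambda>p. integral\<^sup>L M (\<lambda>x. norm (f p x))) summable_on UNIV"
    and F: "\<And>x. ((\<lambda>p. f p x) has_sum F x) UNIV"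
  shows "integrable M F" and "((\<lambda>p. integral\<^sup>L M (f p)) has_sum integral\<^sup>L M F) UNIV"
proof -
  have bij: "bij_betw prod_decode UNIV UNIV" by (rule bij_prod_decode)
  define g where "g n = f (prod_decode n)" for n
  have "(\<lambda>n. integral\<^sup>L M (\<lambda>x. norm (g n x))) summable_on UNIV"
    unfolding g_def using summable_on_reindex_bij_betw[OF bij, of "\<lambda>p. integral\<^sup>L M (\<lambda>x. norm (f p x))"] sm by simp
  hence s1: "summable (\<lambda>n. integral\<^sup>L M (\<lambda>x. norm (g n x)))"
    by (rule summable_on_imp_summable)
  have hg: "((\<lambda>n. g n x) has_sum F x) UNIV" for x
    unfolding g_def using has_sum_reindex_bij_betw[OF bij, of "\<lambda>p. f p x"] F by simp
  have s2: "summable (\<lambda>n. norm (g n x))" for x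
  proof (rule summable_on_imp_summable)
    show "(\<lambda>n. norm (g n x)) summable_on UNIV"
      using has_sum_imp_summable[OF hg[of x]] by (simp only: summable_on_iff_abs_summable_on_complex)
  qed
  have Fx: "(\<Sum>n. g n x) = F x" for x using sums_unique[OF has_sum_imp_sums[OF hg[of x]]] by simp
  have "integrable M (\<lambda>x. \<Sum>n. g n x)"
    using int s1 s2 by (intro integrable_suminf) (auto simp: g_def)
  thus "integrable M F" unfolding Fx .
  have "(\<lambda>n. integral\<^sup>L M (g n)) sums (\<integral>x. (\<Sum>n. g n x) \<partial>M)"
    using int s1 s2 by (intro sums_integral) (auto simp: g_def)
  moreover have "summable (\<lambda>n. norm (integral\<^sup>L M (g n)))"
    by (rule summable_comparison_test[OF _ s1]) (use integral_norm_bound in auto)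
  ultimately have "((\<lambda>n. integral\<^sup>L M (g n)) has_sum integral\<^sup>L M F) UNIV"
    unfolding Fx by (intro norm_summable_imp_has_sum)
  thus "((\<lambda>p. integral\<^sup>L M (f p)) has_sum integral\<^sup>L M F) UNIV"
    unfolding g_def using has_sum_reindex_bij_betw[OF bij, of "\<lambda>p. integral\<^sup>L M (f p)"] by simp
qed

text \<open>R exceeds C D, so the part divided by R^i is geometric with ratio below 1; in the part
  multiplied by R^i the factorial survives and gives an exponential series.\<close>

lemma gauss_bound_summable_on:
  fixes C D G :: real
  assumes "C \<ge> 0" and "D \<ge> 0"
  defines "R \<equiv> 2 * C * D + 1"
  shows "(\<lambda>i. C ^ i / fact i * ((D ^ i * fact i / R ^ i + R ^ i * G) / 2)) summable_on UNIV"
proof -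
  have R: "R > 0" "C * D / R < 1" "C * D / R \<ge> 0" using assms by (auto simp: R_def add_nonneg_pos divide_simps)
  have CD: "C * D \<ge> 0" using assms by simp
  have "(\<lambda>i. (C * D / R) ^ i * (1 / 2) + (C * R) ^ i / fact i * (G / 2)) summable_on UNIV"
    using R CD by (intro summable_on_add summable_on_cmult_left exp_terms_summable_on norm_summable_imp_summable_on)
      (auto simp: norm_power intro!: summable_geometric)
  moreover have "C ^ i / fact i * ((D ^ i * fact i / R ^ i + R ^ i * G) / 2) = (C * D / R) ^ i * (1 / 2) + (C * R) ^ i / fact i * (G / 2)" for i
  proof -
    have "x / f * ((y * f / r + r * G) / 2) = (x * y / r) * (1 / 2) + x * r / f * (G / 2)" if "f \<noteq> 0" for x y r f :: real
      using that by (simp add: distrib_left add_divide_distrib)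
    thus ?thesis by (simp add: power_mult_distrib power_divide)
  qed
  ultimately show ?thesis by simp
qed

text \<open>The mean inequality between x^i and 1 with s = 1 / R^i. The second moment (2i)! / (2^i
  i!) is at most 2^i i!, because the central binomial coefficient is at most 4^i.\<close>

lemma norm_gauss_wave_integral_le:
  assumes "R > 0"
  shows "(LINT x|lborel. norm (gauss_wave i y x)) \<le> (2 ^ i * fact i / R ^ i + R ^ i * 1) / 2"
proof -
  have "(LINT x|lborel. norm (gauss_wave i y x)) = (LINT x|lborel. std_normal_density x * \<bar>poly (monom 1 i * 1) x\<bar>)"
    by (simp add: norm_gauss_wave poly_monom power_abs)
  also have "\<dots> \<le> (1 / R ^ i * gauss_mean (monom 1 i * monom 1 i) + gauss_mean (1 * 1) / (1 / R ^ i)) / 2"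
    using assms by (intro gauss_mean_abs_mult_le) auto
  also have "gauss_mean (monom 1 i * monom 1 i) = fact (2 * i) / (2 ^ i * fact i)"
    using integral_std_normal_moment_even[of i] by (simp add: gauss_mean_def poly_monom mult_2 power_add)
  also have "gauss_mean (1 * 1) = 1" by (simp add: gauss_mean_1)
  also have "(1 / R ^ i * (fact (2 * i) / (2 ^ i * fact i)) + 1 / (1 / R ^ i)) / 2 \<le> (1 / R ^ i * (2 ^ i * fact i) + R ^ i) / 2"
  proof -
    have "fact (2 * i) = (fact i * fact i * real (2 * i choose i))"
      using binomial_fact_lemma[of i "2 * i"] by (metis (no_types, opaque_lifting) add_diff_cancel_right' le_add2 mult_2 of_nat_fact of_nat_mult)
    also have "\<dots> \<le> fact i * fact i * (2 ^ i * 2 ^ i)"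
    proof (intro mult_left_mono)
      have "real (2 * i choose i) \<le> real (2 ^ (2 * i))" by (intro of_nat_mono binomial_le_pow2)
      thus "real (2 * i choose i) \<le> 2 ^ i * 2 ^ i" by (simp add: mult_2 power_add)
    qed auto
    finally have "fact (2 * i) / (2 ^ i * fact i) \<le> (2 ^ i * fact i :: real)" by (simp add: divide_le_eq mult_ac)
    thus ?thesis using assms by (intro divide_right_mono add_mono mult_left_mono) auto
  qed
  finally show ?thesis by simp
qed

lemma integral_norm_complex_product:
  fixes f g :: "real \<Rightarrow> complex"
  assumes "integrable lborel f" and "integrable lborel g"
  shows "(LINT z|lborel. norm (f (Re z) * g (Im z))) = (LINT x|lborel. norm (f x)) * (LINT x|lborel. norm (g x))"
proof -
  have "(LINT z|lborel. complex_of_real (norm (f (Re z))) * complex_of_real (norm (g (Im z)))) =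
     (LINT x|lborel. complex_of_real (norm (f x))) * (LINT x|lborel. complex_of_real (norm (g x)))"
    using assms by (intro integral_complex_product integrable_of_real integrable_norm)
  hence "complex_of_real (LINT z|lborel. norm (f (Re z)) * norm (g (Im z))) =
     complex_of_real ((LINT x|lborel. norm (f x)) * (LINT x|lborel. norm (g x)))"
    by (simp only: of_real_mult[symmetric] integral_complex_of_real)
  thus ?thesis by (simp only: of_real_eq_iff norm_mult)
qed

lemma fourier2_gauss_mult:
  "fourier2 (\<lambda>x. exp (- (cmod x)\<^sup>2 / 2) * f x) y =
    (LINT x|lborel. gauss_wave 0 (Re y) (Re x) * gauss_wave 0 (Im y) (Im x) * of_real (f x))"
proof -
  have pt: "(1 / (2 * pi)) * (exp (- \<i> * of_real (x \<bullet> y)) * of_real (exp (- (cmod x)\<^sup>2 / 2) * f x)) =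
     gauss_wave 0 (Re y) (Re x) * gauss_wave 0 (Im y) (Im x) * of_real (f x)" for x
  proof -
    have e1: "exp (- (cmod x)\<^sup>2 / 2) = exp (- (Re x)\<^sup>2 / 2) * exp (- (Im x)\<^sup>2 / 2)"
      by (simp add: cmod_power2 add_divide_distrib flip: exp_add)
    have "std_normal_density (Re x) * std_normal_density (Im x) = 1 / (2 * pi) * exp (- (cmod x)\<^sup>2 / 2)"
      unfolding e1 std_normal_density_def by simp
    hence e2: "complex_of_real (1 / (2 * pi) * exp (- (cmod x)\<^sup>2 / 2)) = of_real (std_normal_density (Re x)) * of_real (std_normal_density (Im x))"
      by (simp only: of_real_mult[symmetric])
    have e3: "exp (- \<i> * of_real (x \<bullet> y)) = exp (- (\<i> * of_real (Re x) * of_real (Re y))) * exp (- (\<i> * of_real (Im x) * of_real (Im y)))"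
      by (simp add: inner_complex_def algebra_simps flip: exp_add)
    have "(1 / (2 * pi)) * (exp (- \<i> * of_real (x \<bullet> y)) * of_real (exp (- (cmod x)\<^sup>2 / 2) * f x)) =
       complex_of_real (1 / (2 * pi) * exp (- (cmod x)\<^sup>2 / 2)) * exp (- \<i> * of_real (x \<bullet> y)) * of_real (f x)"
      by (simp add: mult_ac)
    thus ?thesis unfolding e2 e3 gauss_wave_eq by (simp add: mult_ac)
  qed
  have "fourier2 (\<lambda>x. exp (- (cmod x)\<^sup>2 / 2) * f x) y =
     (LINT x|lborel. (1 / (2 * pi)) * (exp (- \<i> * of_real (x \<bullet> y)) * of_real (exp (- (cmod x)\<^sup>2 / 2) * f x)))"
    unfolding fourier2_def by (simp only: integral_mult_right_zero)
  thus ?thesis unfolding pt .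
qed

lemma gauss_wave_mult_power:
  "gauss_wave 0 y x * gauss_wave 0 y' x' * of_real (c * x ^ i * x' ^ j) = of_real c * (gauss_wave i y x * gauss_wave j y' x')"
  by (simp add: gauss_wave_def mult_ac)

lemma fourier2_gauss_exp_series:
  assumes h: "geom_bounded h"
  shows "((\<lambda>(i, j). of_real (h i j / (fact i * fact j)) * (gauss_fourier i (Re y) * gauss_fourier j (Im y))) has_sum
    fourier2 (\<lambda>x. exp (- (cmod x)\<^sup>2 / 2) * exp_series h x) y) UNIV"
proof -
  obtain K C where KC: "K \<ge> 0" "C \<ge> 0" "\<And>i j. \<bar>h i j\<bar> \<le> K * C ^ (i + j)"
    using h unfolding geom_bounded_def by blast
  \<comment> \<open>D = 2 matches the factor 2^i in
    \<open>norm_gauss_wave_integral_le\<close>.\<close>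
  define R where "R = 2 * C * 2 + 1"
  have R0: "R > 0" using KC by (simp add: R_def add_nonneg_pos)
  define s where "s i = C ^ i / fact i * ((2 ^ i * fact i / R ^ i + R ^ i * 1) / 2)" for i
  have s0: "s i \<ge> 0" for i using KC R0 by (simp add: s_def)
  have ss: "s summable_on UNIV" unfolding s_def R_def using KC by (intro gauss_bound_summable_on) auto
  define w where "w p x = of_real (h (fst p) (snd p) / (fact (fst p) * fact (snd p))) * (gauss_wave (fst p) (Re y) (Re x) * gauss_wave (snd p) (Im y) (Im x))" for p x
  have int: "integrable lborel (w p)" for p
    unfolding w_def by (intro integrable_mult_right integral_complex_product gauss_wave_integrable)
  have "(\<lambda>p. integral\<^sup>L lborel (\<lambda>x. norm (w p x))) summable_on UNIV"
  proof (rule summable_on_comparison_test)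
    show "(\<lambda>p. K * (case p of (i, j) \<Rightarrow> s i * s j)) summable_on UNIV"
      by (intro summable_on_cmult_right summable_on_prod_nonneg ss s0)
    show "integral\<^sup>L lborel (\<lambda>x. norm (w p x)) \<le> K * (case p of (i, j) \<Rightarrow> s i * s j)" for p
    proof -
      obtain i j where p: "p = (i, j)" by fastforce
      define A where "A i y = (LINT x|lborel. norm (gauss_wave i y x))" for i y
      have A0: "A i y \<ge> 0" for i y unfolding A_def by simp
      have As: "C ^ i / fact i * A i y \<le> s i" for i y
        unfolding s_def A_def using KC R0 by (intro mult_left_mono norm_gauss_wave_integral_le) auto
      have "integral\<^sup>L lborel (\<lambda>x. norm (w p x)) = \<bar>h i j\<bar> / (fact i * fact j) * (A i (Re y) * A j (Im y))"
        unfolding w_def p norm_mult[of "of_real _"] norm_of_real integral_mult_right_zero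
          integral_norm_complex_product[OF gauss_wave_integrable gauss_wave_integrable] A_def
        by simp
      also have "\<dots> \<le> K * C ^ (i + j) / (fact i * fact j) * (A i (Re y) * A j (Im y))"
        using KC A0 by (intro mult_right_mono divide_right_mono) auto
      also have "\<dots> = K * ((C ^ i / fact i * A i (Re y)) * (C ^ j / fact j * A j (Im y)))"
        by (simp add: power_add)
      also have "\<dots> \<le> K * (s i * s j)"
        using KC A0 s0 by (intro mult_left_mono mult_mono As) auto
      finally show ?thesis by (simp add: p)
    qed
  qed auto
  moreover have "((\<lambda>p. w p x) has_sum gauss_wave 0 (Re y) (Re x) * gauss_wave 0 (Im y) (Im x) * of_real (exp_series h x)) UNIV" for x
  proof -
    have "((\<lambda>p. gauss_wave 0 (Re y) (Re x) * gauss_wave 0 (Im y) (Im x) * of_real (case p of (i, j) \<Rightarrow> h i j / (fact i * fact j) * Re x ^ i * Im x ^ j)) has_sum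
       gauss_wave 0 (Re y) (Re x) * gauss_wave 0 (Im y) (Im x) * of_real (exp_series h x)) UNIV"
      by (intro has_sum_cmult_right has_sum_of_real exp_series_has_sum h)
    thus ?thesis unfolding case_prod_unfold gauss_wave_mult_power w_def .
  qed
  ultimately have "((\<lambda>p. integral\<^sup>L lborel (w p)) has_sum
     (LINT x|lborel. gauss_wave 0 (Re y) (Re x) * gauss_wave 0 (Im y) (Im x) * of_real (exp_series h x))) UNIV"
    by (intro has_sum_integral(2)[OF int])
  moreover have "integral\<^sup>L lborel (w p) = (case p of (i, j) \<Rightarrow> of_real (h i j / (fact i * fact j)) * (gauss_fourier i (Re y) * gauss_fourier j (Im y)))" for p
    unfolding w_def integral_mult_right_zero integral_complex_product(2)[OF gauss_wave_integrable gauss_wave_integrable]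
    by (simp add: gauss_fourier_def case_prod_unfold)
  ultimately show ?thesis unfolding fourier2_gauss_mult by simp
qed

lemma fourier2_gauss_monomials:
  assumes "finite S"
  shows "fourier2 (\<lambda>x. exp (- (cmod x)\<^sup>2 / 2) * (\<Sum>(i, j)\<in>S. c (i, j) * Re x ^ i * Im x ^ j)) y =
    (\<Sum>(i, j)\<in>S. of_real (c (i, j)) * (gauss_fourier i (Re y) * gauss_fourier j (Im y)))"
proof -
  have "fourier2 (\<lambda>x. exp (- (cmod x)\<^sup>2 / 2) * (\<Sum>(i, j)\<in>S. c (i, j) * Re x ^ i * Im x ^ j)) y =
    (LINT x|lborel. (\<Sum>p\<in>S. of_real (c p) * (gauss_wave (fst p) (Re y) (Re x) * gauss_wave (snd p) (Im y) (Im x))))"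
    unfolding fourier2_gauss_mult unfolding case_prod_unfold of_real_sum sum_distrib_left gauss_wave_mult_power by simp
  also have "\<dots> = (\<Sum>p\<in>S. of_real (c p) * (gauss_fourier (fst p) (Re y) * gauss_fourier (snd p) (Im y)))"
    using integral_complex_product[OF gauss_wave_integrable gauss_wave_integrable]
    by (subst Bochner_Integration.integral_sum) (auto simp: gauss_fourier_def)
  finally show ?thesis by (simp add: case_prod_unfold)
qed

text \<open>The growing exponential cancels one of the two Gaussians, leaving two Hermite
  polynomials under a single Gaussian weight.\<close>

definition gauss_fourier_pair :: "nat \<Rightarrow> nat \<Rightarrow> real \<Rightarrow> complex" where
  "gauss_fourier_pair i j t = gauss_fourier i t * gauss_fourier j t * exp (of_real (t\<^sup>2 / 2))"

lemma gauss_fourier_pair_eq: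
  "gauss_fourier_pair i j t = ((- \<i>) ^ (i + j) * of_real (sqrt (2 * pi))) * of_real (std_normal_density t * poly (hermite i * hermite j) t)"
proof -
  have "complex_of_real (exp (- t\<^sup>2 / 2)) * exp (of_real (t\<^sup>2 / 2)) = 1"
    unfolding exp_of_real[symmetric] exp_add[symmetric] by simp
  hence "gauss_fourier_pair i j t = (- \<i>) ^ (i + j) * of_real (exp (- t\<^sup>2 / 2) * poly (hermite i * hermite j) t)"
    unfolding gauss_fourier_pair_def gauss_fourier_eq_hermite
    by (simp add: power_add mult_ac)
  also have "exp (- t\<^sup>2 / 2) * poly (hermite i * hermite j) t = sqrt (2 * pi) * (std_normal_density t * poly (hermite i * hermite j) t)"
    by (simp add: std_normal_density_def)
  finally show ?thesis by (simp only: of_real_mult mult_ac)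
qed

lemma gauss_fourier_pair_integrable: "integrable lborel (gauss_fourier_pair i j)"
  unfolding gauss_fourier_pair_eq
  by (intro integrable_mult_right integrable_of_real gauss_poly_integrable)

lemma gauss_fourier_pair_integral:
  "integral\<^sup>L lborel (gauss_fourier_pair i j) = (if i = j then of_real (sqrt (2 * pi) * (- 1) ^ i * fact i) else 0)"
proof -
  have "integral\<^sup>L lborel (gauss_fourier_pair i j) = ((- \<i>) ^ (i + j) * of_real (sqrt (2 * pi))) * of_real (gauss_mean (hermite i * hermite j))"
    unfolding gauss_fourier_pair_eq gauss_mean_def by (simp only: integral_mult_right_zero integral_complex_of_real)
  moreover have "(- \<i>) ^ (i + i) = (- 1) ^ i" by (simp add: power_add flip: power_mult_distrib)
  ultimately show ?thesis by (simp add: gauss_mean_hermite)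
qed

lemma norm_gauss_fourier_pair_integral_le:
  assumes "R > 0"
  shows "(LINT t|lborel. norm (gauss_fourier_pair i j t)) \<le> sqrt (2 * pi) * ((1 ^ i * fact i / R ^ i + R ^ i * fact j) / 2)"
proof -
  have "(LINT t|lborel. norm (gauss_fourier_pair i j t)) = sqrt (2 * pi) * (LINT t|lborel. std_normal_density t * \<bar>poly (hermite i * hermite j) t\<bar>)"
    by (simp only: gauss_fourier_pair_eq norm_mult norm_of_real norm_power norm_minus_cancel norm_ii power_one mult_1_left
        abs_mult integral_mult_right_zero) simp
  also have "\<dots> \<le> sqrt (2 * pi) * ((1 / R ^ i * gauss_mean (hermite i * hermite i) + gauss_mean (hermite j * hermite j) / (1 / R ^ i)) / 2)"
    using assms by (intro mult_left_mono gauss_mean_abs_mult_le) auto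
  finally show ?thesis by (simp add: gauss_mean_hermite mult_ac)
qed

text \<open>Orthogonality leaves only the term (k, l) of the series for F. The sign is that of the
  factors (-i)^(2k) and (-i)^(2l), and 2 \<pi> is the product of two Gaussian masses.\<close>

lemma fourier_pairing_monomial:
  assumes h: "geom_bounded h"
  defines "F \<equiv> fourier2 (\<lambda>x. exp (- (cmod x)\<^sup>2 / 2) * exp_series h x)"
  shows "integrable lborel (\<lambda>y. F y * (gauss_fourier k (Re y) * gauss_fourier l (Im y)) * exp ((cmod y)\<^sup>2 / 2))"
    and "(LINT y|lborel. F y * (gauss_fourier k (Re y) * gauss_fourier l (Im y)) * exp ((cmod y)\<^sup>2 / 2)) =
      of_real (2 * pi * ((- 1) ^ (k + l) * h k l))"
proof -
  let ?I = "\<lambda>y. F y * (gauss_fourier k (Re y) * gauss_fourier l (Im y)) * exp ((cmod y)\<^sup>2 / 2)"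
  obtain K C where KC: "K \<ge> 0" "C \<ge> 0" "\<And>i j. \<bar>h i j\<bar> \<le> K * C ^ (i + j)"
    using h unfolding geom_bounded_def by blast
  \<comment> \<open>D = 1 here, as the squared norm of He_i is i!; the fixed index m contributes
    only the constant m!.\<close>
  define R where "R = 2 * C * 1 + 1"
  have R0: "R > 0" using KC by (simp add: R_def add_nonneg_pos)
  define s where "s m i = C ^ i / fact i * ((1 ^ i * fact i / R ^ i + R ^ i * fact m) / 2)" for m i
  have s0: "s m i \<ge> 0" for m i using KC R0 by (simp add: s_def)
  have ss: "s m summable_on UNIV" for m unfolding s_def R_def using KC by (intro gauss_bound_summable_on) auto
  define w where "w p y = of_real (h (fst p) (snd p) / (fact (fst p) * fact (snd p))) * (gauss_fourier_pair (fst p) k (Re y) * gauss_fourier_pair (snd p) l (Im y))" for p y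
  have int: "integrable lborel (w p)" for p
    unfolding w_def by (intro integrable_mult_right integral_complex_product gauss_fourier_pair_integrable)
  have sm: "(\<lambda>p. integral\<^sup>L lborel (\<lambda>x. norm (w p x))) summable_on UNIV"
  proof (rule summable_on_comparison_test)
    show "(\<lambda>p. K * (2 * pi) * (case p of (i, j) \<Rightarrow> s k i * s l j)) summable_on UNIV"
      by (intro summable_on_cmult_right summable_on_prod_nonneg ss s0)
    show "integral\<^sup>L lborel (\<lambda>x. norm (w p x)) \<le> K * (2 * pi) * (case p of (i, j) \<Rightarrow> s k i * s l j)" for p
    proof -
      obtain i j where p: "p = (i, j)" by fastforce
      define A where "A m i = (LINT x|lborel. norm (gauss_fourier_pair i m x))" for m i
      have A0: "A m i \<ge> 0" for m i unfolding A_def by simp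
      have As: "C ^ i / fact i * A m i \<le> sqrt (2 * pi) * s m i" for m i
      proof -
        have "C ^ i / fact i * A m i \<le> C ^ i / fact i * (sqrt (2 * pi) * ((1 ^ i * fact i / R ^ i + R ^ i * fact m) / 2))"
          unfolding A_def using KC R0 by (intro mult_left_mono norm_gauss_fourier_pair_integral_le) auto
        thus ?thesis unfolding s_def by (simp only: mult_ac)
      qed
      have "integral\<^sup>L lborel (\<lambda>x. norm (w p x)) = \<bar>h i j\<bar> / (fact i * fact j) * (A k i * A l j)"
        unfolding w_def p norm_mult[of "of_real _"] norm_of_real integral_mult_right_zero
          integral_norm_complex_product[OF gauss_fourier_pair_integrable gauss_fourier_pair_integrable] A_def
        by simp
      also have "\<dots> \<le> K * C ^ (i + j) / (fact i * fact j) * (A k i * A l j)"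
        using KC A0 by (intro mult_right_mono divide_right_mono) auto
      also have "\<dots> = K * ((C ^ i / fact i * A k i) * (C ^ j / fact j * A l j))"
        by (simp add: power_add)
      also have "\<dots> \<le> K * ((sqrt (2 * pi) * s k i) * (sqrt (2 * pi) * s l j))"
        using KC A0 s0 by (intro mult_left_mono mult_mono As) auto
      also have "\<dots> = K * (2 * pi) * (s k i * s l j)" by simp
      finally show ?thesis by (simp add: p)
    qed
  qed auto
  have hs: "((\<lambda>p. w p y) has_sum ?I y) UNIV" for y
  proof -
    have e: "complex_of_real (exp ((cmod y)\<^sup>2 / 2)) = exp (of_real ((Re y)\<^sup>2 / 2)) * exp (of_real ((Im y)\<^sup>2 / 2))"
      by (simp add: cmod_power2 add_divide_distrib exp_add flip: exp_of_real)
    have "((\<lambda>p. (case p of (i, j) \<Rightarrow> of_real (h i j / (fact i * fact j)) * (gauss_fourier i (Re y) * gauss_fourier j (Im y))) *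
        (gauss_fourier k (Re y) * gauss_fourier l (Im y) * exp ((cmod y)\<^sup>2 / 2))) has_sum
       F y * (gauss_fourier k (Re y) * gauss_fourier l (Im y) * exp ((cmod y)\<^sup>2 / 2))) UNIV"
      unfolding F_def by (intro has_sum_cmult_left fourier2_gauss_exp_series h)
    moreover have "(case p of (i, j) \<Rightarrow> of_real (h i j / (fact i * fact j)) * (gauss_fourier i (Re y) * gauss_fourier j (Im y))) *
        (gauss_fourier k (Re y) * gauss_fourier l (Im y) * exp ((cmod y)\<^sup>2 / 2)) = w p y" for p
      unfolding w_def gauss_fourier_pair_def case_prod_unfold e by (simp only: mult_ac)
    ultimately show ?thesis by (simp add: mult.assoc)
  qed
  show "integrable lborel (?I)"
    by (rule has_sum_integral(1)[OF int sm hs])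
  have "((\<lambda>p. integral\<^sup>L lborel (w p)) has_sum
     integral\<^sup>L lborel ?I) UNIV"
    by (rule has_sum_integral(2)[OF int sm hs])
  moreover have iw: "integral\<^sup>L lborel (w p) = (if p = (k, l) then of_real (2 * pi * ((- 1) ^ (k + l) * h k l)) else 0)" for p
  proof -
    have "sqrt (2 * pi) * sqrt (2 * pi) = 2 * pi" by simp
    hence "h k l / (fact k * fact l) * ((sqrt (2 * pi) * (- 1) ^ k * fact k) * (sqrt (2 * pi) * (- 1) ^ l * fact l)) = 2 * pi * ((- 1) ^ (k + l) * h k l)"
      by (simp add: power_add)
    hence "complex_of_real (h k l / (fact k * fact l)) * (of_real (sqrt (2 * pi) * (- 1) ^ k * fact k) * of_real (sqrt (2 * pi) * (- 1) ^ l * fact l)) = of_real (2 * pi * ((- 1) ^ (k + l) * h k l))"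
      by (simp only: of_real_mult[symmetric])
    thus ?thesis
      unfolding w_def integral_mult_right_zero
        integral_complex_product(2)[OF gauss_fourier_pair_integrable gauss_fourier_pair_integrable] gauss_fourier_pair_integral
      by (cases p) (auto simp del: of_real_mult of_real_divide)
  qed
  moreover have "((\<lambda>p. integral\<^sup>L lborel (w p)) has_sum of_real (2 * pi * ((- 1) ^ (k + l) * h k l))) UNIV"
    unfolding iw by (rule has_sum_finite_neutralI[where B = "{(k, l)}"]) auto
  ultimately show "integral\<^sup>L lborel ?I =
      of_real (2 * pi * ((- 1) ^ (k + l) * h k l))"
    using has_sum_unique by blast
qed

lemma fourier_pairing:
  assumes h: "geom_bounded h" and S: "finite S"
    and p: "\<And>x. p x = (\<Sum>(i, j)\<in>S. c (i, j) * Re x ^ i * Im x ^ j)"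
  shows "(1 / (2 * pi)) * integral\<^sup>L lborel (\<lambda>y.
      fourier2 (\<lambda>x. exp (- (cmod x)\<^sup>2 / 2) * exp_series h x) y *
      fourier2 (\<lambda>x. exp (- (cmod x)\<^sup>2 / 2) * p x) y * exp ((cmod y)\<^sup>2 / 2)) =
    complex_of_real (\<Sum>(i, j)\<in>S. c (i, j) * ((- 1) ^ (i + j) * h i j))"
proof -
  define F where "F = fourier2 (\<lambda>x. exp (- (cmod x)\<^sup>2 / 2) * exp_series h x)"
  have fp: "fourier2 (\<lambda>x. exp (- (cmod x)\<^sup>2 / 2) * p x) y =
      (\<Sum>(i, j)\<in>S. of_real (c (i, j)) * (gauss_fourier i (Re y) * gauss_fourier j (Im y)))" for y
    unfolding p by (rule fourier2_gauss_monomials[OF S])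
  have "integral\<^sup>L lborel (\<lambda>y. F y * fourier2 (\<lambda>x. exp (- (cmod x)\<^sup>2 / 2) * p x) y * exp ((cmod y)\<^sup>2 / 2)) =
     (LINT y|lborel. (\<Sum>q\<in>S. of_real (c q) * (F y * (gauss_fourier (fst q) (Re y) * gauss_fourier (snd q) (Im y)) * exp ((cmod y)\<^sup>2 / 2))))"
    unfolding fp case_prod_unfold sum_distrib_left sum_distrib_right by (simp add: mult_ac)
  also have "\<dots> = (\<Sum>q\<in>S. of_real (c q) * of_real (2 * pi * ((- 1) ^ (fst q + snd q) * h (fst q) (snd q))))"
    using fourier_pairing_monomial[OF h] unfolding F_def[symmetric]
    by (subst Bochner_Integration.integral_sum) auto
  also have "\<dots> = of_real (2 * pi * (\<Sum>(i, j)\<in>S. c (i, j) * ((- 1) ^ (i + j) * h i j)))"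
    unfolding case_prod_unfold sum_distrib_left of_real_sum
    by (intro sum.cong refl) (simp only: of_real_mult[symmetric] prod.collapse mult_ac)
  finally show ?thesis unfolding F_def by simp
qed

theorem mainTheorem16:
  fixes k :: nat and a b :: real and p :: "complex \<Rightarrow> real"
    and V :: "(complex \<Rightarrow> real) \<Rightarrow> (complex \<Rightarrow> real)"
  assumes "k \<ge> 2" and "a > 0" and "b > 0"
    and "polyfun p"
    and "\<And>j z. j < 2 * k \<Longrightarrow> p (dih_refl k j z) = p z"
    and "is_intertwiner k a b V"
  shows "(\<forall>z u v. u \<in> {-1..1} \<longrightarrow> v \<in> {-1..1} \<longrightarrow>
           (\<exists>c :: nat \<times> nat \<Rightarrow> real. \<forall>w.
              ((\<lambda>(i,j). c (i,j) * Re w ^ i * Im w ^ j) has_sum J_uv k a b u v z w) UNIV))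
    \<and> (\<forall>z. V p z =
         (LINT v:{-1..1}|lborel. nu_const b * (1 - v\<^sup>2) powr (b - 1) *
           (LINT u:{-1..1}|lborel. nu_const a * (1 - u\<^sup>2) powr (a - 1) * p_uv k a b p u v z)))
    \<and> (\<forall>z u v. u \<in> {-1..1} \<longrightarrow> v \<in> {-1..1} \<longrightarrow>
         complex_of_real (p_uv k a b p u v z) =
           (1 / (2 * pi)) * integral\<^sup>L lborel (\<lambda>y.
              fourier2 (\<lambda>x. exp (- (cmod x)\<^sup>2 / 2) * J_uv k a b u v z x) y *
              fourier2 (\<lambda>x. exp (- (cmod x)\<^sup>2 / 2) * p x) y *
              exp ((cmod y)\<^sup>2 / 2)))"
proof (intro conjI allI impI)
  have k: "k > 0" using assms(1) by simp
  have ab: "a + b > 0" using assms(2,3) by simp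
  define h where "h u v z = kern_coeff k (a + b) (\<lambda>l l'. v ^ l * u ^ l') z" for u v z
  have J: "J_uv k a b u v z = exp_series (h u v z)" and gb: "geom_bounded (h u v z)"
    if "u \<in> {-1..1}" "v \<in> {-1..1}" for u v z
    using J_uv_eq_exp_series[OF k ab, of u v z] that unfolding h_def by (auto simp: abs_le_iff)
  show "\<exists>c :: nat \<times> nat \<Rightarrow> real. \<forall>w.
      ((\<lambda>(i,j). c (i,j) * Re w ^ i * Im w ^ j) has_sum J_uv k a b u v z w) UNIV"
    if "u \<in> {-1..1}" "v \<in> {-1..1}" for z u v
    unfolding J[OF that]
    by (rule exI[of _ "\<lambda>(i, j). h u v z i j / (fact i * fact j)"]) (use exp_series_has_sum[OF gb[OF that]] in simp)
  show "V p z = (LINT v:{-1..1}|lborel. nu_const b * (1 - v\<^sup>2) powr (b - 1) *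
      (LINT u:{-1..1}|lborel. nu_const a * (1 - u\<^sup>2) powr (a - 1) * p_uv k a b p u v z))" for z
    unfolding double_integral_p_uv[OF k assms(2-4)]
    by (rule intertwiner_invariant[OF k assms(2,3,6,4)]) (rule assms(5))
  show "complex_of_real (p_uv k a b p u v z) = (1 / (2 * pi)) * integral\<^sup>L lborel (\<lambda>y.
      fourier2 (\<lambda>x. exp (- (cmod x)\<^sup>2 / 2) * J_uv k a b u v z x) y *
      fourier2 (\<lambda>x. exp (- (cmod x)\<^sup>2 / 2) * p x) y * exp ((cmod y)\<^sup>2 / 2))"
    if uv: "u \<in> {-1..1}" "v \<in> {-1..1}" for z u v
  proof -
    define c where "c = poly_coeffs p"
    define S where "S = {ij. c ij \<noteq> 0}"
    have rep: "poly_rep c p" unfolding c_def by (rule poly_rep_poly_coeffs[OF assms(4)])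
    hence S: "finite S" by (simp add: S_def poly_rep_def)
    \<comment> \<open>The pairing of two monomials of degree n carries the sign \<open>(- 1) ^ n\<close>; since p is even,
      the twisted coefficients also represent p and cancel it.\<close>
    define c' where "c' = (\<lambda>(i, j). (- 1) ^ (i + j) * c (i, j))"
    have "p x = (\<Sum>(i, j)\<in>S. c' (i, j) * Re x ^ i * Im x ^ j)" for x
    proof -
      \<comment> \<open>Reflection k sends \<open>cnj x\<close> to \<open>- x\<close>, so invariance
        under the reflections 0 and k makes p even.\<close>
      have "p x = p (- x)"
        using assms(5)[of k "cnj x"] assms(5)[of 0 x] k by (simp add: dih_refl_def)
      also have "\<dots> = (\<Sum>(i, j)\<in>S. c (i, j) * Re (- x) ^ i * Im (- x) ^ j)"
        unfolding S_def using rep by (simp add: poly_rep_def)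
      also have "\<dots> = (\<Sum>(i, j)\<in>S. c' (i, j) * Re x ^ i * Im x ^ j)"
        unfolding uminus_complex.simps power_minus[of "Re x"] power_minus[of "Im x"]
        by (simp add: c'_def power_add mult_ac)
      finally show ?thesis .
    qed
    note pairing = fourier_pairing[OF gb[OF uv] S this]
    have "\<bar>u\<bar> \<le> 1" "\<bar>v\<bar> \<le> 1" using uv by auto
    hence "p_uv k a b p u v z = (\<Sum>(i, j)\<in>S. c (i, j) * h u v z i j)"
      unfolding S_def c_def h_def by (rule p_uv_eq_sum_kern_coeff[OF k ab])
    also have "\<dots> = (\<Sum>(i, j)\<in>S. c' (i, j) * ((- 1) ^ (i + j) * h u v z i j))"
    proof -
      have "((- 1) ^ n * x) * ((- 1) ^ n * y) = x * y" for n and x y :: real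
        by (cases "even n") auto
      hence "c' (i, j) * ((- 1) ^ (i + j) * h u v z i j) = c (i, j) * h u v z i j" for i j
        by (simp only: c'_def prod.case)
      thus ?thesis by (simp only:)
    qed
    finally show ?thesis unfolding J[OF uv] pairing by simp
  qed
qed

end
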